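(* Let $I_h^{cr}\colon U^{cr}_\ell(\mathcal{T}_h)\to\mathbb{R}\cup\{+\infty\}$ and $D_h^{rt}\colon Z^{rt}_\ell(\mathcal{T}_h)\to\mathbb{R}\cup\{-\infty\}$ be the discrete primal and discrete dual functionals defined in the context. The following statements apply: (i) If $\phi_h(x,\cdot)\in C^1(\mathbb{R}^{\ell\times d})$ and $\psi_h(x,\cdot)\in C^1(\mathbb{R}^\ell)$ for a.e. $x\in\Omega$, then, given a minimizer $u_h^{cr}\in U^{cr}_\ell(\mathcal{T}_h)$ of $I_h^{cr}$, a maximizer $z_h^{rt}\in Z^{rt}_\ell(\mathcal{T}_h)$ of $D_h^{rt}$ is given by $$z_h^{rt}=D\phi_h(\cdot,\nabla_hu_h^{cr})+\frac{D\psi_h(\cdot,\Pi_hu_h^{cr})}{d}\otimes(\mathrm{id}_{\mathbb{R}^d}-\Pi_h\mathrm{id}_{\mathbb{R}^d})\quad\text{a.e. in }\Omega,$$ and the discrete strong duality relation $I_h^{cr}(u_h^{cr})=D_h^{rt}(z_h^{rt})$ applies. (ii) If $\phi_h^*(x,\cdot)\in C^1(\mathbb{R}^{\ell\times d})$ and $\psi_h^*(x,\cdot)\in C^1(\mathbb{R}^\ell)$ for a.e. $x\in\Omega$, then, given a maximizer $z_h^{rt}\in Z^{rt}_\ell(\mathcal{T}_h)$ of $D_h^{rt}$, a minimizer $u_h^{cr}\in U^{cr}_\ell(\mathcal{T}_h)$ of $I_h^{cr}$ is given by $$u_h^{cr}=D\psi_h^*(\cdot,\mathrm{div}\,z_h^{rt})+D\phi_h^*(\cdot,\Pi_hz_h^{rt})(\mathrm{id}_{\mathbb{R}^d}-\Pi_h\mathrm{id}_{\mathbb{R}^d})\quad\text{a.e.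 in }\Omega,$$ and the discrete strong duality relation $I_h^{cr}(u_h^{cr})=D_h^{rt}(z_h^{rt})$ applies.
   Context: Setting. $\Omega\subseteq\mathbb{R}^d$, $d\in\mathbb{N}$, is a bounded simplicial (polyhedral) Lipschitz domain with outward unit normal $n$; $\partial\Omega=\Gamma_D\,\dot\cup\,\Gamma_N$ (disjoint), each of $\Gamma_D,\Gamma_N$ being empty or of positive surface measure; $\ell\in\mathbb{N}$. $\mathcal{T}_h$ is a conforming triangulation of $\Omega$ into simplices, $\mathcal{S}_h$ its set of sides ($(d-1)$-dimensional faces), $\mathcal{S}_h^i$ the interior sides, and $\mathcal{S}_h^{\gamma}$ the sides $S$ whose interior is contained in $\gamma\in\{\Gamma_D,\Gamma_N\}$; every boundary side belongs to $\mathcal{S}_h^{\Gamma_D}$ or $\mathcal{S}_h^{\Gamma_N}$. Discrete spaces and operators. $\mathcal{L}^k(\mathcal{T}_h)$: functions that are polynomials of degree at most $k$ on each $T\in\mathcal{T}_h$; $\mathcal{L}^0(\mathcal{M}_h)$: side-wise constant functions on a set of sides $\mathcal{M}_h$. $\Pi_h$ is the element-wise mean ($L^2$-projection onto element-wise constants, acting componentwise), $\pi_h$ the side-wise mean, $\nabla_h$ the element-wise gradient. $[\![\cdot]\!]_S$ denotes the jump across an interior side $S$. The Crouzeix--Raviart space is $\mathcal{S}^{1,cr}(\mathcal{T}_h)=\{v_h\in\mathcal{L}^1(\mathcal{T}_h):\pi_h[\![v_h]\!]_S=0\ \forall S\in\mathcal{S}_h^i\}$ and $U^{cr}_\ell(\mathcal{T}_h)=(\mathcal{S}^{1,cr}(\mathcal{T}_h))^\ell$.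 The lowest-order Raviart--Thomas space is $\mathcal{R}T^0(\mathcal{T}_h)=\{y_h\in(\mathcal{L}^1(\mathcal{T}_h))^d: y_h|_T\cdot n_T\text{ is constant on each side of }T\ \forall T\in\mathcal{T}_h,\ [\![y_h\cdot n]\!]_S=0\ \forall S\in\mathcal{S}_h^i\}$, where $n_T$ is the outward unit normal of $T$, and $Z^{rt}_\ell(\mathcal{T}_h)$ is the space of $\ell\times d$ tensor fields all of whose rows lie in $\mathcal{R}T^0(\mathcal{T}_h)$; divergence is taken row-wise. $\mathrm{id}_{\mathbb{R}^d}$ is the field $x\mapsto x$, $(a\otimes b)_{ij}=a_ib_j$, $D\phi_h, D\psi_h,D\phi_h^*,D\psi_h^*$ are the gradients with respect to the second argument, and in (ii) a matrix in $\mathbb{R}^{\ell\times d}$ is applied to a vector in $\mathbb{R}^d$. $(\cdot,\cdot)_M$ is the $L^2$ inner product on $M$. Densities and data. $\phi_h\colon\Omega\times\mathbb{R}^{\ell\times d}\to\mathbb{R}\cup\{+\infty\}$ and $\psi_h\colon\Omega\times\mathbb{R}^\ell\to\mathbb{R}\cup\{+\infty\}$ are such that $\phi_h(x,\cdot),\psi_h(x,\cdot)$ are proper, convex and lower semi-continuous for a.e. $x\in\Omega$, and $\phi_h(\cdot,r),\psi_h(\cdot,s)$ are element-wise constant for all $r\in\mathbb{R}^{\ell\times d}$, $s\in\mathbb{R}^\ell$. $\phi_h^*,\psi_h^*$ are the Fenchel conjugates with respect to the second argument. $g_h\in(\mathcal{L}^0(\mathcal{S}_h^{\Gamma_N}))^\ell$,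 $u_D^h\in(\mathcal{L}^0(\mathcal{S}_h^{\Gamma_D}))^\ell$. Functionals. For $v_h\in U^{cr}_\ell(\mathcal{T}_h)$, $$I_h^{cr}(v_h)=\int_\Omega\phi_h(\cdot,\nabla_hv_h)\,\mathrm{d}x+\int_\Omega\psi_h(\cdot,\Pi_hv_h)\,\mathrm{d}x-(g_h,\pi_hv_h)_{\Gamma_N}+I^{\Gamma_D}_{\{u_D^h\}}(\pi_hv_h),$$ where $I^{\Gamma_D}_{\{u_D^h\}}(\pi_hv_h)=0$ if $\pi_hv_h=u_D^h$ on $\Gamma_D$ and $+\infty$ otherwise. For $y_h\in Z^{rt}_\ell(\mathcal{T}_h)$, $$D_h^{rt}(y_h)=-\int_\Omega\phi_h^*(\cdot,\Pi_hy_h)\,\mathrm{d}x-\int_\Omega\psi_h^*(\cdot,\mathrm{div}\,y_h)\,\mathrm{d}x+(y_hn,u_D^h)_{\Gamma_D}-I^{\Gamma_N}_{\{g_h\}}(y_hn),$$ where $I^{\Gamma_N}_{\{g_h\}}(y_hn)=0$ if $y_hn=g_h$ on $\Gamma_N$ and $+\infty$ otherwise. It is a standing assumption that $I_h^{cr}$ admits at least one minimizer and $D_h^{rt}$ at least one maximizer. *)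

theory Defs
  imports "HOL-Analysis.Analysis"
begin

section \<open>Domain, triangulation, sides\<close>

text \<open>Near each boundary point and in the direction of a suitable unit vector \<open>e\<close>, the domain is
  the strict epigraph of a Lipschitz function on the hyperplane orthogonal to \<open>e\<close>.\<close>

definition bounded_lipschitz_domain :: "'a::euclidean_space set \<Rightarrow> bool" where
  "bounded_lipschitz_domain \<Omega> \<longleftrightarrow>
     open \<Omega> \<and> connected \<Omega> \<and> \<Omega> \<noteq> {} \<and> bounded \<Omega> \<and>
     (\<forall>p\<in>frontier \<Omega>. \<exists>r>0. \<exists>e L \<gamma>.
        norm e = 1 \<and> L-lipschitz_on {y. y \<bullet> e = 0} \<gamma> \<and>
        \<Omega> \<inter> ball p r = {x \<in> ball p r. \<gamma> (x - (x \<bullet> e) *\<^sub>R e) < x \<bullet> e})"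

text \<open>Elements are closed simplices; conformity is part of \<^const>\<open>triangulation\<close>.\<close>

definition conforming_triangulation :: "'a::euclidean_space set set \<Rightarrow> 'a set \<Rightarrow> bool" where
  "conforming_triangulation \<T> \<Omega> \<longleftrightarrow>
     triangulation \<T> \<and> (\<forall>T\<in>\<T>. int DIM('a) simplex T) \<and> \<Union>\<T> = closure \<Omega>"

definition sides :: "'a::euclidean_space set set \<Rightarrow> 'a set set" where
  "sides \<T> = {S. \<exists>T\<in>\<T>. S facet_of T}"

text \<open>\<open>A = \<Omega>\<close> gives the interior sides, \<open>A = frontier \<Omega>\<close> the boundary sides, and
  \<open>A\<close> the Dirichlet or Neumann part of the boundary the sides on that part.\<close>

definition sides_in :: "'a::euclidean_space set set \<Rightarrow> 'a set \<Rightarrow> 'a set set" where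
  "sides_in \<T> A = {S \<in> sides \<T>. rel_interior S \<subseteq> A}"

definition outer_normal :: "'a::euclidean_space set \<Rightarrow> 'a set \<Rightarrow> 'a" where
  "outer_normal T S = (THE n. norm n = 1 \<and> (\<forall>x\<in>S. \<forall>y\<in>T. n \<bullet> (y - x) \<le> 0))"

definition boundary_elem :: "'a::euclidean_space set set \<Rightarrow> 'a set \<Rightarrow> 'a set" where
  "boundary_elem \<T> S = (THE T. T \<in> \<T> \<and> S facet_of T)"

section \<open>Surface measure\<close>

text \<open>The (d-1)-dimensional Lebesgue measure on a side \<open>S\<close>: a subset of the hyperplane of \<open>S\<close> is
  measured by the d-dimensional volume of the right cylinder of height one over it.  For d = 1
  this is the counting measure on a point.\<close>

definition side_normal :: "'a::euclidean_space set \<Rightarrow> 'a" where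
  "side_normal S = (SOME n. norm n = 1 \<and> (\<forall>x\<in>S. \<forall>y\<in>S. n \<bullet> (y - x) = 0))"

definition side_cylinder :: "'a::euclidean_space set \<Rightarrow> 'a set" where
  "side_cylinder S = {x + t *\<^sub>R side_normal S | x t. x \<in> S \<and> 0 \<le> t \<and> t \<le> 1}"

definition side_measure :: "'a::euclidean_space set \<Rightarrow> 'a measure" where
  "side_measure S =
     completion (distr (restrict_space lborel (side_cylinder S)) borel (closest_point (affine hull S)))"

definition surface_measure :: "'a::euclidean_space set set \<Rightarrow> 'a set \<Rightarrow> 'a set \<Rightarrow> ennreal" where
  "surface_measure \<T> \<Omega> A = (\<Sum>S\<in>sides_in \<T> (frontier \<Omega>). emeasure (side_measure S) (A \<inter> S))"

definition side_mean ::
  "'a::euclidean_space set \<Rightarrow> ('a \<Rightarrow> 'b::{banach, second_countable_topology}) \<Rightarrow> 'b" where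
  "side_mean S f =
     (1 / measure (side_measure S) S) *\<^sub>R (\<integral>x. indicator S x *\<^sub>R f x \<partial>side_measure S)"

section \<open>Piecewise polynomial functions\<close>

text \<open>A piecewise polynomial function is a function on the whole space of which only the values in
  the interiors of the elements matter; its restriction to a closed element \<open>T\<close>, in particular its
  values on the sides of \<open>T\<close>, is the continuous extension \<open>elem_trace T v\<close>.\<close>

definition polynomial_deg :: "nat \<Rightarrow> (real^'d \<Rightarrow> real) \<Rightarrow> bool" where
  "polynomial_deg k p \<longleftrightarrow>
     (\<exists>c :: ('d \<Rightarrow> nat) \<Rightarrow> real.
        p = (\<lambda>x. \<Sum>\<alpha>\<in>{\<alpha>. sum \<alpha> UNIV \<le> k}. c \<alpha> * (\<Prod>i\<in>UNIV. (x $ i) ^ \<alpha> i)))"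

definition broken_poly :: "nat \<Rightarrow> (real^'d) set set \<Rightarrow> (real^'d \<Rightarrow> real) set" where
  "broken_poly k \<T> = {v. \<forall>T\<in>\<T>. \<exists>p. polynomial_deg k p \<and> (\<forall>x\<in>interior T. v x = p x)}"

definition elem_trace :: "'a::euclidean_space set \<Rightarrow> ('a \<Rightarrow> 'b::t2_space) \<Rightarrow> 'a \<Rightarrow> 'b" where
  "elem_trace T v x = Lim (at x within interior T) v"

definition elementwise_constant :: "'a::euclidean_space set set \<Rightarrow> ('a \<Rightarrow> 'b) \<Rightarrow> bool" where
  "elementwise_constant \<T> f \<longleftrightarrow> (\<forall>T\<in>\<T>. f constant_on interior T)"

definition sidewise_constant :: "'a::euclidean_space set set \<Rightarrow> ('a \<Rightarrow> 'b) \<Rightarrow> bool" where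
  "sidewise_constant M f \<longleftrightarrow> (\<forall>S\<in>M. f constant_on rel_interior S)"

definition Pi_h :: "'a::euclidean_space set set \<Rightarrow> ('a \<Rightarrow> 'b::{banach, second_countable_topology})
    \<Rightarrow> 'a \<Rightarrow> 'b" where
  "Pi_h \<T> v x = (let T = (THE T. T \<in> \<T> \<and> x \<in> interior T)
                 in (1 / measure lebesgue T) *\<^sub>R integral\<^sup>L (lebesgue_on T) v)"

text \<open>Side-wise mean on a boundary side, where the adjacent element is unique.  The mean of a jump across
  an interior side is written with \<open>side_mean\<close> directly.\<close>

definition pi_h :: "'a::euclidean_space set set \<Rightarrow> ('a \<Rightarrow> 'b::{banach, second_countable_topology})
    \<Rightarrow> 'a set \<Rightarrow> 'b" where
  "pi_h \<T> v S = side_mean S (elem_trace (boundary_elem \<T> S) v)"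

text \<open>Classical derivatives at points in the interiors of elements.  For tensor fields in \<open>Z_rt\<close> the
  row-wise distributional divergence is this element-wise one, almost everywhere.\<close>

definition grad_h :: "(real^'d \<Rightarrow> real^'l) \<Rightarrow> real^'d \<Rightarrow> real^'d^'l" where
  "grad_h v x = jacobian v (at x)"

definition div_h :: "(real^'d \<Rightarrow> real^'d^'l) \<Rightarrow> real^'d \<Rightarrow> real^'l" where
  "div_h y x = (\<chi> i. trace (jacobian (\<lambda>x. y x $ i) (at x)))"

definition crouzeix_raviart :: "(real^'d) set set \<Rightarrow> (real^'d) set \<Rightarrow> (real^'d \<Rightarrow> real) set" where
  "crouzeix_raviart \<T> \<Omega> =
     {v \<in> broken_poly 1 \<T>.
        \<forall>S\<in>sides_in \<T> \<Omega>. \<forall>T\<in>\<T>. \<forall>T'\<in>\<T>. T \<noteq> T' \<and> S facet_of T \<and> S facet_of T' \<longrightarrow>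
          side_mean S (\<lambda>x. elem_trace T v x - elem_trace T' v x) = 0}"

definition U_cr :: "(real^'d) set set \<Rightarrow> (real^'d) set \<Rightarrow> (real^'d \<Rightarrow> real^'l) set" where
  "U_cr \<T> \<Omega> = {v. \<forall>i. (\<lambda>x. v x $ i) \<in> crouzeix_raviart \<T> \<Omega>}"

definition raviart_thomas :: "(real^'d) set set \<Rightarrow> (real^'d) set \<Rightarrow> (real^'d \<Rightarrow> real^'d) set" where
  "raviart_thomas \<T> \<Omega> =
     {y. (\<forall>j. (\<lambda>x. y x $ j) \<in> broken_poly 1 \<T>) \<and>
         (\<forall>T\<in>\<T>. \<forall>S. S facet_of T \<longrightarrow> (\<lambda>x. elem_trace T y x \<bullet> outer_normal T S) constant_on S) \<and>
         (\<forall>S\<in>sides_in \<T> \<Omega>. \<forall>T\<in>\<T>. \<forall>T'\<in>\<T>. T \<noteq> T' \<and> S facet_of T \<and> S facet_of T' \<longrightarrow>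
            (\<forall>x\<in>S. elem_trace T y x \<bullet> outer_normal T S + elem_trace T' y x \<bullet> outer_normal T' S = 0))}"

definition Z_rt :: "(real^'d) set set \<Rightarrow> (real^'d) set \<Rightarrow> (real^'d \<Rightarrow> real^'d^'l) set" where
  "Z_rt \<T> \<Omega> = {y. \<forall>i. (\<lambda>x. y x $ i) \<in> raviart_thomas \<T> \<Omega>}"

text \<open>\<open>y n\<close> on a boundary side \<open>S\<close>, where the outward normal of the domain is that of the
  adjacent element.\<close>

definition normal_trace ::
  "(real^'d) set set \<Rightarrow> (real^'d \<Rightarrow> real^'d^'l) \<Rightarrow> (real^'d) set \<Rightarrow> real^'d \<Rightarrow> real^'l" where
  "normal_trace \<T> y S x =
     (let T = boundary_elem \<T> S in elem_trace T y x *v outer_normal T S)"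

section \<open>Convex analysis\<close>

definition proper_convex_lsc :: "('a::euclidean_space \<Rightarrow> ereal) \<Rightarrow> bool" where
  "proper_convex_lsc f \<longleftrightarrow>
     ((\<forall>r. f r \<noteq> -\<infinity>) \<and> (\<exists>r. f r \<noteq> \<infinity>)) \<and>
     (\<forall>r s. \<forall>t\<in>{0<..<1}. f ((1 - t) *\<^sub>R r + t *\<^sub>R s) \<le> ereal (1 - t) * f r + ereal t * f s) \<and>
     (\<forall>r. f r \<le> Liminf (at r) f)"

definition fenchel :: "('a::euclidean_space \<Rightarrow> ereal) \<Rightarrow> 'a \<Rightarrow> ereal" where
  "fenchel f s = (SUP r. ereal (s \<bullet> r) - f r)"

definition C1 :: "('a::euclidean_space \<Rightarrow> ereal) \<Rightarrow> bool" where
  "C1 f \<longleftrightarrow> (\<forall>r. \<bar>f r\<bar> \<noteq> \<infinity>) \<and>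
     (\<exists>G. continuous_on UNIV G \<and> (\<forall>r. GDERIV (\<lambda>s. real_of_ereal (f s)) r :> G r))"

definition gradient :: "('a::euclidean_space \<Rightarrow> ereal) \<Rightarrow> 'a \<Rightarrow> 'a" where
  "gradient f r = (THE D. GDERIV (\<lambda>s. real_of_ereal (f s)) r :> D)"

definition tensor :: "real^'l \<Rightarrow> real^'d \<Rightarrow> real^'d^'l" (infixl "\<otimes>\<^sub>t" 75) where
  "a \<otimes>\<^sub>t b = (\<chi> i j. a $ i * b $ j)"

section \<open>The functionals\<close>

text \<open>Lebesgue integral of an extended real function as the integral of the positive part minus
  that of the negative part (\<^const>\<open>e2ennreal\<close> truncates at 0).\<close>

definition eintegral :: "'a measure \<Rightarrow> ('a \<Rightarrow> ereal) \<Rightarrow> ereal" where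
  "eintegral M f =
     enn2ereal (\<integral>\<^sup>+ x. e2ennreal (f x) \<partial>M) - enn2ereal (\<integral>\<^sup>+ x. e2ennreal (- f x) \<partial>M)"

text \<open>Inner product in the square integrable functions on the union of a set of sides, of functions
  that may be given side by side.\<close>

definition L2_sides :: "'a::euclidean_space set set \<Rightarrow> ('a set \<Rightarrow> 'a \<Rightarrow> 'b::euclidean_space) \<Rightarrow>
    ('a set \<Rightarrow> 'a \<Rightarrow> 'b) \<Rightarrow> real" where
  "L2_sides M f g = (\<Sum>S\<in>M. \<integral>x. indicator S x *\<^sub>R (f S x \<bullet> g S x) \<partial>side_measure S)"

text \<open>Indicator functional of equality in the interiors of the given sides, i.e. up to a null set of
  their union.\<close>

definition I_sides ::
  "'a::euclidean_space set set \<Rightarrow> ('a set \<Rightarrow> 'a \<Rightarrow> 'b) \<Rightarrow> ('a set \<Rightarrow> 'a \<Rightarrow> 'b) \<Rightarrow> ereal" where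
  "I_sides M f g = (if \<forall>S\<in>M. \<forall>x\<in>rel_interior S. f S x = g S x then 0 else \<infinity>)"

definition I_cr where
  "I_cr \<Omega> \<Gamma>\<^sub>D \<Gamma>\<^sub>N \<T> (\<phi> :: real^'d \<Rightarrow> real^'d^'l \<Rightarrow> ereal) (\<psi> :: real^'d \<Rightarrow> real^'l \<Rightarrow> ereal)
      (g :: real^'d \<Rightarrow> real^'l) (u\<^sub>D :: real^'d \<Rightarrow> real^'l) (v :: real^'d \<Rightarrow> real^'l) =
     eintegral (lebesgue_on \<Omega>) (\<lambda>x. \<phi> x (grad_h v x))
     + eintegral (lebesgue_on \<Omega>) (\<lambda>x. \<psi> x (Pi_h \<T> v x))
     - ereal (L2_sides (sides_in \<T> \<Gamma>\<^sub>N) (\<lambda>S. g) (\<lambda>S x. pi_h \<T> v S))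
     + I_sides (sides_in \<T> \<Gamma>\<^sub>D) (\<lambda>S x. pi_h \<T> v S) (\<lambda>S. u\<^sub>D)"

definition D_rt where
  "D_rt \<Omega> \<Gamma>\<^sub>D \<Gamma>\<^sub>N \<T> (\<phi> :: real^'d \<Rightarrow> real^'d^'l \<Rightarrow> ereal) (\<psi> :: real^'d \<Rightarrow> real^'l \<Rightarrow> ereal)
      (g :: real^'d \<Rightarrow> real^'l) (u\<^sub>D :: real^'d \<Rightarrow> real^'l) (y :: real^'d \<Rightarrow> real^'d^'l) =
     - eintegral (lebesgue_on \<Omega>) (\<lambda>x. fenchel (\<phi> x) (Pi_h \<T> y x))
     - eintegral (lebesgue_on \<Omega>) (\<lambda>x. fenchel (\<psi> x) (div_h y x))
     + ereal (L2_sides (sides_in \<T> \<Gamma>\<^sub>D) (normal_trace \<T> y) (\<lambda>S. u\<^sub>D))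
     - I_sides (sides_in \<T> \<Gamma>\<^sub>N) (normal_trace \<T> y) (\<lambda>S. g)"

end

theory Submission
  imports Defs
begin

text \<open>
  On an element \<open>T\<close> a Crouzeix-Raviart function \<open>v\<close> is given by its gradient and its value at the
  centroid, or else by its means over the sides of \<open>T\<close>; a Raviart-Thomas field \<open>y\<close> is given by its
  value at the centroid and its divergence, or else by its fluxes through the sides.  The two
  descriptions are paired by the Gauss formula
  \<open>\<Sum>\<^sub>S mean\<^sub>S v \<bullet> flux\<^sub>S y = \<bar>T\<bar> (\<nabla>v \<bullet> y(b) + v(b) \<bullet> div y)\<close>, where \<open>b\<close> is the centroid of \<open>T\<close>
  (\<open>integration_by_parts_elem\<close>).

  Centroid data are exactly what the functionals depend on: since the densities are constant on
  elements, both functionals are finite sums over the elements and the boundary sides.  Side data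
  are exactly what the definitions of the two spaces restrict: means agree and fluxes cancel across
  an interior side (\<open>U_cr_iff\<close>, \<open>Z_rt_iff\<close>).  Hence the sum of the Gauss formula over all elements
  leaves only the boundary sides, and Young's inequality on each element gives weak duality.  For
  admissible \<open>u\<close> and \<open>z\<close> with equality in Young's inequality on each element, the values of the
  functionals coincide, so that \<open>u\<close> is a minimizer and \<open>z\<close> a maximizer (\<open>strong_duality\<close>).

  In (i) the formula for \<open>z\<close> prescribes the centroid value \<open>D\<phi>(\<nabla>u)\<close> and the divergence
  \<open>D\<psi>(u(b))\<close> on each element, and these values give equality in Young's inequality.  It remains to
  see that the element-wise fields fit together.  Let \<open>S\<close> be a side that is not on the Dirichlet
  part.  The first variation of the primal functional in direction of a Crouzeix-Raviart function
  whose means over all other sides vanish is zero.  By the Gauss formula, applied element by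
  element, this variation is determined by the sum of the fluxes of \<open>z\<close> through \<open>S\<close> out of the
  adjacent elements, minus the load if \<open>S\<close> is a Neumann side (\<open>dual_reconstruction\<close>).  Part (ii) is
  the same argument with the flux basis of the Raviart-Thomas space as directions
  (\<open>primal_reconstruction\<close>); there
  equality in Young's inequality needs that \<open>\<phi>\<close> and \<open>\<psi>\<close> are the conjugates of \<open>\<phi>\<^sup>*\<close> and \<open>\<psi>\<^sup>*\<close>
  (\<open>fenchel_moreau\<close>).

  Two groups of geometric facts enter.  For one simplex, means of affine functions are values at
  centroids, and the area of the side opposite to a vertex is \<open>d \<bar>T\<bar> \<bar>\<nabla>\<lambda>\<bar>\<close>, where \<open>\<lambda>\<close> is the
  barycentric coordinate of that vertex (\<open>side_measure_pyramid\<close>).  For the triangulation, the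
  relative interior of a side lies either in the domain, and then the side belongs to exactly two
  elements, or in the boundary, and then it belongs to exactly one (\<open>elems_cases\<close>).
\<close>

section \<open>Gradients and conjugates of convex functions\<close>

lemma gradient_eqI:
  assumes "GDERIV (\<lambda>s. real_of_ereal (f s)) r :> D"
  shows "gradient f r = D"
  unfolding gradient_def
proof (rule the_equality)
  show "GDERIV (\<lambda>s. real_of_ereal (f s)) r :> D" by fact
next
  fix E assume "GDERIV (\<lambda>s. real_of_ereal (f s)) r :> E"
  then have "(\<lambda>h. h \<bullet> E) = (\<lambda>h. h \<bullet> D)"
    using assms unfolding gderiv_def by (rule has_derivative_unique)
  then show "E = D"
    by (metis vector_eq_rdot inner_commute)
qed

lemma C1_gradient:
  assumes "C1 f"
  shows "GDERIV (\<lambda>s. real_of_ereal (f s)) r :> gradient f r"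
  using assms gradient_eqI unfolding C1_def by metis

lemma C1_finite: "C1 f \<Longrightarrow> f r = ereal (real_of_ereal (f r))"
  by (simp add: C1_def ereal_real)

lemma GDERIV_along_line:
  fixes f :: "'a::euclidean_space \<Rightarrow> real"
  assumes "GDERIV f r :> D"
  shows "((\<lambda>t. f (r + t *\<^sub>R w)) has_real_derivative (w \<bullet> D)) (at 0)"
proof -
  have "((\<lambda>t::real. r + t *\<^sub>R w) has_derivative (\<lambda>t. t *\<^sub>R w)) (at 0)"
    by (auto intro!: derivative_eq_intros)
  then have "((\<lambda>t. f (r + t *\<^sub>R w)) has_derivative (\<lambda>t. (t *\<^sub>R w) \<bullet> D)) (at 0)"
    using assms unfolding gderiv_def
    by (intro has_derivative_compose[where f = "\<lambda>t. r + t *\<^sub>R w" and g = f]) auto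
  then show ?thesis
    unfolding has_field_derivative_def by (simp add: mult_commute_abs)
qed

text \<open>By convexity the difference quotient of \<open>f\<close> along the segment from \<open>r\<close> to \<open>s\<close> is at most
  \<open>f s - f r\<close>; its limit at \<open>r\<close> is the directional derivative.\<close>

lemma subgradient_inequality:
  fixes f :: "'a::euclidean_space \<Rightarrow> real"
  assumes conv: "\<And>r s t. 0 < t \<Longrightarrow> t < 1 \<Longrightarrow> f ((1 - t) *\<^sub>R r + t *\<^sub>R s) \<le> (1 - t) * f r + t * f s"
    and der: "GDERIV f r :> D"
  shows "f r + D \<bullet> (s - r) \<le> f s"
proof -
  have "((\<lambda>t. f (r + t *\<^sub>R (s - r))) has_real_derivative ((s - r) \<bullet> D)) (at 0)"
    by (rule GDERIV_along_line[OF der])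
  then have lim: "((\<lambda>t. (f (r + t *\<^sub>R (s - r)) - f r) / t) \<longlongrightarrow> (s - r) \<bullet> D) (at_right 0)"
    unfolding DERIV_def using tendsto_within_subset[of _ _ 0 UNIV "{0<..}"]
    by simp
  have "(s - r) \<bullet> D \<le> f s - f r"
  proof (rule tendsto_upperbound[OF lim])
    have "eventually (\<lambda>t. t \<in> {0<..<1}) (at_right (0::real))"
      by (rule eventually_at_right_real) simp
    then show "\<forall>\<^sub>F t in at_right 0. (f (r + t *\<^sub>R (s - r)) - f r) / t \<le> f s - f r"
    proof eventually_elim
      case (elim t)
      have "r + t *\<^sub>R (s - r) = (1 - t) *\<^sub>R r + t *\<^sub>R s" by (simp add: algebra_simps)
      then have "f (r + t *\<^sub>R (s - r)) \<le> (1 - t) * f r + t * f s" using conv[of t r s] elim by auto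
      then show ?case using elim by (simp add: field_simps)
    qed
  qed simp
  then show ?thesis by (simp add: inner_commute)
qed

lemma fenchel_upper: "ereal (s \<bullet> r) - f r \<le> fenchel f s"
  unfolding fenchel_def by (rule SUP_upper) simp

lemma fenchel_not_MInf:
  assumes "proper_convex_lsc f" shows "fenchel f s \<noteq> -\<infinity>"
proof -
  obtain r where "f r \<noteq> \<infinity>" "f r \<noteq> -\<infinity>" using assms unfolding proper_convex_lsc_def by blast
  then have "ereal (s \<bullet> r) - f r \<noteq> -\<infinity>" by (cases "f r") auto
  then show ?thesis using fenchel_upper[of s r f] by auto
qed

lemma fenchel_young:
  assumes "proper_convex_lsc f" shows "ereal (s \<bullet> r) \<le> f r + fenchel f s"
proof -
  have "f r \<noteq> -\<infinity>" using assms unfolding proper_convex_lsc_def by blast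
  then show ?thesis using fenchel_upper[of s r f] fenchel_not_MInf[OF assms, of s]
    by (cases "f r"; cases "fenchel f s") auto
qed

text \<open>Equality in Young's inequality: by the subgradient inequality the supremum that defines the
  conjugate at the gradient is attained at \<open>r\<close>.\<close>

lemma fenchel_at_gradient:
  assumes f: "proper_convex_lsc f" and C: "C1 f"
  shows "f r + fenchel f (gradient f r) = ereal (gradient f r \<bullet> r)"
proof -
  define F where "F = (\<lambda>s. real_of_ereal (f s))"
  have fF: "f s = ereal (F s)" for s using C1_finite[OF C] by (simp add: F_def)
  have sub: "F r + gradient f r \<bullet> (s - r) \<le> F s" for s
  proof (rule subgradient_inequality)
    show "GDERIV F r :> gradient f r" using C1_gradient[OF C] unfolding F_def .
    fix p q :: 'a and t :: real assume "0 < t" "t < 1"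
    then have "f ((1 - t) *\<^sub>R p + t *\<^sub>R q) \<le> ereal (1 - t) * f p + ereal t * f q"
      using f unfolding proper_convex_lsc_def by auto
    then show "F ((1 - t) *\<^sub>R p + t *\<^sub>R q) \<le> (1 - t) * F p + t * F q" by (simp add: fF)
  qed
  have "fenchel f (gradient f r) \<le> ereal (gradient f r \<bullet> r - F r)"
    unfolding fenchel_def
  proof (rule SUP_least)
    fix s show "ereal (gradient f r \<bullet> s) - f s \<le> ereal (gradient f r \<bullet> r - F r)"
      using sub[of s] by (simp add: fF inner_diff_right)
  qed
  moreover have "ereal (gradient f r \<bullet> r - F r) \<le> fenchel f (gradient f r)"
    using fenchel_upper[of "gradient f r" r f] by (simp add: fF)
  ultimately have "fenchel f (gradient f r) = ereal (gradient f r \<bullet> r - F r)" by (rule antisym)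
  then show ?thesis by (simp add: fF)
qed

text \<open>This is lower semicontinuity: if \<open>t < c < f r\<close>, then \<open>f\<close> exceeds \<open>c\<close> in a neighbourhood of
  \<open>r\<close>, and a product neighbourhood of \<open>(r, t)\<close> misses the epigraph.\<close>

lemma closed_epigraph:
  assumes f: "proper_convex_lsc f"
  shows "closed {(r, t). f r \<le> ereal t}"
  unfolding closed_def
proof (rule Topological_Spaces.openI)
  fix z assume "z \<in> - {(r, t). f r \<le> ereal t}"
  then obtain r t where z: "z = (r, t)" "ereal t < f r" by (cases z) auto
  obtain c where c: "ereal t < ereal c" "ereal c < f r"
    using z(2) ereal_dense2 by blast
  have "f r \<le> Liminf (at r) f" using f unfolding proper_convex_lsc_def by blast
  then have "eventually (\<lambda>s. ereal c < f s) (at r)"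
    using c(2) less_le_trans by (metis less_LiminfD)
  then have "eventually (\<lambda>s. ereal c < f s) (nhds r)"
    using c(2) by (simp add: eventually_at_filter) (auto elim: eventually_mono)
  then obtain A where A: "open A" "r \<in> A" "\<And>s. s \<in> A \<Longrightarrow> ereal c < f s"
    unfolding eventually_nhds by blast
  show "\<exists>T. open T \<and> z \<in> T \<and> T \<subseteq> - {(r, t). f r \<le> ereal t}"
  proof (intro exI[of _ "A \<times> {..<c}"] conjI)
    show "open (A \<times> {..<c})" using A by (intro open_Times) auto
    show "z \<in> A \<times> {..<c}" using z c A by auto
    show "A \<times> {..<c} \<subseteq> - {(r, t). f r \<le> ereal t}"
    proof
      fix x assume "x \<in> A \<times> {..<c}"
      then obtain s u where x: "x = (s, u)" "s \<in> A" "u < c" by auto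
      then have "ereal u < f s" using A(3)[of s] by (metis less_ereal.simps(1) order.strict_trans)
      then show "x \<in> - {(r, t). f r \<le> ereal t}" by (simp add: x(1))
    qed
  qed
qed

lemma convex_epigraph:
  assumes f: "proper_convex_lsc f"
  shows "convex {(r, t). f r \<le> ereal t}"
proof (rule convexI, clarsimp)
  fix r s :: 'a and a b u v :: real
  assume H: "f r \<le> ereal a" "f s \<le> ereal b" "0 \<le> u" "0 \<le> v" "u + v = 1"
  show "f (u *\<^sub>R r + v *\<^sub>R s) \<le> ereal (u * a + v * b)"
  proof (cases "u = 0 \<or> v = 0")
    case True then show ?thesis using H by auto
  next
    case False
    then have uv: "0 < u" "0 < v" "v < 1" "u = 1 - v" using H by auto
    have "f (u *\<^sub>R r + v *\<^sub>R s) \<le> ereal u * f r + ereal v * f s"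
      using f uv unfolding proper_convex_lsc_def by auto
    also have "\<dots> \<le> ereal u * ereal a + ereal v * ereal b"
      using H uv by (intro add_mono ereal_mult_left_mono) auto
    finally show ?thesis by simp
  qed
qed

text \<open>The inequality of the Fenchel-Moreau theorem that does not hold trivially.  A point \<open>(q, c)\<close>
  below the graph is separated from the epigraph by a hyperplane.  If the hyperplane is not vertical,
  it is the graph of an affine minorant with slope \<open>p\<close>.  A vertical one, \<open>a \<bullet> r > b\<close> on the domain of
  \<open>f\<close>, tilts the constant minorant that comes from the finite value of the conjugate at \<open>0\<close>: the
  multiples \<open>- s *\<^sub>R a\<close> are slopes of minorants whose values at \<open>q\<close> grow without bound.\<close>

lemma fenchel_moreau:
  assumes f: "proper_convex_lsc f" and fin: "\<And>p. fenchel f p \<noteq> \<infinity>"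
    and c: "ereal c < f q"
  shows "\<exists>p. ereal c < ereal (p \<bullet> q) - fenchel f p"
proof -
  let ?E = "{(r, t). f r \<le> ereal t}"
  obtain r0 where r0: "f r0 \<noteq> \<infinity>" "f r0 \<noteq> -\<infinity>" using f unfolding proper_convex_lsc_def by blast
  define t0 where "t0 = real_of_ereal (f r0)"
  have t0: "f r0 = ereal t0" using r0 by (cases "f r0") (auto simp: t0_def)
  have "(q, c) \<notin> ?E" using c by auto
  then obtain z b where zb: "z \<bullet> (q, c) < b" "\<And>x. x \<in> ?E \<Longrightarrow> b < z \<bullet> x"
    using separating_hyperplane_closed_point[OF convex_epigraph[OF f] closed_epigraph[OF f]] by blast
  obtain a \<alpha> where z: "z = (a, \<alpha>)" by (cases z)
  have sep: "a \<bullet> q + \<alpha> * c < b" using zb(1) by (simp add: z)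
  have sepE: "b < a \<bullet> r + \<alpha> * t" if "f r \<le> ereal t" for r t using zb(2)[of "(r,t)"] that by (simp add: z)
  have fin': "\<exists>F. fenchel f p = ereal F" for p
    using fin[of p] fenchel_not_MInf[OF f, of p] by (cases "fenchel f p") auto
  have "\<alpha> \<ge> 0"
  proof (rule ccontr)
    assume "\<not> \<alpha> \<ge> 0"
    \<comment> \<open>far enough up in the epigraph to cross a hyperplane with \<open>\<alpha> < 0\<close>\<close>
    define t where "t = max t0 ((b - a \<bullet> r0) / \<alpha>)"
    have "b < a \<bullet> r0 + \<alpha> * t" by (rule sepE) (simp add: t0 t_def)
    moreover have "\<alpha> * t \<le> b - a \<bullet> r0"
    proof -
      have "\<alpha> * t \<le> \<alpha> * ((b - a \<bullet> r0) / \<alpha>)"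
        using \<open>\<not> \<alpha> \<ge> 0\<close> by (intro mult_left_mono_neg) (auto simp: t_def)
      then show ?thesis using \<open>\<not> \<alpha> \<ge> 0\<close> by simp
    qed
    ultimately show False by simp
  qed
  show ?thesis
  proof (cases "\<alpha> = 0")
    case False
    with \<open>\<alpha> \<ge> 0\<close> have pos: "\<alpha> > 0" by simp
    define p where "p = - a /\<^sub>R \<alpha>"
    have "fenchel f p \<le> ereal (- b / \<alpha>)"
      unfolding fenchel_def
    proof (rule SUP_least)
      fix r
      show "ereal (p \<bullet> r) - f r \<le> ereal (- b / \<alpha>)"
      proof (cases "f r")
        case (real t)
        then have "b < a \<bullet> r + \<alpha> * t" by (intro sepE) simp
        moreover have "\<alpha> * (p \<bullet> r) = - (a \<bullet> r)" using pos by (simp add: p_def)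
        ultimately have "p \<bullet> r - t \<le> - b / \<alpha>"
          by (subst pos_le_divide_eq[OF pos]) (simp add: algebra_simps)
        then show ?thesis using real by simp
      next
        case MInf then show ?thesis using f unfolding proper_convex_lsc_def by blast
      qed simp
    qed
    moreover have "c < p \<bullet> q - (- b / \<alpha>)"
    proof -
      have "\<alpha> * (p \<bullet> q) = - (a \<bullet> q)" using pos by (simp add: p_def)
      then have "\<alpha> * c < \<alpha> * (p \<bullet> q - (- b / \<alpha>))" using sep pos by (simp add: algebra_simps)
      then show ?thesis using pos by (simp only: mult_less_cancel_left_pos)
    qed
    ultimately have "ereal c < ereal (p \<bullet> q) - fenchel f p"
      using fin'[of p] by (auto)
    then show ?thesis by blast
  next
    case True
    obtain F where F: "fenchel f 0 = ereal F" using fin' by blast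
    have d: "b - a \<bullet> q > 0" using sep True by simp
    \<comment> \<open>large enough for the tilted minorant to exceed \<open>c\<close> at \<open>q\<close>\<close>
    define s where "s = max 0 ((c + F + 1) / (b - a \<bullet> q))"
    have s: "s \<ge> 0" "s * (b - a \<bullet> q) \<ge> c + F + 1"
      using d by (auto simp: s_def field_simps max_def)
    have "fenchel f (- s *\<^sub>R a) \<le> ereal (F - s * b)"
      unfolding fenchel_def
    proof (rule SUP_least)
      fix r
      show "ereal ((- s *\<^sub>R a) \<bullet> r) - f r \<le> ereal (F - s * b)"
      proof (cases "f r")
        case (real t)
        then have "b < a \<bullet> r + \<alpha> * t" by (intro sepE) simp
        then have "s * b \<le> s * (a \<bullet> r)" using s True by (simp add: mult_left_mono)
        moreover have "- t \<le> F" using fenchel_upper[of 0 r f] F real by simp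
        ultimately show ?thesis using real by simp
      next
        case MInf then show ?thesis using f unfolding proper_convex_lsc_def by blast
      qed simp
    qed
    moreover have "c < (- s *\<^sub>R a) \<bullet> q - (F - s * b)" using s by (simp add: algebra_simps)
    ultimately have "ereal c < ereal ((- s *\<^sub>R a) \<bullet> q) - fenchel f (- s *\<^sub>R a)"
      using fin'[of "- s *\<^sub>R a"] by auto
    then show ?thesis by blast
  qed
qed

text \<open>A conjugate is convex as a supremum of affine functions, so the subgradient inequality
  applies to it.  It says that the supremum that defines the biconjugate at the gradient is attained
  at \<open>s\<close>, and the biconjugate is \<open>f\<close>.\<close>

lemma fenchel_at_conjugate_gradient:
  assumes f: "proper_convex_lsc f" and C: "C1 (fenchel f)"
  shows "f (gradient (fenchel f) s) + fenchel f s = ereal (s \<bullet> gradient (fenchel f) s)"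
proof -
  define F where "F = (\<lambda>s. real_of_ereal (fenchel f s))"
  define q where "q = gradient (fenchel f) s"
  have fF: "fenchel f p = ereal (F p)" for p using C1_finite[OF C] by (simp add: F_def)
  have sub: "F s + q \<bullet> (p - s) \<le> F p" for p
  proof (rule subgradient_inequality)
    show "GDERIV F s :> q" using C1_gradient[OF C] unfolding F_def q_def .
    fix p p' :: 'a and t :: real assume t: "0 < t" "t < 1"
    have "fenchel f ((1 - t) *\<^sub>R p + t *\<^sub>R p') \<le> ereal ((1 - t) * F p + t * F p')"
      unfolding fenchel_def[of f "(1 - t) *\<^sub>R p + t *\<^sub>R p'"]
    proof (rule SUP_least)
      fix r
      show "ereal (((1 - t) *\<^sub>R p + t *\<^sub>R p') \<bullet> r) - f r \<le> ereal ((1 - t) * F p + t * F p')"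
      proof (cases "f r")
        case (real u)
        have "p \<bullet> r - u \<le> F p" "p' \<bullet> r - u \<le> F p'"
          using fenchel_upper[of p r f] fenchel_upper[of p' r f] real by (auto simp: fF)
        then have "(1 - t) * (p \<bullet> r - u) + t * (p' \<bullet> r - u) \<le> (1 - t) * F p + t * F p'"
          using t by (intro add_mono mult_left_mono) auto
        then show ?thesis using real by (simp add: algebra_simps)
      next
        case MInf then show ?thesis using f unfolding proper_convex_lsc_def by blast
      qed simp
    qed
    then show "F ((1 - t) *\<^sub>R p + t *\<^sub>R p') \<le> (1 - t) * F p + t * F p'" by (simp add: fF)
  qed
  have "f q \<le> ereal (s \<bullet> q - F s)"
  proof (rule ccontr)
    assume "\<not> f q \<le> ereal (s \<bullet> q - F s)"
    then obtain p where "ereal (s \<bullet> q - F s) < ereal (p \<bullet> q) - fenchel f p"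
      using fenchel_moreau[OF f] fF by (metis PInfty_neq_ereal(1) not_le)
    then show False using sub[of p] by (simp add: fF inner_commute inner_diff_right)
  qed
  moreover have "ereal (s \<bullet> q) \<le> f q + ereal (F s)"
    using fenchel_young[OF f, of s q] by (simp add: fF)
  ultimately show ?thesis
    unfolding q_def[symmetric] fF by (cases "f q") auto
qed

section \<open>Volume under reflections and linear maps\<close>

text \<open>The factor \<open>c\<close> is the absolute value of the determinant.  The property is stable under
  composition, so that elementary maps suffice, and for coordinate swaps and shears the images of
  boxes decide.\<close>

lemma linear_image_measure_scale:
  fixes f :: "real^'d \<Rightarrow> real^'d"
  assumes "linear f"
  shows "\<exists>c. \<forall>S\<in>lmeasurable. f ` S \<in> lmeasurable \<and> measure lebesgue (f ` S) = c * measure lebesgue S"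
proof (rule induct_linear_elementary[OF assms])
  fix f g :: "real^'d \<Rightarrow> real^'d"
  assume "\<exists>c. \<forall>S\<in>lmeasurable. f ` S \<in> lmeasurable \<and> measure lebesgue (f ` S) = c * measure lebesgue S"
    and "\<exists>c. \<forall>S\<in>lmeasurable. g ` S \<in> lmeasurable \<and> measure lebesgue (g ` S) = c * measure lebesgue S"
  then obtain c c' where
    "\<forall>S\<in>lmeasurable. f ` S \<in> lmeasurable \<and> measure lebesgue (f ` S) = c * measure lebesgue S"
    "\<forall>S\<in>lmeasurable. g ` S \<in> lmeasurable \<and> measure lebesgue (g ` S) = c' * measure lebesgue S"
    by (elim exE)
  then show "\<exists>c. \<forall>S\<in>lmeasurable. (f \<circ> g) ` S \<in> lmeasurable \<and> measure lebesgue ((f \<circ> g) ` S) = c * measure lebesgue S"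
    by (intro exI[of _ "c * c'"]) (simp add: image_comp[symmetric] del: o_apply)
next
  fix f :: "real^'d \<Rightarrow> real^'d" and i
  assume f: "linear f" "\<And>x. f x $ i = 0"
  have "negligible (f ` S)" for S
    by (rule negligible_subset[OF negligible_standard_hyperplane_cart[of i]]) (use f in auto)
  then show "\<exists>c. \<forall>S\<in>lmeasurable. f ` S \<in> lmeasurable \<and> measure lebesgue (f ` S) = c * measure lebesgue S"
    by (intro exI[of _ 0]) (auto simp: negligible_imp_measure0 negligible_iff_measure)
next
  fix c :: "'d \<Rightarrow> real"
  show "\<exists>c'. \<forall>S\<in>lmeasurable. (\<lambda>x. \<chi> i. c i * x $ i) ` S \<in> lmeasurable \<and>
      measure lebesgue ((\<lambda>x. \<chi> i. c i * x $ i) ` S) = c' * measure lebesgue S"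
    using measurable_stretch measure_stretch by blast
next
  fix m n :: 'd assume "m \<noteq> n"
  let ?h = "\<lambda>x::real^'d. \<chi> i. x $ Transposition.transpose m n i"
  have lin: "linear ?h" by (rule linearI) (simp_all add: vec_eq_iff)
  have meq: "measure lebesgue (?h ` cbox a b) = measure lebesgue (cbox a b)" for a b
  proof -
    have "?h ` cbox a b = cbox (?h a) (?h b)"
    proof (rule set_eqI)
      fix x
      have "x \<in> ?h ` cbox a b \<longleftrightarrow> ?h x \<in> cbox a b"
      proof
        assume "?h x \<in> cbox a b"
        moreover have "x = ?h (?h x)" by (simp add: vec_eq_iff)
        ultimately show "x \<in> ?h ` cbox a b" by (rule rev_image_eqI)
      next
        assume "x \<in> ?h ` cbox a b"
        then obtain y where y: "y \<in> cbox a b" "x = ?h y" by blast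
        then have "?h x = y" by (simp add: vec_eq_iff)
        then show "?h x \<in> cbox a b" using y by (simp only:)
      qed
      also have "\<dots> \<longleftrightarrow> (\<forall>i. a $ i \<le> x $ Transposition.transpose m n i \<and> x $ Transposition.transpose m n i \<le> b $ i)"
        by (simp add: mem_box_cart)
      also have "\<dots> \<longleftrightarrow> (\<forall>i. a $ Transposition.transpose m n i \<le> x $ i \<and> x $ i \<le> b $ Transposition.transpose m n i)"
        by (metis transpose_involutory)
      also have "\<dots> \<longleftrightarrow> x \<in> cbox (?h a) (?h b)" by (simp add: mem_box_cart)
      finally show "x \<in> ?h ` cbox a b \<longleftrightarrow> x \<in> cbox (?h a) (?h b)" .
    qed
    moreover have "(\<Prod>i\<in>UNIV. ?h b $ i - ?h a $ i) = (\<Prod>i\<in>UNIV. b $ i - a $ i)"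
      using prod.reindex_bij_betw[of "Transposition.transpose m n" UNIV UNIV "\<lambda>i. b $ i - a $ i"]
      by (simp add: bij_swap)
    moreover have "cbox (?h a) (?h b) = {} \<longleftrightarrow> cbox a b = {}"
      using calculation(1) by (metis image_is_empty)
    ultimately show ?thesis by (cases "cbox a b = {}") (auto simp: content_cbox_cart)
  qed
  show "\<exists>c. \<forall>S\<in>lmeasurable. ?h ` S \<in> lmeasurable \<and> measure lebesgue (?h ` S) = c * measure lebesgue S"
  proof (intro exI[of _ 1] ballI)
    fix S :: "(real^'d) set" assume S: "S \<in> lmeasurable"
    have "?h ` S \<in> lmeasurable \<and> 1 * measure lebesgue S = measure lebesgue (?h ` S)"
      by (rule measure_linear_sufficient[OF lin S]) (simp only: meq mult_1)
    then show "?h ` S \<in> lmeasurable \<and> measure lebesgue (?h ` S) = 1 * measure lebesgue S" by (elim conjE) (intro conjI; simp only:)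
  qed
next
  fix m n :: 'd assume mn: "m \<noteq> n"
  let ?h = "\<lambda>x::real^'d. \<chi> i. if i = m then x $ m + x $ n else x $ i"
  have lin: "linear ?h" by (rule linearI) (auto simp: vec_eq_iff algebra_simps)
  have meq: "measure lebesgue (?h ` cbox a b) = measure lebesgue (cbox a b)" for a b
  proof (cases "cbox a b = {}")
    case False
    then have ne: "cbox 0 (b - a) \<noteq> {}"
      by (auto simp: interval_ne_empty_cart)
    have eq: "cbox a b = (+) a ` cbox 0 (b - a)" by (simp add: cbox_translation[symmetric])
    have "?h ` cbox a b = (+) (?h a) ` ?h ` cbox 0 (b - a)"
      unfolding eq image_image using linear_add[OF lin] by simp
    then have "measure lebesgue (?h ` cbox a b) = measure lebesgue (?h ` cbox 0 (b - a))"
      by (simp only: measure_translation)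
    also have "\<dots> = measure lebesgue (cbox 0 (b - a))"
      by (rule measure_shear_interval[OF mn ne]) simp
    also have "\<dots> = measure lebesgue (cbox a b)" unfolding eq by (simp only: measure_translation)
    finally show ?thesis .
  qed simp
  show "\<exists>c. \<forall>S\<in>lmeasurable. ?h ` S \<in> lmeasurable \<and> measure lebesgue (?h ` S) = c * measure lebesgue S"
  proof (intro exI[of _ 1] ballI)
    fix S :: "(real^'d) set" assume S: "S \<in> lmeasurable"
    have "?h ` S \<in> lmeasurable \<and> 1 * measure lebesgue S = measure lebesgue (?h ` S)"
      by (rule measure_linear_sufficient[OF lin S]) (simp only: meq mult_1)
    then show "?h ` S \<in> lmeasurable \<and> measure lebesgue (?h ` S) = 1 * measure lebesgue S" by (elim conjE) (intro conjI; simp only:)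
  qed
qed

text \<open>The condition on \<open>a\<close> and \<open>w\<close> makes the map an involution, namely the reflection in the
  hyperplane \<open>c + a \<bullet> x = 0\<close> along \<open>w\<close>.  The factor by which an involution multiplies volumes
  has square one.\<close>

lemma distr_affine_reflection:
  fixes a w :: "real^'d" and c :: real
  assumes aw: "a \<bullet> w = -2"
  defines "A \<equiv> \<lambda>x. x + (c + a \<bullet> x) *\<^sub>R w"
  shows "distr lborel borel A = lborel" and "A (A x) = x"
proof -
  have inv: "A (A x) = x" for x
  proof -
    have "c + a \<bullet> A x = - (c + a \<bullet> x)" using aw by (simp add: A_def algebra_simps)
    moreover have "A (A x) = A x + (c + a \<bullet> A x) *\<^sub>R w" by (simp only: A_def)
    ultimately have "A (A x) = A x - (c + a \<bullet> x) *\<^sub>R w" by (simp only: scaleR_minus_left) simp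
    then show ?thesis by (simp add: A_def)
  qed
  then show "A (A x) = x" .
  define L where "L = (\<lambda>x. x + (a \<bullet> x) *\<^sub>R w)"
  have lin: "linear L" by (rule linearI) (simp_all add: L_def algebra_simps)
  have AL: "A = (\<lambda>x. c *\<^sub>R w + L x)" by (auto simp: A_def L_def algebra_simps)
  have LL: "L (L x) = x" for x
  proof -
    have "a \<bullet> L x = - (a \<bullet> x)" using aw by (simp add: L_def algebra_simps)
    moreover have "L (L x) = L x + (a \<bullet> L x) *\<^sub>R w" by (simp only: L_def)
    ultimately have "L (L x) = L x - (a \<bullet> x) *\<^sub>R w" by (simp only: scaleR_minus_left) simp
    then show ?thesis by (simp add: L_def)
  qed
  obtain k where k: "\<And>S. S \<in> lmeasurable \<Longrightarrow> L ` S \<in> lmeasurable \<and> measure lebesgue (L ` S) = k * measure lebesgue S"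
    using linear_image_measure_scale[OF lin] by blast
  have "k = 1"
  proof -
    let ?B = "cbox 0 One :: (real^'d) set"
    have B: "?B \<in> lmeasurable" "measure lebesgue ?B = 1" by auto
    have "L ` L ` ?B = ?B" by (simp add: image_image LL)
    then have "k * k = 1" using k[OF B(1)] k[of "L ` ?B"] B(2) by auto
    moreover have "k \<ge> 0" using k[OF B(1)] B(2) by (metis measure_nonneg mult.right_neutral)
    ultimately show ?thesis by (auto simp: square_eq_1_iff)
  qed
  have cont: "continuous_on UNIV A" unfolding A_def by (intro continuous_intros)
  show "distr lborel borel A = lborel"
  proof (rule lborel_eqI[symmetric])
    fix l u :: "real^'d" assume le: "\<And>b. b \<in> Basis \<Longrightarrow> l \<bullet> b \<le> u \<bullet> b"
    have m: "A \<in> borel_measurable borel" using cont by (rule borel_measurable_continuous_onI)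
    have "A -` box l u = A ` box l u" using inv by (auto simp: image_iff) metis
    also have "\<dots> = (+) (c *\<^sub>R w) ` L ` box l u" by (simp add: AL image_image)
    finally have eq: "A -` box l u = (+) (c *\<^sub>R w) ` L ` box l u" .
    have bor: "A -` box l u \<in> sets borel"
      using measurable_sets_borel[OF m, of "box l u"] by simp
    have lm: "A -` box l u \<in> lmeasurable"
      unfolding eq using k[of "box l u"] measurable_translation by auto
    have "emeasure (distr lborel borel A) (box l u) = emeasure lborel (A -` box l u)"
      using m by (subst emeasure_distr) auto
    also have "\<dots> = emeasure lebesgue (A -` box l u)"
      using bor by simp
    also have "\<dots> = ennreal (measure lebesgue (A -` box l u))"
      by (rule emeasure_eq_measure2[OF lm])
    also have "measure lebesgue (A -` box l u) = measure lebesgue (box l u)"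
      unfolding eq measure_translation using k[OF lmeasurable_box] \<open>k = 1\<close> by (metis mult_1)
    also have "ennreal \<dots> = emeasure lborel (box l u)"
      using emeasure_eq_measure2[OF lmeasurable_box, of l u] by simp
    also have "\<dots> = (\<Prod>b\<in>Basis. (u - l) \<bullet> b)"
      using le by (rule emeasure_lborel_box)
    finally show "emeasure (distr lborel borel A) (box l u) = (\<Prod>b\<in>Basis. (u - l) \<bullet> b)" .
  qed simp
qed

lemma integral_affine_reflection:
  fixes a w :: "real^'d" and c :: real and f :: "real^'d \<Rightarrow> real"
  assumes aw: "a \<bullet> w = -2"
  defines "A \<equiv> \<lambda>x. x + (c + a \<bullet> x) *\<^sub>R w"
  assumes K: "K \<in> sets borel" "A ` K \<subseteq> K" and f: "continuous_on UNIV f"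
  shows "(\<integral>x. indicator K x * f x \<partial>lborel) = (\<integral>x. indicator K x * f (A x) \<partial>lborel)"
proof -
  have inv: "A (A x) = x" for x unfolding A_def by (rule distr_affine_reflection[OF aw])
  have d: "distr lborel borel A = lborel" unfolding A_def by (rule distr_affine_reflection[OF aw])
  have [measurable]: "A \<in> borel_measurable borel" "f \<in> borel_measurable borel"
    by (auto intro!: borel_measurable_continuous_onI continuous_intros f simp: A_def)
  have [measurable]: "K \<in> sets borel" by fact
  have "(\<integral>x. indicator K x * f x \<partial>lborel) = (\<integral>x. indicator K x * f x \<partial>distr lborel borel A)"
    by (simp add: d)
  also have "\<dots> = (\<integral>x. indicator K (A x) * f (A x) \<partial>lborel)"
    by (rule integral_distr) measurable
  also have "(\<lambda>x. indicator K (A x) :: real) = indicator K"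
  proof
    fix x show "(indicator K (A x) :: real) = indicator K x"
      using K(2) inv by (metis image_subset_iff indicator_simps)
  qed
  finally show ?thesis by (simp add: fun_eq_iff)
qed

lemma measure_affine_reflection:
  fixes a w :: "real^'d" and c :: real
  assumes aw: "a \<bullet> w = -2" and K: "K \<in> sets borel"
  shows "measure lebesgue ((\<lambda>x. x + (c + a \<bullet> x) *\<^sub>R w) ` K) = measure lebesgue K"
proof -
  define A where "A = (\<lambda>x. x + (c + a \<bullet> x) *\<^sub>R w)"
  have inv: "A (A x) = x" for x unfolding A_def by (rule distr_affine_reflection[OF aw])
  have d: "distr lborel borel A = lborel" unfolding A_def by (rule distr_affine_reflection[OF aw])
  have m: "A \<in> borel_measurable borel"
    by (auto intro!: borel_measurable_continuous_onI continuous_intros simp: A_def)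
  have eq: "A ` K = A -` K" by (auto simp: inv image_iff) (metis inv)
  have "A -` K \<in> sets borel" using measurable_sets_borel[OF m K] .
  moreover have "measure lborel K = measure lborel (A -` K)"
    using m K by (subst d[symmetric], subst measure_distr) auto
  ultimately show ?thesis unfolding A_def[symmetric] eq using K by simp
qed

text \<open>The prism of height one in direction \<open>k\<close> over the standard simplex in the other coordinates.\<close>

definition std_prism :: "'d \<Rightarrow> (real^'d) set" where
  "std_prism k = {x. (\<forall>i. 0 \<le> x $ i) \<and> (\<Sum>i\<in>UNIV - {k}. x $ i) \<le> 1 \<and> x $ k \<le> 1}"

text \<open>By Fubini this is the volume of the standard simplex of dimension \<open>d - 1\<close> times the length of
  the unit interval.\<close>

lemma measure_std_prism:
  fixes k :: "'d::finite"
  shows "std_prism k \<in> lmeasurable" and "std_prism k \<in> sets borel"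
    and "measure lebesgue (std_prism k) = 1 / fact (CARD('d) - 1)"
proof -
  let ?P = "std_prism k"
  define b where "b = (axis k 1 :: real^'d)"
  define A where "A = (Basis - {b} :: (real^'d) set)"
  have bB: "b \<in> Basis" by (simp add: b_def)
  have AB: "insert b A = Basis" "b \<notin> A" "finite A" using bB by (auto simp: A_def)
  have cA: "card A = CARD('d) - 1" using bB by (simp add: A_def)
  have Aeq: "A = (\<lambda>i. axis i 1) ` (UNIV - {k})"
    by (auto simp: A_def b_def Basis_vec_def axis_eq_axis)
  have sumA: "(\<Sum>i\<in>UNIV - {k}. x $ i) = (\<Sum>j\<in>A. x \<bullet> j)" for x :: "real^'d"
    unfolding Aeq by (subst sum.reindex) (auto simp: inj_on_def axis_eq_axis inner_axis)
  have Pc: "?P = {x. (\<forall>j\<in>Basis. 0 \<le> x \<bullet> j) \<and> (\<Sum>j\<in>A. x \<bullet> j) \<le> 1 \<and> x \<bullet> b \<le> 1}"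
    by (auto simp: std_prism_def sumA b_def Basis_vec_def inner_axis)
  have Pb: "?P \<in> sets borel"
    unfolding Pc by measurable
  interpret product_sigma_finite "\<lambda>_::real^'d. lborel :: real measure" by standard
  let ?M = "\<lambda>A. (Pi\<^sub>M A (\<lambda>_::real^'d. lborel :: real measure))"
  define S where "S = {x::(real^'d) \<Rightarrow> real. (\<forall>i\<in>A. 0 \<le> x i) \<and> sum x A \<le> 1}"
  have Sm: "S \<inter> space (?M A) \<in> sets (?M A)"
  proof -
    have "S \<inter> space (?M A) = {x\<in>space (?M A). (\<forall>i\<in>A. 0 \<le> x i) \<and> (\<Sum>i\<in>A. x i) \<le> 1}"
      by (auto simp: S_def)
    also have "\<dots> \<in> sets (?M A)" using AB(3) by measurable
    finally show ?thesis .
  qed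
  have cm: "(\<lambda>f. f j) \<in> borel_measurable (?M (insert b A))" if "j \<in> insert b A" for j
    using measurable_component_singleton[OF that, of "\<lambda>_. lborel"] by simp
  let ?Q = "{f. (\<forall>j\<in>Basis. 0 \<le> f j) \<and> (\<Sum>j\<in>A. f j) \<le> 1 \<and> f b \<le> 1} \<inter> space (?M (insert b A))"
  have Qm: "?Q \<in> sets (?M (insert b A))"
  proof -
    have "?Q
      = (\<Inter>j\<in>insert b A. {f\<in>space (?M (insert b A)). 0 \<le> f j})
          \<inter> ({f\<in>space (?M (insert b A)). (\<Sum>j\<in>A. f j) \<le> 1} \<inter> {f\<in>space (?M (insert b A)). f b \<le> 1})"
      using AB(1) by auto
    also have "\<dots> \<in> sets (?M (insert b A))"
      using AB(3) by (intro sets.Int sets.finite_INT borel_measurable_le borel_measurable_sum cm) auto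
    finally show ?thesis .
  qed
  let ?g = "\<lambda>f. \<Sum>j\<in>Basis. f j *\<^sub>R j :: real^'d"
  have gi: "?g f \<bullet> j = f j" if "j \<in> Basis" for f and j :: "real^'d" using that by simp
  have pre: "?g -` ?P = {f. (\<forall>j\<in>Basis. 0 \<le> f j) \<and> (\<Sum>j\<in>A. f j) \<le> 1 \<and> f b \<le> 1}"
  proof -
    have "(\<Sum>j\<in>A. ?g f \<bullet> j) = sum f A" for f by (intro sum.cong) (auto simp: A_def)
    then show ?thesis unfolding Pc using bB by (auto)
  qed
  have "emeasure lborel ?P = emeasure (distr (?M Basis) borel ?g) ?P"
    by (subst lborel_eq) simp
  also have "\<dots> = emeasure (?M Basis) (?g -` ?P \<inter> space (?M Basis))"
    using Pb by (subst emeasure_distr) auto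
  also have "\<dots> = emeasure (?M (insert b A)) ?Q"
    by (simp only: AB(1) pre)
  also have "\<dots> = (\<integral>\<^sup>+f. indicator ?Q f \<partial>?M (insert b A))"
  proof (rule nn_integral_indicator[symmetric])
    show "?Q \<in> sets (?M (insert b A))" by (rule Qm)
  qed
  also have "\<dots> = (\<integral>\<^sup>+y. \<integral>\<^sup>+f. indicator ?Q (f(b := y)) \<partial>?M A \<partial>lborel)"
  proof (rule product_nn_integral_insert_rev[OF AB(3,2)])
    show "indicator ?Q \<in> borel_measurable (?M (insert b A))"
      by (rule borel_measurable_indicator[OF Qm])
  qed
  also have "\<dots> = (\<integral>\<^sup>+y. \<integral>\<^sup>+f. indicator {0..1::real} y * indicator (S \<inter> space (?M A)) f \<partial>?M A \<partial>lborel)"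
  proof (intro nn_integral_cong)
    fix y and f assume f: "f \<in> space (?M A)"
    have "f(b := y) \<in> space (?M (insert b A))" using f by (auto simp: space_PiM PiE_def extensional_def)
    moreover have "sum (f(b := y)) A = sum f A" using AB(2) by (intro sum.cong) auto
    ultimately show "indicator ?Q (f(b := y))
        = indicator {0..1::real} y * (indicator (S \<inter> space (?M A)) f :: ennreal)"
      using AB f unfolding AB(1)[symmetric] by (auto simp: indicator_def S_def)
  qed
  also have "\<dots> = (\<integral>\<^sup>+y. indicator {0..1::real} y * emeasure (?M A) (S \<inter> space (?M A)) \<partial>lborel)"
    using Sm by (intro nn_integral_cong) (simp add: nn_integral_cmult)
  also have "\<dots> = emeasure lborel {0..1::real} * emeasure (?M A) (S \<inter> space (?M A))"
    by (subst nn_integral_multc) auto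
  also have "\<dots> = ennreal (1 / fact (CARD('d) - 1))"
    using emeasure_std_simplex_aux[OF AB(3), of 1] cA by (simp add: S_def divide_ennreal ennreal_fact[symmetric])
  finally have e: "emeasure lborel ?P = ennreal (1 / fact (CARD('d) - 1))" .
  show "?P \<in> sets borel" by (rule Pb)
  show "?P \<in> lmeasurable" using e Pb by (intro fmeasurableI) auto
  show "measure lebesgue ?P = 1 / fact (CARD('d) - 1)"
    using Pb e by (simp add: measure_def)
qed

section \<open>Barycentric coordinates of a simplex\<close>

definition centroid :: "'a::real_vector set \<Rightarrow> 'a" where
  "centroid W = (1 / real (card W)) *\<^sub>R \<Sum>W"

text \<open>The gradient of the barycentric coordinate of \<open>p\<close>, which falls from one at \<open>p\<close> to zero at each
  other vertex; for a simplex of full dimension this determines it.\<close>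

definition bary_grad :: "'a::real_inner set \<Rightarrow> 'a \<Rightarrow> 'a" where
  "bary_grad V p = (SOME G. \<forall>q\<in>V - {p}. G \<bullet> (q - p) = -1)"

text \<open>The barycentric coordinate of \<open>p\<close>, extended to the whole space as an affine function.\<close>

definition bary :: "'a::real_inner set \<Rightarrow> 'a \<Rightarrow> 'a \<Rightarrow> real" where
  "bary V p x = 1 + bary_grad V p \<bullet> (x - p)"

lemma bary_affine: "bary V p (x + t *\<^sub>R w) = bary V p x + t * (bary_grad V p \<bullet> w)"
  by (simp add: bary_def algebra_simps)

lemma bary_diff: "bary V p x - bary V p y = bary_grad V p \<bullet> (x - y)"
  by (simp add: bary_def algebra_simps)

lemma continuous_on_bary [continuous_intros]: "continuous_on A (bary V p)"
  unfolding bary_def[abs_def] by (intro continuous_intros)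

text \<open>A simplex of full dimension, given by its vertices.  The facet \<open>F p\<close> is the one opposite to
  the vertex \<open>p\<close>; \<open>lam p\<close> is the barycentric coordinate of \<open>p\<close> and \<open>G p\<close> its gradient.\<close>

locale full_simplex =
  fixes V :: "(real^'d) set"
  assumes indep: "\<not> affine_dependent V" and card_V: "card V = CARD('d) + 1"
begin

abbreviation "T \<equiv> convex hull V"
abbreviation "F p \<equiv> convex hull (V - {p})"
abbreviation "G \<equiv> bary_grad V"
abbreviation "lam \<equiv> bary V"

lemma finite_V: "finite V" using card_V by (metis Suc_eq_plus1 card.infinite nat.distinct(1))

lemma affine_hull_V: "affine hull V = UNIV"
  using affine_independent_span_eq[OF indep] card_V by simp

lemma card_facet: "p \<in> V \<Longrightarrow> card (V - {p}) = CARD('d)"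
  using card_V finite_V by simp

lemma facet_vertices_nonempty: "p \<in> V \<Longrightarrow> V - {p} \<noteq> {}"
  using card_facet[of p] by (metis card.empty zero_less_card_finite less_irrefl)

lemma V_nonempty: "V \<noteq> {}" using card_V by auto

text \<open>The vectors \<open>q - p\<close> form a basis, so some linear functional is \<open>- 1\<close> on all of them; its adjoint
  represents it as an inner product.\<close>

lemma bary_grad_vertex:
  assumes "p \<in> V" "q \<in> V - {p}"
  shows "G p \<bullet> (q - p) = -1"
proof -
  let ?B = "(\<lambda>q. q - p) ` (V - {p})"
  have "independent ?B"
    using affine_dependent_iff_dependent2[OF assms(1)] indep by simp
  then obtain g :: "real^'d \<Rightarrow> real" where g: "linear g" "\<forall>x\<in>?B. g x = -1"
    using linear_independent_extend[of ?B "\<lambda>_. -1"] by auto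
  have "\<exists>E. \<forall>q\<in>V - {p}. E \<bullet> (q - p) = -1"
    using g adjoint_works[OF g(1), of _ 1] by (intro exI[of _ "adjoint g 1"]) (auto simp: inner_commute)
  then have "\<forall>q\<in>V - {p}. G p \<bullet> (q - p) = -1"
    unfolding bary_grad_def by (rule someI_ex)
  then show ?thesis using assms(2) by blast
qed

lemma bary_vertex: "p \<in> V \<Longrightarrow> q \<in> V \<Longrightarrow> lam p q = (if q = p then 1 else 0)"
  using bary_grad_vertex[of p q] by (auto simp: bary_def)

lemma bary_combination:
  assumes p: "p \<in> V" and u: "sum u V = 1"
  shows "lam p (\<Sum>q\<in>V. u q *\<^sub>R q) = u p"
proof -
  have "(\<Sum>q\<in>V. u q * lam p q) = (\<Sum>q\<in>V. u q * (1 - G p \<bullet> p) + u q * (G p \<bullet> q))"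
    by (simp add: bary_def algebra_simps)
  also have "\<dots> = lam p (\<Sum>q\<in>V. u q *\<^sub>R q)"
    using u by (simp add: bary_def inner_diff_right inner_sum_right sum.distrib flip: sum_distrib_right)
  finally have "lam p (\<Sum>q\<in>V. u q *\<^sub>R q) = (\<Sum>q\<in>V. u q * lam p q)" ..
  also have "\<dots> = (\<Sum>q\<in>V. if q = p then u q else 0)"
    by (rule sum.cong) (auto simp: bary_vertex p)
  also have "\<dots> = u p" using p finite_V by simp
  finally show ?thesis .
qed

text \<open>The vertices span the space affinely, and the coordinate functions recover the coefficients
  of an affine combination of vertices.\<close>

lemma bary_expansion: "(\<Sum>p\<in>V. lam p x) = 1" "(\<Sum>p\<in>V. lam p x *\<^sub>R p) = x"
proof -
  have "x \<in> affine hull V" by (simp add: affine_hull_V)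
  then obtain u where u: "sum u V = 1" "(\<Sum>q\<in>V. u q *\<^sub>R q) = x"
    unfolding affine_hull_finite[OF finite_V] by auto
  have l: "lam p x = u p" if "p \<in> V" for p using bary_combination[OF that u(1)] u(2) by simp
  show "(\<Sum>p\<in>V. lam p x) = 1" using u(1) l by (simp cong: sum.cong)
  show "(\<Sum>p\<in>V. lam p x *\<^sub>R p) = x" using u(2) l by (simp cong: sum.cong)
qed

lemma bary_grad_expansion: "(\<Sum>p\<in>V. G p \<bullet> w) = 0" "(\<Sum>p\<in>V. (G p \<bullet> w) *\<^sub>R p) = w"
proof -
  have d: "G p \<bullet> w = lam p w - lam p 0" for p by (simp add: bary_diff)
  show "(\<Sum>p\<in>V. G p \<bullet> w) = 0" by (simp add: d sum_subtractf bary_expansion)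
  show "(\<Sum>p\<in>V. (G p \<bullet> w) *\<^sub>R p) = w" by (simp add: d scaleR_diff_left sum_subtractf bary_expansion)
qed

lemma affine_bary_expansion:
  fixes f :: "real^'d \<Rightarrow> 'b::real_vector"
  assumes "linear L" "\<And>x. f x = c + L x"
  shows "f x = (\<Sum>p\<in>V. lam p x *\<^sub>R f p)"
proof -
  have "(\<Sum>p\<in>V. lam p x *\<^sub>R f p) = (\<Sum>p\<in>V. lam p x) *\<^sub>R c + L (\<Sum>p\<in>V. lam p x *\<^sub>R p)"
    by (simp add: assms scaleR_add_right sum.distrib scaleR_left.sum linear_sum linear_scale)
  then show ?thesis by (simp add: bary_expansion assms)
qed

lemma bary_grad_eq_zeroI: "(\<And>p q. p \<in> V \<Longrightarrow> q \<in> V \<Longrightarrow> w \<bullet> (p - q) = 0) \<Longrightarrow> w = 0"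
proof -
  assume H: "\<And>p q. p \<in> V \<Longrightarrow> q \<in> V \<Longrightarrow> w \<bullet> (p - q) = 0"
  obtain r where r: "r \<in> V" using V_nonempty by blast
  have "w \<bullet> w = (\<Sum>p\<in>V. (G p \<bullet> w) * (w \<bullet> p))"
    using arg_cong[OF bary_grad_expansion(2)[of w], of "\<lambda>x. w \<bullet> x"] by (simp add: inner_sum_right)
  also have "\<dots> = (\<Sum>p\<in>V. (G p \<bullet> w) * (w \<bullet> r))"
    using H[OF _ r] by (intro sum.cong) (auto simp: inner_diff_right)
  also have "\<dots> = 0" by (simp add: bary_grad_expansion flip: sum_distrib_right)
  finally show "w = 0" by simp
qed

lemma bary_grad_nonzero: "p \<in> V \<Longrightarrow> G p \<noteq> 0"
proof
  assume p: "p \<in> V" and z: "G p = 0"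
  obtain q where "q \<in> V - {p}" using facet_vertices_nonempty[OF p] by blast
  from bary_grad_vertex[OF p this] z show False by simp
qed

lemma in_simplex_iff: "x \<in> T \<longleftrightarrow> (\<forall>p\<in>V. 0 \<le> lam p x)"
proof
  assume "x \<in> T"
  then obtain u where u: "\<forall>x\<in>V. 0 \<le> u x" "sum u V = 1" "(\<Sum>q\<in>V. u q *\<^sub>R q) = x"
    unfolding convex_hull_finite[OF finite_V] by auto
  then show "\<forall>p\<in>V. 0 \<le> lam p x" using bary_combination[OF _ u(2)] by auto
next
  assume "\<forall>p\<in>V. 0 \<le> lam p x"
  then show "x \<in> T" unfolding convex_hull_finite[OF finite_V]
    using bary_expansion by (intro CollectI exI[of _ "\<lambda>p. lam p x"]) auto
qed

lemma in_interior_iff: "x \<in> interior T \<longleftrightarrow> (\<forall>p\<in>V. 0 < lam p x)"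
proof
  assume "x \<in> interior T"
  then obtain u where u: "\<forall>x\<in>V. 0 < u x" "sum u V = 1" "(\<Sum>q\<in>V. u q *\<^sub>R q) = x"
    using interior_convex_hull_explicit_minimal[OF indep] card_V by (auto split: if_splits)
  then show "\<forall>p\<in>V. 0 < lam p x" using bary_combination[OF _ u(2)] by auto
next
  assume H: "\<forall>p\<in>V. 0 < lam p x"
  have "open {x. \<forall>p\<in>V. 0 < lam p x}"
    unfolding Collect_ball_eq using finite_V
    by (intro open_INT ballI open_Collect_less continuous_intros) auto
  moreover have "{x. \<forall>p\<in>V. 0 < lam p x} \<subseteq> T" using in_simplex_iff by force
  ultimately show "x \<in> interior T" using H by (auto intro: interiorI)
qed

lemma bary_centroid: "p \<in> V \<Longrightarrow> lam p (centroid V) = 1 / (real CARD('d) + 1)"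
  using bary_combination[of p "\<lambda>_. 1 / (real CARD('d) + 1)"] card_V
  by (simp add: centroid_def scaleR_sum_right add.commute)

lemma centroid_interior: "centroid V \<in> interior T"
  unfolding in_interior_iff by (simp add: bary_centroid)

lemma bary_facet_centroid:
  assumes "p \<in> V" "q \<in> V"
  shows "lam q (centroid (V - {p})) = (if q = p then 0 else 1 / real CARD('d))"
proof -
  have "centroid (V - {p}) = (\<Sum>r\<in>V. (if r = p then 0 else 1 / real CARD('d)) *\<^sub>R r)"
    unfolding centroid_def card_facet[OF assms(1)] scaleR_sum_right
    using finite_V by (intro sum.mono_neutral_cong_left) auto
  moreover have "(\<Sum>r\<in>V. if r = p then 0 else 1 / real CARD('d)) = (\<Sum>r\<in>V - {p}. 1 / real CARD('d))"
    using finite_V by (intro sum.mono_neutral_cong_right) auto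
  ultimately show ?thesis
    using bary_combination[OF assms(2), of "\<lambda>r. if r = p then 0 else 1 / real CARD('d)"] card_facet[OF assms(1)]
    by simp
qed

lemma in_facet_iff:
  assumes p: "p \<in> V"
  shows "x \<in> F p \<longleftrightarrow> lam p x = 0 \<and> (\<forall>q\<in>V - {p}. 0 \<le> lam q x)"
proof
  assume "x \<in> F p"
  then obtain u where u: "\<forall>x\<in>V - {p}. 0 \<le> u x" "sum u (V - {p}) = 1" "(\<Sum>q\<in>V - {p}. u q *\<^sub>R q) = x"
    using convex_hull_finite[of "V - {p}"] finite_V by auto
  define u' where "u' = (\<lambda>q. if q = p then 0 else u q)"
  have "sum u' V = sum u (V - {p})" "(\<Sum>q\<in>V. u' q *\<^sub>R q) = (\<Sum>q\<in>V - {p}. u q *\<^sub>R q)"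
    using finite_V by (auto intro!: sum.mono_neutral_cong_right simp: u'_def split: if_splits)
  then have "lam q x = u' q" if "q \<in> V" for q using bary_combination[OF that, of u'] u by simp
  then show "lam p x = 0 \<and> (\<forall>q\<in>V - {p}. 0 \<le> lam q x)" using u(1) p by (auto simp: u'_def)
next
  assume H: "lam p x = 0 \<and> (\<forall>q\<in>V - {p}. 0 \<le> lam q x)"
  have "sum (\<lambda>q. lam q x) V = sum (\<lambda>q. lam q x) (V - {p})"
    "(\<Sum>q\<in>V. lam q x *\<^sub>R q) = (\<Sum>q\<in>V - {p}. lam q x *\<^sub>R q)"
    using finite_V H by (auto intro!: sum.mono_neutral_right)
  then show "x \<in> F p" using H bary_expansion[of x] finite_V
    by (auto simp: convex_hull_finite intro!: exI[of _ "\<lambda>q. lam q x"])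
qed

lemma rel_interior_facet:
  assumes p: "p \<in> V" and x: "x \<in> rel_interior (F p)"
  shows "lam p x = 0" "\<And>q. q \<in> V - {p} \<Longrightarrow> 0 < lam q x"
proof -
  have "\<not> affine_dependent (V - {p})" using indep by (rule affine_independent_Diff)
  then obtain u where u: "\<forall>x\<in>V - {p}. 0 < u x" "sum u (V - {p}) = 1" "(\<Sum>q\<in>V - {p}. u q *\<^sub>R q) = x"
    using x rel_interior_convex_hull_explicit[of "V - {p}"] by auto
  define u' where "u' = (\<lambda>q. if q = p then 0 else u q)"
  have "sum u' V = sum u (V - {p})" "(\<Sum>q\<in>V. u' q *\<^sub>R q) = (\<Sum>q\<in>V - {p}. u q *\<^sub>R q)"
    using finite_V by (auto intro!: sum.mono_neutral_cong_right simp: u'_def split: if_splits)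
  then have "lam q x = u' q" if "q \<in> V" for q using bary_combination[OF that, of u'] u by simp
  then show "lam p x = 0" "\<And>q. q \<in> V - {p} \<Longrightarrow> 0 < lam q x" using u(1) p by (auto simp: u'_def)
qed

lemma facet_subset: "F p \<subseteq> T" by (rule hull_mono) auto

lemma facet_of_iff: "S facet_of T \<longleftrightarrow> (\<exists>p\<in>V. S = F p)"
  unfolding facet_of_convex_hull_affine_independent[OF indep]
  using facet_vertices_nonempty by auto

lemma inj_on_F: "inj_on F V"
proof (rule inj_onI)
  fix p q assume H: "p \<in> V" "q \<in> V" "F p = F q"
  show "p = q"
  proof (rule ccontr)
    assume "p \<noteq> q"
    then have "q \<in> F p" using H hull_subset[of "V - {p}" convex] by blast
    then show False using H(3) in_facet_iff[OF H(2), of q] bary_vertex[OF H(2,2)] by simp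
  qed
qed

text \<open>Subtracting the multiple of \<open>G p\<close> with the same value on the edges at \<open>p\<close> leaves a vector that is
  orthogonal to all edges of the simplex.\<close>

lemma normal_to_facet:
  assumes p: "p \<in> V" and n: "\<And>q r. q \<in> V - {p} \<Longrightarrow> r \<in> V - {p} \<Longrightarrow> n \<bullet> (q - r) = 0"
  obtains c where "n = c *\<^sub>R G p" "\<And>r. r \<in> V - {p} \<Longrightarrow> c = n \<bullet> (p - r)"
proof -
  obtain r0 where r0: "r0 \<in> V - {p}" using facet_vertices_nonempty[OF p] by blast
  define c where "c = n \<bullet> (p - r0)"
  have c: "c = n \<bullet> (p - r)" if "r \<in> V - {p}" for r
    using n[OF that r0] by (simp add: c_def inner_diff_right)
  have Gp: "G p \<bullet> (p - r) = 1" if "r \<in> V - {p}" for r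
    using bary_grad_vertex[OF p that] by (simp add: inner_diff_right)
  have "n - c *\<^sub>R G p = 0"
  proof (rule bary_grad_eq_zeroI)
    fix q r assume "q \<in> V" "r \<in> V"
    have z: "(n - c *\<^sub>R G p) \<bullet> (q - p) = 0" if "q \<in> V" for q
    proof (cases "q = p")
      case False
      have "(n - c *\<^sub>R G p) \<bullet> (q - p) = c * (G p \<bullet> (p - q)) - n \<bullet> (p - q)"
        by (simp add: inner_diff_left inner_diff_right right_diff_distrib)
      then show ?thesis using c[of q] Gp[of q] that False by simp
    qed simp
    show "(n - c *\<^sub>R G p) \<bullet> (q - r) = 0"
      using z[OF \<open>q \<in> V\<close>] z[OF \<open>r \<in> V\<close>] by (simp only: inner_diff_right)
  qed
  then have "n = c *\<^sub>R G p" by (simp only: right_minus_eq)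
  then show thesis using that[of c] c by blast
qed

lemma grad_facet:
  assumes p: "p \<in> V" "x \<in> F p" "y \<in> F p"
  shows "G p \<bullet> (x - y) = 0"
  using assms in_facet_iff[OF p(1)] bary_diff[of V p x y] by simp

lemma outer_normal_facet:
  assumes p: "p \<in> V"
  shows "outer_normal T (F p) = - (1 / norm (G p)) *\<^sub>R G p"
  unfolding outer_normal_def
proof (rule the_equality)
  have G0: "norm (G p) > 0" using bary_grad_nonzero[OF p] by simp
  show "norm (- (1 / norm (G p)) *\<^sub>R G p) = 1 \<and>
    (\<forall>x\<in>F p. \<forall>y\<in>T. (- (1 / norm (G p)) *\<^sub>R G p) \<bullet> (y - x) \<le> 0)"
  proof (intro conjI ballI)
    show "norm (- (1 / norm (G p)) *\<^sub>R G p) = 1" using G0 by simp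
    fix x y assume "x \<in> F p" "y \<in> T"
    then have "G p \<bullet> (y - x) \<ge> 0"
      using in_facet_iff[OF p, of x] in_simplex_iff[of y] p bary_diff[of V p y x] by (metis diff_0_right)
    then show "(- (1 / norm (G p)) *\<^sub>R G p) \<bullet> (y - x) \<le> 0"
      using G0 by (simp add: field_simps)
  qed
  fix n assume n: "norm n = 1 \<and> (\<forall>x\<in>F p. \<forall>y\<in>T. n \<bullet> (y - x) \<le> 0)"
  have vT: "v \<in> T" if "v \<in> V" for v using that by (rule hull_inc)
  have vF: "v \<in> F p" if "v \<in> V - {p}" for v using that by (rule hull_inc)
  obtain c where c: "n = c *\<^sub>R G p" "\<And>r. r \<in> V - {p} \<Longrightarrow> c = n \<bullet> (p - r)"
  proof (rule normal_to_facet[OF p, of n])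
    fix q r assume q: "q \<in> V - {p}" and r: "r \<in> V - {p}"
    have "n \<bullet> (q - r) \<le> 0" "n \<bullet> (r - q) \<le> 0"
      using n vT[of q] vT[of r] vF[OF q] vF[OF r] q r by auto
    then show "n \<bullet> (q - r) = 0" by (simp add: inner_diff_right)
  qed blast
  obtain r where r: "r \<in> V - {p}" using facet_vertices_nonempty[OF p] by blast
  have "c \<le> 0" using c(2)[OF r] n vT[OF p] vF[OF r] by auto
  moreover have "\<bar>c\<bar> * norm (G p) = 1" using n c(1) by (metis norm_scaleR)
  ultimately have "c = - (1 / norm (G p))" using G0 by (simp add: field_simps)
  then show "n = - (1 / norm (G p)) *\<^sub>R G p" using c(1) by simp
qed

text \<open>The choice operator in the definition of the side normal leaves the sign of \<open>c\<close> open, so only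
  its modulus is determined.\<close>

lemma side_normal_facet:
  assumes p: "p \<in> V"
  obtains c where "side_normal (F p) = c *\<^sub>R G p" "\<bar>c\<bar> * norm (G p) = 1" "norm (side_normal (F p)) = 1"
proof -
  let ?P = "\<lambda>n. norm n = 1 \<and> (\<forall>x\<in>F p. \<forall>y\<in>F p. n \<bullet> (y - x) = 0)"
  have G0: "norm (G p) > 0" using bary_grad_nonzero[OF p] by simp
  have "?P ((1 / norm (G p)) *\<^sub>R G p)" using grad_facet[OF p] G0 by auto
  then have P: "?P (side_normal (F p))" unfolding side_normal_def by (rule someI)
  have vF: "v \<in> F p" if "v \<in> V - {p}" for v using that by (rule hull_inc)
  obtain c where "side_normal (F p) = c *\<^sub>R G p"
    using normal_to_facet[OF p, of "side_normal (F p)"] P vF by metis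
  then show thesis using that[of c] P by (metis norm_scaleR)
qed

end

section \<open>Volume and quadrature on a simplex\<close>

lemma (in complete_measure) measurable_AE_cong:
  assumes f: "f \<in> measurable M N" and ae: "AE x in M. f x = g x" and g: "\<And>x. g x \<in> space N"
  shows "g \<in> measurable M N"
proof (rule measurableI)
  fix A assume A: "A \<in> sets N"
  show "g -` A \<inter> space M \<in> sets M"
  proof (rule in_sets_AE)
    show "AE x in M. (x \<in> f -` A \<inter> space M) = (x \<in> g -` A \<inter> space M)" using ae by eventually_elim auto
    show "f -` A \<inter> space M \<in> sets M" using f A by (rule measurable_sets)
  qed auto
qed (use g in auto)

text \<open>Piecewise polynomial functions and the boundary data are arbitrary on null sets, hence possibly
  not Borel measurable there.\<close>

lemma integral_completion_AE_cong:
  fixes f g :: "'a \<Rightarrow> 'b::{banach, second_countable_topology}"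
  assumes f: "f \<in> borel_measurable M" and ae: "AE x in M. f x = g x"
  shows "integral\<^sup>L (completion M) g = integral\<^sup>L M f"
proof -
  have ae': "AE x in completion M. f x = g x" using ae by (rule AE_completion)
  have f': "f \<in> borel_measurable (completion M)" using f by (rule measurable_completion)
  have "g \<in> borel_measurable (completion M)"
    by (rule completion.measurable_AE_cong[OF f' ae']) simp
  then have "integral\<^sup>L (completion M) g = integral\<^sup>L (completion M) f"
    using f' ae' by (intro integral_cong_AE) auto
  then show ?thesis using integral_completion[OF f] by simp
qed

lemma AE_lborel_not_negligible: "negligible N \<Longrightarrow> AE x in lborel. x \<notin> N"
  using AE_not_in[of N lebesgue] unfolding negligible_iff_null_sets by (simp add: AE_completion_iff)

lemma side_cylinder_eq: "side_cylinder S = (\<lambda>(x, t). x + t *\<^sub>R side_normal S) ` (S \<times> {0..1})"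
  unfolding side_cylinder_def by force

lemma compact_side_cylinder: "compact S \<Longrightarrow> compact (side_cylinder S)"
  unfolding side_cylinder_eq
  by (intro compact_continuous_image compact_Times) (auto intro!: continuous_intros simp: case_prod_unfold)

lemma convex_side_cylinder:
  assumes "convex S" shows "convex (side_cylinder S)"
proof -
  have "linear (\<lambda>(x, t). x + t *\<^sub>R side_normal S)"
    by (rule linearI) (auto simp: algebra_simps)
  then show ?thesis unfolding side_cylinder_eq
    using assms by (intro convex_linear_image convex_Times) auto
qed

context full_simplex
begin

lemma compact_T: "compact T" using finite_V by (rule finite_imp_compact_convex_hull)
lemma compact_F: "compact (F p)" using finite_V by (intro finite_imp_compact_convex_hull) auto

lemma T_borel [measurable]: "T \<in> sets borel" using compact_T by (simp add: borel_compact)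

lemma measure_T_pos: "0 < measure lebesgue T"
proof -
  have "\<not> negligible T"
    using centroid_interior negligible_subset[OF _ interior_subset[of T]] open_not_negligible[of "interior T"] by blast
  then show ?thesis
    using lmeasurable_compact[OF compact_T] by (simp add: negligible_iff_measure zero_less_measure_iff)
qed

lemma AE_interior: "AE x in lborel. x \<in> T \<longrightarrow> x \<in> interior T"
  using AE_lborel_not_negligible[OF negligible_convex_frontier[of T]]
  by (auto elim!: eventually_mono simp: frontier_def closure_closed compact_T compact_imp_closed)

text \<open>The map that moves \<open>x\<close> along the edge from \<open>q\<close> to \<open>q'\<close> by the difference of the two coordinates
  exchanges these coordinates.\<close>

lemma bary_swap:
  assumes q: "q \<in> V" "q' \<in> V" "q \<noteq> q'" and r: "r \<in> V"
  shows "lam r (x + (lam q x - lam q' x) *\<^sub>R (q' - q)) = (if r = q then lam q' x else if r = q' then lam q x else lam r x)"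
proof -
  have "lam r (x + (lam q x - lam q' x) *\<^sub>R (q' - q)) = lam r x + (lam q x - lam q' x) * (lam r q' - lam r q)"
    unfolding bary_affine bary_diff ..
  then show ?thesis using q r by (auto simp: bary_vertex)
qed

text \<open>Exchanging two vertices is a reflection, which preserves volume.  With \<open>n = 0\<close> the map \<open>P\<close> is
  the identity and \<open>K\<close> can be the simplex; with a unit vector \<open>n\<close> that is normal to a facet, \<open>P\<close>
  projects onto the hyperplane of the facet and \<open>K\<close> can be the cylinder on the facet.\<close>

lemma integral_swap_bary:
  fixes n x\<^sub>0 :: "real^'d"
  defines "P \<equiv> \<lambda>y. y - (n \<bullet> (y - x\<^sub>0)) *\<^sub>R n"
  assumes q: "q \<in> V" "q' \<in> V" "q \<noteq> q'" and nw: "n \<bullet> (q' - q) = 0" and K: "K \<in> sets borel"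
    and swap: "\<And>y. y \<in> K \<Longrightarrow> y + (lam q (P y) - lam q' (P y)) *\<^sub>R (q' - q) \<in> K"
  shows "(\<integral>y. indicator K y * lam q (P y) \<partial>lborel) = (\<integral>y. indicator K y * lam q' (P y) \<partial>lborel)"
proof -
  define w where "w = q' - q"
  have nw: "n \<bullet> w = 0" using nw by (simp add: w_def)
  define a where "a = (G q - G q') - ((G q - G q') \<bullet> n) *\<^sub>R n"
  have aw: "a \<bullet> w = -2"
    using bary_grad_vertex[of q q'] bary_grad_vertex[of q' q] q nw
    by (simp add: a_def inner_diff_left) (simp add: w_def inner_diff_right)
  define c where "c = lam q (P 0) - lam q' (P 0)"
  have Pd: "P y - P 0 = y - (n \<bullet> y) *\<^sub>R n" for y
    by (simp add: P_def inner_diff_right algebra_simps)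
  have h: "c + a \<bullet> y = lam q (P y) - lam q' (P y)" for y
  proof -
    have "lam q (P y) - lam q' (P y) - c = (G q - G q') \<bullet> (P y - P 0)"
      by (simp add: c_def inner_diff_left flip: bary_diff)
    also have "\<dots> = a \<bullet> y" unfolding Pd a_def by (simp add: inner_diff_left inner_diff_right)
    finally show ?thesis by simp
  qed
  define A where "A = (\<lambda>y. y + (c + a \<bullet> y) *\<^sub>R w)"
  have "P (A y) = P y + (c + a \<bullet> y) *\<^sub>R w" for y
    using nw by (simp add: A_def P_def inner_diff_right inner_add_right)
  then have PA: "lam q (P (A y)) = lam q' (P y)" for y
    using bary_swap[OF q q(1), of "P y"] by (simp add: h w_def)
  have "A ` K \<subseteq> K" using swap by (auto simp: A_def h w_def)
  then have "(\<integral>y. indicator K y * lam q (P y) \<partial>lborel) = (\<integral>y. indicator K y * lam q (P (A y)) \<partial>lborel)"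
    unfolding A_def
    by (intro integral_affine_reflection[OF aw] K)
       (auto intro!: continuous_on_compose2[OF continuous_on_bary] continuous_intros simp: P_def)
  then show ?thesis by (simp add: PA)
qed

lemma integral_swap_bary_simplex:
  assumes q: "q \<in> V" "q' \<in> V"
  shows "(\<integral>x. indicator T x * lam q x \<partial>lborel) = (\<integral>x. indicator T x * lam q' x \<partial>lborel)"
proof (cases "q = q'")
  case False
  have "y + (lam q y - lam q' y) *\<^sub>R (q' - q) \<in> T" if "y \<in> T" for y
    using that bary_swap[OF q False] q unfolding in_simplex_iff by simp
  then show ?thesis using integral_swap_bary[OF q False, of 0 T 0] T_borel by simp
qed simp

lemma integrable_T:
  fixes f :: "real^'d \<Rightarrow> 'b::{banach, second_countable_topology}"
  shows "continuous_on UNIV f \<Longrightarrow> integrable lborel (\<lambda>x. indicator T x *\<^sub>R f x)"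
  by (intro borel_integrable_compact compact_T) (auto intro: continuous_on_subset)

text \<open>By symmetry the coordinates have the same integral, and they add up to one.\<close>

lemma integral_bary:
  assumes q: "q \<in> V"
  shows "(\<integral>x. indicator T x * lam q x \<partial>lborel) = measure lebesgue T / (real CARD('d) + 1)"
proof -
  have "(\<Sum>r\<in>V. \<integral>x. indicator T x * lam r x \<partial>lborel) = (\<integral>x. (\<Sum>r\<in>V. indicator T x * lam r x) \<partial>lborel)"
    using integrable_T[OF continuous_on_bary] by (subst Bochner_Integration.integral_sum) auto
  also have "\<dots> = (\<integral>x. indicator T x \<partial>lborel)"
    by (simp add: bary_expansion flip: sum_distrib_left)
  also have "\<dots> = measure lebesgue T" by simp
  finally have "(\<Sum>r\<in>V. \<integral>x. indicator T x * lam r x \<partial>lborel) = measure lebesgue T" .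
  moreover have "(\<Sum>r\<in>V. \<integral>x. indicator T x * lam r x \<partial>lborel) = (\<Sum>r\<in>V. \<integral>x. indicator T x * lam q x \<partial>lborel)"
    by (intro sum.cong refl integral_swap_bary_simplex q)
  ultimately show ?thesis by (simp add: card_V field_simps)
qed

lemma integral_affine:
  fixes f :: "real^'d \<Rightarrow> 'b::euclidean_space"
  assumes L: "linear L" "\<And>x. f x = c + L x"
  shows "(\<integral>x. indicator T x *\<^sub>R f x \<partial>lborel) = measure lebesgue T *\<^sub>R f (centroid V)"
proof -
  have "(\<integral>x. indicator T x *\<^sub>R f x \<partial>lborel) = (\<integral>x. (\<Sum>q\<in>V. (indicator T x * lam q x) *\<^sub>R f q) \<partial>lborel)"
    by (subst affine_bary_expansion[OF L]) (simp add: scaleR_sum_right)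
  also have "\<dots> = (\<Sum>q\<in>V. \<integral>x. (indicator T x * lam q x) *\<^sub>R f q \<partial>lborel)"
    using integrable_T[OF continuous_on_bary] by (intro Bochner_Integration.integral_sum integrable_scaleR_left) auto
  also have "\<dots> = (\<Sum>q\<in>V. (\<integral>x. indicator T x * lam q x \<partial>lborel) *\<^sub>R f q)"
    using integrable_T[OF continuous_on_bary] by (intro sum.cong refl integral_scaleR_left) auto
  also have "\<dots> = (\<Sum>q\<in>V. measure lebesgue T *\<^sub>R (lam q (centroid V) *\<^sub>R f q))"
    by (intro sum.cong) (auto simp: integral_bary bary_centroid)
  also have "\<dots> = measure lebesgue T *\<^sub>R f (centroid V)"
    by (simp add: affine_bary_expansion[OF L, of "centroid V"] scaleR_sum_right)
  finally show ?thesis .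
qed

lemma mean_value_affine:
  fixes v :: "real^'d \<Rightarrow> 'b::euclidean_space"
  assumes L: "linear L" "\<And>x. x \<in> interior T \<Longrightarrow> v x = c + L x"
  shows "(1 / measure lebesgue T) *\<^sub>R integral\<^sup>L (lebesgue_on T) v = c + L (centroid V)"
proof -
  have "integral\<^sup>L (lebesgue_on T) v = (\<integral>x. indicator T x *\<^sub>R v x \<partial>lebesgue)"
    by (rule integral_restrict_space) simp
  also have "\<dots> = (\<integral>x. indicator T x *\<^sub>R (c + L x) \<partial>lborel)"
  proof (rule integral_completion_AE_cong)
    show "(\<lambda>x. indicator T x *\<^sub>R (c + L x)) \<in> borel_measurable lborel"
      using L(1) by (intro borel_measurable_integrable integrable_T continuous_intros linear_continuous_on)
        (simp add: linear_conv_bounded_linear)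
    show "AE x in lborel. indicator T x *\<^sub>R (c + L x) = indicator T x *\<^sub>R v x"
      using AE_interior by eventually_elim (auto simp: L(2) indicator_def)
  qed
  also have "\<dots> = measure lebesgue T *\<^sub>R (c + L (centroid V))"
    using integral_affine[OF L(1), of "\<lambda>x. c + L x" c] by simp
  finally show ?thesis using measure_T_pos by simp
qed

text \<open>The area of a facet is the volume of the cylinder of height one on it, so this is the volume of
  a pyramid: \<open>\<bar>T\<bar> = h area / d\<close> with the height \<open>h = 1 / norm (G p)\<close>.  In the coordinates in which
  the simplex is the standard simplex, the cylinder is the image of the standard prism under a linear
  map \<open>N\<close> that only changes the direction of the \<open>k\<close>-th axis, and the prism has \<open>d\<close> times the volume
  of the standard simplex.\<close>

lemma side_measure_pyramid:
  assumes p: "p \<in> V"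
  shows "measure lebesgue (side_cylinder (F p)) = real CARD('d) * measure lebesgue T * norm (G p)"
proof -
  obtain r where r: "r \<in> V - {p}" using facet_vertices_nonempty[OF p] by blast
  have "card (UNIV::'d set) = card (V - {r})" using card_facet[of r] r by simp
  then obtain e where e: "bij_betw e (UNIV::'d set) (V - {r})"
    using finite_V by (metis finite_class.finite_UNIV finite_Diff finite_same_card_bij)
  obtain k where k: "e k = p" using e p r unfolding bij_betw_def by (metis DiffI Diff_iff image_iff singleton_iff)
  have eV: "e i \<in> V - {r}" for i using e unfolding bij_betw_def by blast
  have e_inj: "e i = e j \<longleftrightarrow> i = j" for i j using e unfolding bij_betw_def inj_on_def by blast
  have sumV: "(\<Sum>q\<in>V. f q) = f r + (\<Sum>i\<in>UNIV. f (e i))" for f :: "real^'d \<Rightarrow> 'b::comm_monoid_add"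
    using r finite_V sum.reindex_bij_betw[OF e, of f] by (simp add: sum.remove[of V r])
  define L where "L = (\<lambda>y::real^'d. \<Sum>i\<in>UNIV. y $ i *\<^sub>R (e i - r))"
  define Y where "Y = (\<lambda>x::real^'d. \<chi> i. G (e i) \<bullet> x)"
  have linL: "linear L" unfolding L_def
    by (rule linearI) (simp_all add: scaleR_add_left sum.distrib scaleR_sum_right)
  have LY: "L (Y x) = x" for x
  proof -
    have s: "G r \<bullet> x = - (\<Sum>i\<in>UNIV. G (e i) \<bullet> x)" using bary_grad_expansion(1)[of x] by (simp add: sumV)
    have "x = (\<Sum>q\<in>V. (G q \<bullet> x) *\<^sub>R q)" by (simp add: bary_grad_expansion)
    also have "\<dots> = (\<Sum>i\<in>UNIV. (G (e i) \<bullet> x) *\<^sub>R e i) - (\<Sum>i\<in>UNIV. (G (e i) \<bullet> x)) *\<^sub>R r"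
      by (simp add: sumV s)
    also have "\<dots> = L (Y x)" by (simp add: L_def Y_def scaleR_diff_right sum_subtractf scaleR_sum_left)
    finally show ?thesis ..
  qed
  have YL: "Y (L y) = y" for y
  proof -
    have Ge: "G (e i) \<bullet> (e j - r) = (if j = i then 1 else 0)" for i j
      using eV[of i] eV[of j] r by (auto simp: bary_vertex e_inj simp flip: bary_diff)
    show ?thesis
      by (simp add: Y_def L_def vec_eq_iff inner_sum_right Ge if_distrib cong: if_cong)
  qed
  have lame: "lam (e i) (r + x) = Y x $ i" for i x
    using bary_diff[of V "e i" "r + x" r] bary_vertex[of "e i" r] eV[of i] r by (auto simp: Y_def)
  have lamr: "lam r (r + x) = 1 - (\<Sum>i\<in>UNIV. Y x $ i)" for x
    using bary_expansion(1)[of "r + x"] by (simp add: sumV lame)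
  obtain cL where cL: "\<And>S. S \<in> lmeasurable \<Longrightarrow> measure lebesgue (L ` S) = cL * measure lebesgue S"
    using linear_image_measure_scale[OF linL] by blast
  define D where "D = (convex hull (insert 0 Basis) :: (real^'d) set)"
  have D: "D = {x. (\<forall>i. 0 \<le> x $ i) \<and> (\<Sum>i\<in>UNIV. x $ i) \<le> 1}"
  proof -
    have "(\<Sum>b\<in>Basis. x \<bullet> b) = (\<Sum>i\<in>UNIV. x $ i)" for x :: "real^'d"
    proof -
      have B: "(Basis :: (real^'d) set) = range (\<lambda>i. axis i 1)" by (auto simp: Basis_vec_def)
      have I: "inj (\<lambda>i::'d. axis i (1::real))" by (auto simp: inj_on_def axis_eq_axis)
      show ?thesis unfolding B sum.reindex[OF I] by (simp add: inner_axis o_def)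
    qed
    then show ?thesis unfolding D_def std_simplex by (auto simp: Basis_vec_def inner_axis)
  qed
  have "compact D" unfolding D_def by (intro finite_imp_compact_convex_hull) auto
  then have mD: "D \<in> lmeasurable" "measure lebesgue D = 1 / fact CARD('d)"
    using content_std_simplex[where 'a = "real^'d"]
    by (auto intro: lmeasurable_compact simp: D_def borel_compact)
  have T_eq: "T = (+) r ` L ` D"
  proof (rule set_eqI)
    fix x
    have "x \<in> T \<longleftrightarrow> 0 \<le> lam r x \<and> (\<forall>i. 0 \<le> lam (e i) x)"
      unfolding in_simplex_iff using e r unfolding bij_betw_def by (metis DiffI Diff_iff empty_iff imageE insert_iff rangeI)
    also have "\<dots> \<longleftrightarrow> Y (x - r) \<in> D" using lame[of _ "x - r"] lamr[of "x - r"] by (auto simp: D)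
    also have "\<dots> \<longleftrightarrow> x \<in> (+) r ` L ` D"
    proof
      assume "Y (x - r) \<in> D"
      then show "x \<in> (+) r ` L ` D" using LY[of "x - r"] by (force simp: image_iff)
    next
      assume "x \<in> (+) r ` L ` D" then show "Y (x - r) \<in> D" using YL by auto
    qed
    finally show "x \<in> T \<longleftrightarrow> x \<in> (+) r ` L ` D" .
  qed
  have mT: "measure lebesgue T = cL / fact CARD('d)"
    unfolding T_eq measure_translation by (simp add: cL mD)
  define P where "P = (std_prism k :: (real^'d) set)"
  have mP: "P \<in> lmeasurable" "P \<in> sets borel" "measure lebesgue P = 1 / fact (CARD('d) - 1)"
    unfolding P_def by (rule measure_std_prism)+
  define n where "n = side_normal (F p)"
  obtain cn where cn: "n = cn *\<^sub>R G p" "\<bar>cn\<bar> * norm (G p) = 1"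
    using side_normal_facet[OF p] unfolding n_def by metis
  define \<alpha> where "\<alpha> = G p \<bullet> n"
  have abs_\<alpha>: "\<bar>\<alpha>\<bar> = norm (G p)"
  proof -
    have "\<bar>\<alpha>\<bar> = (\<bar>cn\<bar> * norm (G p)) * norm (G p)" by (simp add: \<alpha>_def cn(1) abs_mult dot_square_norm power2_eq_square)
    then show ?thesis by (simp add: cn(2))
  qed
  define w where "w = (\<chi> i. if i = k then -2 else Y n $ i)"
  \<comment> \<open>The map \<open>N\<close> is a reflection with the right image of the \<open>k\<close>-th axis up to its \<open>k\<close>-th component, followed by a rescaling of that component.\<close>
  define R where "R = (\<lambda>y::real^'d. y + (0 + axis k 1 \<bullet> y) *\<^sub>R w)"
  define m where "m = (\<lambda>i::'d. if i = k then - \<alpha> else 1)"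
  define N where "N = (\<lambda>y. (\<chi> i. m i * R y $ i) :: real^'d)"
  have Yk: "Y n $ k = \<alpha>" by (simp add: Y_def k \<alpha>_def)
  have N: "N y = (\<chi> i. if i = k then \<alpha> * y $ k else y $ i + y $ k * Y n $ i)" for y
    by (auto simp: N_def m_def R_def w_def vec_eq_iff inner_axis')
  have mN: "N ` P \<in> lmeasurable" "measure lebesgue (N ` P) = \<bar>\<alpha>\<bar> * measure lebesgue P"
  proof -
    have aw: "axis k 1 \<bullet> w = -2" by (simp add: w_def inner_axis')
    have "linear R" unfolding R_def by (rule linearI) (simp_all add: algebra_simps inner_add_right)
    then have RP: "R ` P \<in> lmeasurable" using linear_image_measure_scale mP(1) by blast
    have "measure lebesgue (R ` P) = measure lebesgue P"
      unfolding R_def by (rule measure_affine_reflection[OF aw mP(2)])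
    moreover have NP: "N ` P = (\<lambda>x. \<chi> i. m i * x $ i) ` R ` P" unfolding N_def image_image ..
    moreover have "\<bar>prod m UNIV\<bar> = \<bar>\<alpha>\<bar>" by (simp add: m_def prod.remove[of UNIV k] prod.neutral)
    ultimately show "measure lebesgue (N ` P) = \<bar>\<alpha>\<bar> * measure lebesgue P"
      using measure_stretch[OF RP, of m] by simp
    show "N ` P \<in> lmeasurable" unfolding NP by (rule measurable_stretch[OF RP])
  qed
  have LN: "L (N y) = L (\<chi> i. if i = k then 0 else y $ i) + y $ k *\<^sub>R n" for y
  proof -
    have "N y = (\<chi> i. if i = k then 0 else y $ i) + y $ k *\<^sub>R Y n"
      by (auto simp: N vec_eq_iff Yk)
    then show ?thesis using linL by (simp add: linear_add linear_scale LY)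
  qed
  have cyl: "side_cylinder (F p) = (+) r ` L ` N ` P"
  proof -
    let ?z = "\<lambda>y::real^'d. (\<chi> i. if i = k then 0 else y $ i)"
    have zF: "r + L (?z y) \<in> F p \<longleftrightarrow> (\<forall>i. i \<noteq> k \<longrightarrow> 0 \<le> y $ i) \<and> (\<Sum>i\<in>UNIV - {k}. y $ i) \<le> 1" for y
    proof -
      have l: "lam (e i) (r + L (?z y)) = (if i = k then 0 else y $ i)" for i by (simp add: lame YL)
      have lr: "lam r (r + L (?z y)) = 1 - (\<Sum>i\<in>UNIV - {k}. y $ i)"
        by (simp add: lamr YL sum.remove[of UNIV k])
      have V': "V - {p} = insert r (e ` (UNIV - {k}))"
      proof -
        have "V = insert r (range e)" using e r unfolding bij_betw_def by auto
        moreover have "range e = insert p (e ` (UNIV - {k}))" using k by auto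
        moreover have "p \<notin> e ` (UNIV - {k})" using k e_inj by auto
        ultimately show ?thesis using r by auto
      qed
      have "(\<forall>q\<in>V - {p}. 0 \<le> lam q (r + L (?z y))) \<longleftrightarrow>
          0 \<le> lam r (r + L (?z y)) \<and> (\<forall>i. i \<noteq> k \<longrightarrow> 0 \<le> lam (e i) (r + L (?z y)))"
        unfolding V' by auto
      moreover have "lam p (r + L (?z y)) = 0" using l[of k] k by simp
      ultimately show ?thesis unfolding in_facet_iff[OF p] l lr by auto
    qed
    show ?thesis
    proof (intro equalityI subsetI)
      fix x assume "x \<in> side_cylinder (F p)"
      then obtain x' t where x: "x = x' + t *\<^sub>R n" "x' \<in> F p" "0 \<le> t" "t \<le> 1"
        unfolding side_cylinder_def n_def by auto
      define y where "y = (\<chi> i. if i = k then t else Y (x' - r) $ i)"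
      have "Y (x' - r) $ k = 0" using x(2) in_facet_iff[OF p] lame[of k "x' - r"] k by simp
      then have z: "?z y = Y (x' - r)" by (auto simp: y_def vec_eq_iff)
      then have x': "x' = r + L (?z y)" by (simp add: LY)
      then have "y \<in> P" using zF[of y] x by (auto simp: P_def std_prism_def y_def)
      moreover have "x = r + L (N y)" using x(1) x' by (simp add: LN) (simp add: y_def)
      ultimately show "x \<in> (+) r ` L ` N ` P" by blast
    next
      fix x assume "x \<in> (+) r ` L ` N ` P"
      then obtain y where y: "y \<in> P" "x = r + L (N y)" by auto
      then have "x = (r + L (?z y)) + y $ k *\<^sub>R n" by (simp add: LN)
      moreover have "r + L (?z y) \<in> F p" using zF y(1) by (auto simp: P_def std_prism_def)
      moreover have "0 \<le> y $ k" "y $ k \<le> 1" using y(1) by (auto simp: P_def std_prism_def)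
      ultimately show "x \<in> side_cylinder (F p)" unfolding side_cylinder_def n_def by blast
    qed
  qed
  have "measure lebesgue (side_cylinder (F p)) = cL * (\<bar>\<alpha>\<bar> / fact (CARD('d) - 1))"
    unfolding cyl measure_translation by (simp add: cL mN mP)
  also have "\<dots> = real CARD('d) * measure lebesgue T * norm (G p)"
    unfolding mT abs_\<alpha> by (subst fact_reduce[of "CARD('d)"]) (auto simp: field_simps)
  finally show ?thesis .
qed

end

section \<open>Area and quadrature on a facet\<close>

context full_simplex
begin

lemma inner_normal_facet:
  assumes p: "p \<in> V" and x: "x \<in> affine hull F p" "y \<in> affine hull F p"
  shows "side_normal (F p) \<bullet> (x - y) = 0"
proof -
  obtain c where c: "side_normal (F p) = c *\<^sub>R G p" using side_normal_facet[OF p] by metis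
  obtain z where z: "z \<in> F p" using facet_vertices_nonempty[OF p] by fastforce
  have "affine hull F p \<subseteq> {x. G p \<bullet> x = G p \<bullet> z}"
  proof (rule hull_minimal)
    show "F p \<subseteq> {x. G p \<bullet> x = G p \<bullet> z}" using grad_facet[OF p _ z] by (auto simp: inner_diff_right)
  qed (rule affine_hyperplane)
  from subsetD[OF this x(1)] subsetD[OF this x(2)] have "G p \<bullet> x = G p \<bullet> y" by simp
  then show ?thesis by (simp add: c inner_diff_right)
qed

abbreviation "cp p \<equiv> closest_point (affine hull F p)"

lemma closest_point_cylinder:
  assumes p: "p \<in> V" and x: "x \<in> affine hull F p"
  shows "cp p (x + t *\<^sub>R side_normal (F p)) = x"
proof (rule closest_point_unique[symmetric])
  show "\<forall>z\<in>affine hull F p. dist (x + t *\<^sub>R side_normal (F p)) x \<le> dist (x + t *\<^sub>R side_normal (F p)) z"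
  proof
    fix z assume z: "z \<in> affine hull F p"
    let ?n = "side_normal (F p)"
    have o: "?n \<bullet> (x - z) = 0" by (rule inner_normal_facet[OF p x z])
    have "(norm (t *\<^sub>R ?n))\<^sup>2 \<le> (norm (x - z))\<^sup>2 + (norm (t *\<^sub>R ?n))\<^sup>2" by simp
    also have "\<dots> = (norm ((x - z) + t *\<^sub>R ?n))\<^sup>2"
      using o by (subst norm_add_Pythagorean) (auto simp: orthogonal_def inner_commute)
    finally have "norm (t *\<^sub>R ?n) \<le> norm ((x - z) + t *\<^sub>R ?n)" by (rule power2_le_imp_le) simp
    then show "dist (x + t *\<^sub>R ?n) x \<le> dist (x + t *\<^sub>R ?n) z"
      by (simp add: dist_norm algebra_simps)
  qed
qed (use x in auto)

text \<open>On the cylinder this is the closest point of the hyperplane of the facet, in an affine form.\<close>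

definition proj :: "real^'d \<Rightarrow> real^'d \<Rightarrow> real^'d" where
  "proj p y = y - (side_normal (F p) \<bullet> (y - centroid (V - {p}))) *\<^sub>R side_normal (F p)"

lemma facet_centroid_mem: "p \<in> V \<Longrightarrow> centroid (V - {p}) \<in> F p"
  unfolding in_facet_iff by (auto simp: bary_facet_centroid)

lemma proj_cylinder:
  assumes p: "p \<in> V" and x: "x \<in> F p"
  shows "proj p (x + t *\<^sub>R side_normal (F p)) = x"
proof -
  let ?n = "side_normal (F p)"
  have "?n \<bullet> ?n = 1" using side_normal_facet[OF p] by (metis norm_eq_1)
  moreover have "?n \<bullet> (x - centroid (V - {p})) = 0"
    using inner_normal_facet[OF p] hull_inc[OF x] hull_inc[OF facet_centroid_mem[OF p]] by blast
  moreover have "?n \<bullet> (x + t *\<^sub>R ?n - centroid (V - {p})) = ?n \<bullet> (x - centroid (V - {p})) + t * (?n \<bullet> ?n)"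
    by (simp add: inner_add_right inner_diff_right)
  ultimately show ?thesis by (simp add: proj_def)
qed

abbreviation "cyl p \<equiv> side_cylinder (F p)"

lemma cyl_borel: "cyl p \<in> sets borel"
  using compact_side_cylinder[OF compact_F] by (simp add: borel_compact)

text \<open>The side measure of the facet before its completion.\<close>

abbreviation "raw_side p \<equiv> distr (restrict_space lborel (cyl p)) borel (cp p)"

lemma closest_point_measurable: "p \<in> V \<Longrightarrow> cp p \<in> borel_measurable (restrict_space lborel (cyl p))"
  using facet_vertices_nonempty[of p]
  by (intro measurable_restrict_space1) (auto intro!: borel_measurable_continuous_onI continuous_on_closest_point affine_imp_convex)

lemma raw_integral:
  fixes f :: "real^'d \<Rightarrow> 'b::{banach, second_countable_topology}"
  assumes p: "p \<in> V" and f: "f \<in> borel_measurable borel"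
  shows "integral\<^sup>L (raw_side p) (\<lambda>x. indicator (F p) x *\<^sub>R f x) = (\<integral>y. indicator (cyl p) y *\<^sub>R f (proj p y) \<partial>lborel)"
proof -
  have [measurable]: "F p \<in> sets borel" using compact_F by (simp add: borel_compact)
  have "integral\<^sup>L (raw_side p) (\<lambda>x. indicator (F p) x *\<^sub>R f x) =
    (\<integral>y. indicator (F p) (cp p y) *\<^sub>R f (cp p y) \<partial>restrict_space lborel (cyl p))"
    using f by (intro integral_distr closest_point_measurable[OF p]) measurable
  also have "\<dots> = (\<integral>y. indicator (cyl p) y *\<^sub>R (indicator (F p) (cp p y) *\<^sub>R f (cp p y)) \<partial>lborel)"
    using cyl_borel by (intro integral_restrict_space) auto
  also have "\<dots> = (\<integral>y. indicator (cyl p) y *\<^sub>R f (proj p y) \<partial>lborel)"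
  proof (intro Bochner_Integration.integral_cong refl)
    fix y
    show "indicator (cyl p) y *\<^sub>R (indicator (F p) (cp p y) *\<^sub>R f (cp p y))
        = indicator (cyl p) y *\<^sub>R f (proj p y)"
    proof (cases "y \<in> cyl p")
      case True
      then obtain x t where "y = x + t *\<^sub>R side_normal (F p)" "x \<in> F p" unfolding side_cylinder_def by blast
      then have "cp p y = x" "proj p y = x" "x \<in> F p"
        using closest_point_cylinder[OF p] proj_cylinder[OF p] hull_inc by metis+
      then show ?thesis by simp
    qed simp
  qed
  finally show ?thesis .
qed

lemma raw_emeasure:
  assumes p: "p \<in> V" and A: "A \<in> sets borel"
  shows "emeasure (raw_side p) A = emeasure lborel {y \<in> cyl p. cp p y \<in> A}"
proof -
  have sp: "space (restrict_space lborel (cyl p)) = cyl p" by (simp add: space_restrict_space)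
  have "emeasure (raw_side p) A = emeasure (restrict_space lborel (cyl p)) (cp p -` A \<inter> cyl p)"
    using emeasure_distr[OF closest_point_measurable[OF p] A] by (simp add: sp)
  also have "\<dots> = emeasure lborel (cp p -` A \<inter> cyl p)"
    using cyl_borel by (intro emeasure_restrict_space) auto
  also have "cp p -` A \<inter> cyl p = {y \<in> cyl p. cp p y \<in> A}" by auto
  finally show ?thesis .
qed

lemma measure_side:
  assumes p: "p \<in> V"
  shows "measure (side_measure (F p)) (F p) = real CARD('d) * measure lebesgue T * norm (G p)"
proof -
  have b: "F p \<in> sets borel" using compact_F by (simp add: borel_compact)
  have "{y \<in> cyl p. cp p y \<in> F p} = cyl p"
  proof (intro equalityI subsetI)
    fix y assume y: "y \<in> cyl p"
    then obtain x t where x: "y = x + t *\<^sub>R side_normal (F p)" "x \<in> F p" unfolding side_cylinder_def by blast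
    then have "cp p y = x" using closest_point_cylinder[OF p] hull_inc by metis
    then show "y \<in> {y \<in> cyl p. cp p y \<in> F p}" using x y by simp
  qed auto
  then have "measure (side_measure (F p)) (F p) = measure lebesgue (cyl p)"
    using raw_emeasure[OF p b] b cyl_borel unfolding side_measure_def measure_def by simp
  then show ?thesis by (simp add: side_measure_pyramid[OF p])
qed

lemma measure_side_pos: "p \<in> V \<Longrightarrow> 0 < measure (side_measure (F p)) (F p)"
  using measure_T_pos bary_grad_nonzero by (simp add: measure_side)

text \<open>The points of the cylinder over the relative boundary of the facet lie in the topological
  boundary of the cylinder, which is a null set because the cylinder is convex.\<close>

lemma raw_null_rel_frontier:
  assumes p: "p \<in> V" shows "F p - rel_interior (F p) \<in> null_sets (raw_side p)"
proof -
  let ?N = "F p - rel_interior (F p)"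
  let ?C = "{y \<in> cyl p. cp p y \<in> ?N}"
  have cl: "closed (F p)" using compact_F compact_imp_closed by blast
  have "closed ?N" using closed_rel_frontier[of "F p"] cl by (simp add: rel_frontier_def)
  then have b: "?N \<in> sets borel" by auto
  have "?C \<subseteq> frontier (cyl p)"
  proof clarify
    fix y assume y: "y \<in> cyl p" and N: "cp p y \<in> F p" "cp p y \<notin> rel_interior (F p)"
    obtain x t where x: "y = x + t *\<^sub>R side_normal (F p)" "x \<in> F p" using y unfolding side_cylinder_def by blast
    have cx: "cp p y = x" using x closest_point_cylinder[OF p] hull_inc by metis
    have "y \<notin> interior (cyl p)"
    proof
      assume "y \<in> interior (cyl p)"
      then obtain e where e: "e > 0" "ball y e \<subseteq> cyl p" unfolding mem_interior by blast
      have "ball x e \<inter> affine hull F p \<subseteq> F p"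
      proof clarify
        fix z assume z: "z \<in> ball x e" "z \<in> affine hull F p"
        have "z + t *\<^sub>R side_normal (F p) \<in> ball y e" using z(1) by (simp add: x(1) dist_norm)
        then obtain x' t' where x': "z + t *\<^sub>R side_normal (F p) = x' + t' *\<^sub>R side_normal (F p)" "x' \<in> F p"
          using e(2) unfolding side_cylinder_def by blast
        then have "z = x'" using closest_point_cylinder[OF p] z(2) hull_inc by metis
        then show "z \<in> F p" using x' by simp
      qed
      then have "x \<in> rel_interior (F p)" unfolding mem_rel_interior_ball using x(2) e(1) by blast
      then show False using N(2) cx by simp
    qed
    moreover have "y \<in> closure (cyl p)" using y closure_subset by blast
    ultimately show "y \<in> frontier (cyl p)" by (simp add: frontier_def)
  qed
  moreover have "convex (cyl p)" by (intro convex_side_cylinder convex_convex_hull)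
  ultimately have "negligible ?C" using negligible_convex_frontier negligible_subset by blast
  moreover have "?C \<in> sets lborel"
  proof -
    have "?C = cp p -` ?N \<inter> space (restrict_space lborel (cyl p))"
      by (auto simp: space_restrict_space)
    also have "\<dots> \<in> sets (restrict_space lborel (cyl p))" by (rule measurable_sets[OF closest_point_measurable[OF p] b])
    finally show ?thesis using cyl_borel[of p] by (simp add: sets_restrict_space_iff)
  qed
  ultimately have "?C \<in> null_sets lborel" by (simp add: negligible_iff_null_sets null_sets_completion_iff)
  then show ?thesis using raw_emeasure[OF p b] b by (auto simp: null_sets_def)
qed

lemma side_integral_const:
  fixes f :: "real^'d \<Rightarrow> 'b::{banach, second_countable_topology}"
  assumes p: "p \<in> V" and f: "\<And>x. x \<in> rel_interior (F p) \<Longrightarrow> f x = a"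
  shows "(\<integral>x. indicator (F p) x *\<^sub>R f x \<partial>side_measure (F p)) = measure (side_measure (F p)) (F p) *\<^sub>R a"
proof -
  have [measurable]: "F p \<in> sets borel" using compact_F by (simp add: borel_compact)
  have "(\<integral>x. indicator (F p) x *\<^sub>R f x \<partial>side_measure (F p)) = (\<integral>x. indicator (F p) x *\<^sub>R a \<partial>raw_side p)"
    unfolding side_measure_def
  proof (rule integral_completion_AE_cong)
    show "AE x in raw_side p. indicator (F p) x *\<^sub>R a = indicator (F p) x *\<^sub>R f x"
      using AE_not_in[OF raw_null_rel_frontier[OF p]] by eventually_elim (auto simp: f indicator_def)
  qed simp
  also have "\<dots> = measure (raw_side p) (F p) *\<^sub>R a"
  proof -
    have "emeasure (raw_side p) (F p) < \<infinity>"
    proof -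
      have "emeasure (raw_side p) (F p) \<le> emeasure lborel (cyl p)"
        unfolding raw_emeasure[OF p \<open>F p \<in> sets borel\<close>] using cyl_borel by (intro emeasure_mono) auto
      also have "\<dots> < \<infinity>" using compact_side_cylinder[OF compact_F] emeasure_compact_finite by blast
      finally show ?thesis .
    qed
    then show ?thesis by simp
  qed
  also have "measure (raw_side p) (F p) = measure (side_measure (F p)) (F p)"
    unfolding side_measure_def by simp
  finally show ?thesis .
qed

lemma integral_swap_cyl:
  assumes p: "p \<in> V" and q: "q \<in> V - {p}" "q' \<in> V - {p}"
  shows "(\<integral>y. indicator (cyl p) y * lam q (proj p y) \<partial>lborel) = (\<integral>y. indicator (cyl p) y * lam q' (proj p y) \<partial>lborel)"
proof (cases "q = q'")
  case False
  let ?n = "side_normal (F p)"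
  have qV: "q \<in> V" "q' \<in> V" using q by auto
  have qF: "q \<in> F p" "q' \<in> F p" using q by (auto intro: hull_inc)
  have nw: "?n \<bullet> (q' - q) = 0" using inner_normal_facet[OF p] qF hull_inc by metis
  show ?thesis
    unfolding proj_def
  proof (rule integral_swap_bary[OF qV False nw cyl_borel], fold proj_def)
    fix y assume "y \<in> cyl p"
    then obtain x t where x: "y = x + t *\<^sub>R ?n" "x \<in> F p" "0 \<le> t" "t \<le> 1" unfolding side_cylinder_def by blast
    have "x + (lam q x - lam q' x) *\<^sub>R (q' - q) \<in> F p"
      using x(2) bary_swap[OF qV False] q p unfolding in_facet_iff[OF p] by auto
    moreover have "y + (lam q (proj p y) - lam q' (proj p y)) *\<^sub>R (q' - q) = (x + (lam q x - lam q' x) *\<^sub>R (q' - q)) + t *\<^sub>R ?n"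
      using proj_cylinder[OF p x(2), of t] by (simp add: x(1))
    ultimately show "y + (lam q (proj p y) - lam q' (proj p y)) *\<^sub>R (q' - q) \<in> cyl p"
      unfolding side_cylinder_def using x by blast
  qed
qed simp

lemma integrable_bary_cyl: "integrable lborel (\<lambda>y. indicator (cyl p) y * lam r (proj p y))"
proof -
  have "continuous_on (cyl p) (\<lambda>y. lam r (proj p y))"
    unfolding proj_def by (intro continuous_on_compose2[OF continuous_on_bary[of UNIV]] continuous_intros) auto
  from borel_integrable_compact[OF compact_side_cylinder[OF compact_F] this] show ?thesis by simp
qed

text \<open>As for the simplex, but \<open>lam p\<close> vanishes on the facet and only the other \<open>d\<close> coordinates share
  the area.\<close>

lemma integral_bary_cyl:
  assumes p: "p \<in> V" and q: "q \<in> V"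
  shows "(\<integral>y. indicator (cyl p) y * lam q (proj p y) \<partial>lborel) = measure lebesgue (cyl p) * lam q (centroid (V - {p}))"
proof -
  note int = integrable_bary_cyl
  have zero: "(\<integral>y. indicator (cyl p) y * lam p (proj p y) \<partial>lborel) = 0"
  proof -
    have z: "indicator (cyl p) y * lam p (proj p y) = 0" for y
    proof (cases "y \<in> cyl p")
      case True
      then obtain x t where x: "y = x + t *\<^sub>R side_normal (F p)" "x \<in> F p" unfolding side_cylinder_def by blast
      then show ?thesis using proj_cylinder[OF p x(2)] in_facet_iff[OF p] by simp
    qed simp
    show ?thesis unfolding z by simp
  qed
  show ?thesis
  proof (cases "q = p")
    case True then show ?thesis using zero by (simp add: bary_facet_centroid p)
  next
    case False
    have "(\<Sum>r\<in>V. \<integral>y. indicator (cyl p) y * lam r (proj p y) \<partial>lborel) = (\<integral>y. (\<Sum>r\<in>V. indicator (cyl p) y * lam r (proj p y)) \<partial>lborel)"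
      using int by (subst Bochner_Integration.integral_sum) auto
    also have "\<dots> = (\<integral>y. indicator (cyl p) y \<partial>lborel)"
      by (simp add: bary_expansion flip: sum_distrib_left)
    also have "\<dots> = measure lebesgue (cyl p)" using cyl_borel by simp
    finally have "(\<Sum>r\<in>V. \<integral>y. indicator (cyl p) y * lam r (proj p y) \<partial>lborel) = measure lebesgue (cyl p)" .
    moreover have "(\<Sum>r\<in>V. \<integral>y. indicator (cyl p) y * lam r (proj p y) \<partial>lborel) = (\<Sum>r\<in>V - {p}. \<integral>y. indicator (cyl p) y * lam q (proj p y) \<partial>lborel)"
      unfolding sum.remove[OF finite_V p] zero add_0 using False q
      by (intro sum.cong refl integral_swap_cyl p) auto
    ultimately have "real CARD('d) * (\<integral>y. indicator (cyl p) y * lam q (proj p y) \<partial>lborel) = measure lebesgue (cyl p)"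
      by (simp add: card_facet[OF p])
    then show ?thesis using False by (simp add: bary_facet_centroid p q field_simps)
  qed
qed

lemma side_integral_affine:
  fixes f :: "real^'d \<Rightarrow> 'b::euclidean_space"
  assumes p: "p \<in> V" and L: "linear L" "\<And>x. x \<in> F p \<Longrightarrow> f x = c + L x"
  shows "(\<integral>x. indicator (F p) x *\<^sub>R f x \<partial>side_measure (F p)) = measure (side_measure (F p)) (F p) *\<^sub>R (c + L (centroid (V - {p})))"
proof -
  have [measurable]: "F p \<in> sets borel" using compact_F by (simp add: borel_compact)
  have Lc: "continuous_on UNIV (\<lambda>x. c + L x)"
    using L(1) by (intro continuous_intros linear_continuous_on) (simp add: linear_conv_bounded_linear)
  then have Lm: "(\<lambda>x. c + L x) \<in> borel_measurable borel" by (rule borel_measurable_continuous_onI)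
  note int = integrable_bary_cyl
  have fF: "(\<lambda>x. indicator (F p) x *\<^sub>R f x) = (\<lambda>x. indicator (F p) x *\<^sub>R (c + L x))"
  proof
    fix x show "indicator (F p) x *\<^sub>R f x = indicator (F p) x *\<^sub>R (c + L x)" by (cases "x \<in> F p") (auto simp: L(2))
  qed
  have "(\<integral>x. indicator (F p) x *\<^sub>R f x \<partial>side_measure (F p)) = (\<integral>x. indicator (F p) x *\<^sub>R (c + L x) \<partial>raw_side p)"
    unfolding side_measure_def fF using Lm by (intro integral_completion borel_measurable_scaleR borel_measurable_indicator) auto
  also have "\<dots> = (\<integral>y. indicator (cyl p) y *\<^sub>R (c + L (proj p y)) \<partial>lborel)" by (rule raw_integral[OF p Lm])
  also have "\<dots> = (\<integral>y. (\<Sum>q\<in>V. (indicator (cyl p) y * lam q (proj p y)) *\<^sub>R (c + L q)) \<partial>lborel)"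
    by (subst affine_bary_expansion[OF L(1), of "\<lambda>x. c + L x" c]) (simp_all add: scaleR_sum_right)
  also have "\<dots> = (\<Sum>q\<in>V. \<integral>y. (indicator (cyl p) y * lam q (proj p y)) *\<^sub>R (c + L q) \<partial>lborel)"
    using int by (intro Bochner_Integration.integral_sum integrable_scaleR_left) auto
  also have "\<dots> = (\<Sum>q\<in>V. (\<integral>y. indicator (cyl p) y * lam q (proj p y) \<partial>lborel) *\<^sub>R (c + L q))"
    using int by (intro sum.cong refl integral_scaleR_left) auto
  also have "\<dots> = (\<Sum>q\<in>V. measure lebesgue (cyl p) *\<^sub>R (lam q (centroid (V - {p})) *\<^sub>R (c + L q)))"
    by (intro sum.cong) (auto simp: integral_bary_cyl p)
  also have "\<dots> = measure lebesgue (cyl p) *\<^sub>R (c + L (centroid (V - {p})))"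
    using affine_bary_expansion[OF L(1), of "\<lambda>x. c + L x" c "centroid (V - {p})"] by (simp add: scaleR_sum_right)
  also have "measure lebesgue (cyl p) = measure (side_measure (F p)) (F p)"
    by (simp add: measure_side side_measure_pyramid p)
  finally show ?thesis .
qed

lemma side_mean_affine:
  fixes f :: "real^'d \<Rightarrow> 'b::euclidean_space"
  assumes p: "p \<in> V" and L: "linear L" "\<And>x. x \<in> F p \<Longrightarrow> f x = c + L x"
  shows "side_mean (F p) f = c + L (centroid (V - {p}))"
  using side_integral_affine[OF assms] measure_side_pos[OF p] by (simp add: side_mean_def)

end

section \<open>The Gauss formula on a simplex\<close>

text \<open>The multi-indices of order at most one are zero and the unit multi-indices.\<close>

lemma polynomial_deg_1_iff:
  fixes p :: "real^'d \<Rightarrow> real"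
  shows "polynomial_deg 1 p \<longleftrightarrow> (\<exists>b a. \<forall>x. p x = b + a \<bullet> x)"
proof -
  define z where "z = (\<lambda>_::'d. 0::nat)"
  define e where "e = (\<lambda>i j::'d. if j = i then 1 else (0::nat))"
  have I: "{\<alpha>::'d \<Rightarrow> nat. sum \<alpha> UNIV \<le> 1} = insert z (range e)"
  proof (intro equalityI subsetI)
    fix \<alpha> :: "'d \<Rightarrow> nat" assume a: "\<alpha> \<in> {\<alpha>. sum \<alpha> UNIV \<le> 1}"
    show "\<alpha> \<in> insert z (range e)"
    proof (cases "\<alpha> = z")
      case False
      then obtain i where i: "\<alpha> i \<noteq> 0" by (auto simp: z_def)
      have "sum \<alpha> UNIV = \<alpha> i + sum \<alpha> (UNIV - {i})" by (rule sum.remove) auto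
      then have "\<alpha> i + sum \<alpha> (UNIV - {i}) \<le> 1" using a by simp
      then have "\<alpha> i = 1" "sum \<alpha> (UNIV - {i}) = 0" using i by linarith+
      then have "\<alpha> = e i" by (auto simp: e_def fun_eq_iff)
      then show ?thesis by blast
    qed simp
  next
    fix \<alpha> assume "\<alpha> \<in> insert z (range e)"
    then show "\<alpha> \<in> {\<alpha>. sum \<alpha> UNIV \<le> 1}" by (auto simp: z_def e_def)
  qed
  have inj: "inj e" by (auto simp: inj_def e_def fun_eq_iff split: if_splits)
  have nz: "z \<notin> range e"
  proof
    assume "z \<in> range e"
    then obtain i where "z = e i" by blast
    then have "z i = e i i" by simp
    then show False by (simp add: z_def e_def)
  qed
  have pz: "(\<Prod>j\<in>UNIV. (x $ j) ^ z j) = 1" for x :: "real^'d" by (simp add: z_def)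
  have pe: "(\<Prod>j\<in>UNIV. (x $ j) ^ e i j) = x $ i" for x :: "real^'d" and i
    by (simp add: e_def if_distrib[of "\<lambda>n. _ ^ n"] cong: if_cong)
  have S: "(\<Sum>\<alpha>\<in>{\<alpha>. sum \<alpha> UNIV \<le> 1}. c \<alpha> * (\<Prod>i\<in>UNIV. (x $ i) ^ \<alpha> i)) = c z + (\<Sum>i\<in>UNIV. c (e i) * x $ i)"
    for c :: "('d \<Rightarrow> nat) \<Rightarrow> real" and x :: "real^'d"
    unfolding I by (subst sum.insert[OF _ nz]) (simp_all add: sum.reindex[OF inj] pz pe o_def)
  show ?thesis
  proof
    assume "polynomial_deg 1 p"
    then obtain c where "p = (\<lambda>x. c z + (\<Sum>i\<in>UNIV. c (e i) * x $ i))"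
      unfolding polynomial_deg_def S by blast
    then show "\<exists>b a. \<forall>x. p x = b + a \<bullet> x"
      by (intro exI[of _ "c z"] exI[of _ "\<chi> i. c (e i)"]) (simp add: inner_vec_def)
  next
    assume "\<exists>b a. \<forall>x. p x = b + a \<bullet> x"
    then obtain b a where p: "\<And>x. p x = b + a \<bullet> x" by blast
    define c where "c = (\<lambda>\<alpha>. if \<alpha> = z then b else a $ (inv e \<alpha>))"
    have "c z + (\<Sum>i\<in>UNIV. c (e i) * x $ i) = p x" for x
    proof -
      have "c (e i) = a $ i" for i using nz inj by (auto simp: c_def) 
      then show ?thesis by (simp add: c_def p inner_vec_def)
    qed
    then show "polynomial_deg 1 p" unfolding polynomial_deg_def S by (intro exI[of _ c]) auto
  qed
qed

text \<open>Points of a closed convex set with nonempty interior are limits of interior points, so the limit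
  in the definition of the trace is unique.\<close>

lemma elem_trace_eq:
  fixes v :: "'a::euclidean_space \<Rightarrow> 'b::t2_space"
  assumes T: "convex T" "closed T" "interior T \<noteq> {}" and x: "x \<in> T"
    and f: "\<And>z. z \<in> interior T \<Longrightarrow> v z = f z" and c: "isCont f x"
  shows "elem_trace T v x = f x"
  unfolding elem_trace_def
proof (rule tendsto_Lim)
  have "x \<in> closure (interior T)" using convex_closure_interior[OF T(1,3)] T(2) x by simp
  then have "x islimpt interior T"
    using islimpt_subset interior_subset by (auto simp: closure_def intro: interior_limit_point[of x "interior T", simplified])
  then show "at x within interior T \<noteq> bot" by (simp add: trivial_limit_within)
  have "(f \<longlongrightarrow> f x) (at x within interior T)" using c by (meson UNIV_I continuous_within isCont_def tendsto_within_subset subset_UNIV)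
  moreover have "eventually (\<lambda>z. v z = f z) (at x within interior T)"
    unfolding eventually_at_filter using f by (intro always_eventually) auto
  ultimately show "(v \<longlongrightarrow> f x) (at x within interior T)"
    using tendsto_cong by fastforce
qed

lemma grad_h_affine:
  assumes x: "x \<in> interior T" and v: "\<And>z. z \<in> interior T \<Longrightarrow> v z = c + W *v z"
  shows "grad_h v x = W"
proof -
  have "((\<lambda>z. c + W *v z) has_derivative (\<lambda>h. W *v h)) (at x)"
    by (auto intro!: derivative_eq_intros bounded_linear_imp_has_derivative)
  then have "(v has_derivative (\<lambda>h. W *v h)) (at x)"
    by (rule has_derivative_transform_within_open[OF _ open_interior x]) (simp add: v)
  then have "frechet_derivative v (at x) = (\<lambda>h. W *v h)" by (rule frechet_derivative_at[symmetric])
  then show ?thesis unfolding grad_h_def jacobian_def by (simp add: matrix_of_matrix_vector_mul)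
qed

lemma tensor_mult_vec: "(a \<otimes>\<^sub>t b) *v x = (b \<bullet> x) *\<^sub>R a"
  by (simp add: tensor_def matrix_vector_mult_def vec_eq_iff inner_vec_def sum_distrib_right sum_distrib_left algebra_simps)

lemma tensor_nth: "(a \<otimes>\<^sub>t b) $ i = a $ i *\<^sub>R b"
  by (simp add: tensor_def vec_eq_iff)

lemma tensor_simps: "a \<otimes>\<^sub>t (x + y) = a \<otimes>\<^sub>t x + a \<otimes>\<^sub>t y" "a \<otimes>\<^sub>t (x - y) = a \<otimes>\<^sub>t x - a \<otimes>\<^sub>t y"
  "a \<otimes>\<^sub>t (t *\<^sub>R x) = t *\<^sub>R (a \<otimes>\<^sub>t x)" "(t *\<^sub>R a) \<otimes>\<^sub>t x = t *\<^sub>R (a \<otimes>\<^sub>t x)"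
  "(a + b) \<otimes>\<^sub>t x = a \<otimes>\<^sub>t x + b \<otimes>\<^sub>t x" "0 \<otimes>\<^sub>t x = 0" "a \<otimes>\<^sub>t 0 = 0"
  by (simp_all add: tensor_def vec_eq_iff algebra_simps)

lemma linear_tensor: "linear (\<lambda>x. a \<otimes>\<^sub>t x)"
  by (rule linearI) (simp_all add: tensor_simps)

lemma div_h_affine:
  fixes y :: "real^'d \<Rightarrow> real^'d^'l"
  assumes x: "x \<in> interior T" and y: "\<And>z. z \<in> interior T \<Longrightarrow> y z = a + c \<otimes>\<^sub>t z"
  shows "div_h y x = real CARD('d) *\<^sub>R c"
proof -
  have "trace (jacobian (\<lambda>z. y z $ i) (at x)) = real CARD('d) * c $ i" for i
  proof -
    have "((\<lambda>z. a $ i + c $ i *\<^sub>R z) has_derivative (\<lambda>h. c $ i *\<^sub>R h)) (at x)"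
      by (auto intro!: derivative_eq_intros)
    then have "((\<lambda>z. y z $ i) has_derivative (\<lambda>h. c $ i *\<^sub>R h)) (at x)"
      by (rule has_derivative_transform_within_open[OF _ open_interior x]) (simp add: y tensor_nth)
    then have "frechet_derivative (\<lambda>z. y z $ i) (at x) = (\<lambda>h. c $ i *\<^sub>R h)" by (rule frechet_derivative_at[symmetric])
    then show ?thesis unfolding jacobian_def by (simp add: trace_def matrix_def axis_def)
  qed
  then show ?thesis by (simp add: div_h_def vec_eq_iff)
qed

context full_simplex
begin

text \<open>An affine field whose normal components are constant on all facets is a constant plus a multiple
  of the identity.  Its component along \<open>G p\<close> is affine and constant on \<open>F p\<close>, hence of the form
  \<open>k p + \<kappa> p * lam p\<close>.  These components add up to zero because the gradients \<open>G p\<close> do, so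
  \<open>\<Sum>p. \<kappa> p * lam p\<close> is constant, and all \<open>\<kappa> p\<close> agree.\<close>

lemma constant_normal_components:
  assumes L: "linear L" and k: "\<And>p. p \<in> V \<Longrightarrow> \<exists>k. \<forall>x\<in>F p. (a + L x) \<bullet> G p = k"
  shows "\<exists>c. \<forall>x. L x = c *\<^sub>R x"
proof -
  obtain k where k: "\<And>p x. p \<in> V \<Longrightarrow> x \<in> F p \<Longrightarrow> (a + L x) \<bullet> G p = k p" using k by metis
  \<comment> \<open>the increase of the component along \<open>G p\<close> from the facet \<open>F p\<close> to the vertex \<open>p\<close>\<close>
  define \<kappa> where "\<kappa> = (\<lambda>p. (a + L p) \<bullet> G p - k p)"
  have lin: "linear (\<lambda>x. L x \<bullet> G p)" for p
    using L by (intro linearI) (simp_all add: linear_add linear_scale inner_add_left)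
  have f: "(a + L x) \<bullet> G p = k p + \<kappa> p * lam p x" if p: "p \<in> V" for p x
  proof -
    have "(a + L x) \<bullet> G p = (\<Sum>q\<in>V. lam q x * ((a + L q) \<bullet> G p))"
      using affine_bary_expansion[OF lin, of "\<lambda>x. (a + L x) \<bullet> G p" "a \<bullet> G p" p x] by (simp add: inner_add_left)
    also have "\<dots> = lam p x * ((a + L p) \<bullet> G p) + (\<Sum>q\<in>V - {p}. lam q x * ((a + L q) \<bullet> G p))"
      using finite_V p by (rule sum.remove)
    also have "(\<Sum>q\<in>V - {p}. lam q x * ((a + L q) \<bullet> G p)) = (\<Sum>q\<in>V - {p}. lam q x * k p)"
    proof (intro sum.cong refl)
      fix q assume "q \<in> V - {p}"
      then have "q \<in> F p" by (rule hull_inc)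
      then show "lam q x * ((a + L q) \<bullet> G p) = lam q x * k p" using k[OF p] by simp
    qed
    also have "\<dots> = (1 - lam p x) * k p"
      using bary_expansion(1)[of x] finite_V p by (simp add: sum.remove flip: sum_distrib_right)
    finally show ?thesis by (simp add: \<kappa>_def algebra_simps)
  qed
  have g: "L w \<bullet> G p = \<kappa> p * (G p \<bullet> w)" if p: "p \<in> V" for p w
  proof -
    have "L w \<bullet> G p = (a + L w) \<bullet> G p - (a + L 0) \<bullet> G p" by (simp add: inner_add_left linear_0[OF L])
    also have "\<dots> = \<kappa> p * (lam p w - lam p 0)" unfolding f[OF p] by (simp add: algebra_simps)
    finally show ?thesis by (simp add: bary_diff)
  qed
  have \<kappa>: "\<kappa> q = \<kappa> r" if q: "q \<in> V" "r \<in> V" for q r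
  proof -
    have "0 = (\<Sum>p\<in>V. G p \<bullet> L (q - r))" by (simp add: bary_grad_expansion)
    also have "\<dots> = (\<Sum>p\<in>V. \<kappa> p * (lam p q - lam p r))" 
    proof (intro sum.cong refl)
      fix p assume "p \<in> V"
      then show "G p \<bullet> L (q - r) = \<kappa> p * (lam p q - lam p r)"
        using g[of p "q - r"] by (simp only: bary_diff inner_commute)
    qed
    also have "\<dots> = (\<Sum>p\<in>V. (if p = q then \<kappa> p else 0) - (if p = r then \<kappa> p else 0))"
      using q by (intro sum.cong) (auto simp: bary_vertex)
    also have "\<dots> = \<kappa> q - \<kappa> r" using q finite_V by (simp add: sum_subtractf)
    finally show ?thesis by simp
  qed
  obtain q where q: "q \<in> V" using V_nonempty by blast
  have "L w = \<kappa> q *\<^sub>R w" for w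
  proof -
    have "L w = (\<Sum>p\<in>V. (G p \<bullet> L w) *\<^sub>R p)" by (simp add: bary_grad_expansion)
    also have "\<dots> = (\<Sum>p\<in>V. \<kappa> q *\<^sub>R ((G p \<bullet> w) *\<^sub>R p))"
    proof (intro sum.cong refl)
      fix p assume "p \<in> V"
      then show "(G p \<bullet> L w) *\<^sub>R p = \<kappa> q *\<^sub>R ((G p \<bullet> w) *\<^sub>R p)"
        using g[of p w] \<kappa>[of p q] q by (simp add: inner_commute)
    qed
    also have "\<dots> = \<kappa> q *\<^sub>R (\<Sum>p\<in>V. (G p \<bullet> w) *\<^sub>R p)" by (rule scaleR_sum_right[symmetric])
    also have "\<dots> = \<kappa> q *\<^sub>R w" by (simp only: bary_grad_expansion)
    finally show ?thesis .
  qed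
  then show ?thesis by blast
qed

lemma facet_centroid_shift:
  assumes p: "p \<in> V"
  shows "centroid (V - {p}) - centroid V = (1 / real CARD('d)) *\<^sub>R (centroid V - p)"
proof -
  have "\<Sum>V = p + \<Sum>(V - {p})" using finite_V p by (rule sum.remove)
  then have "(real CARD('d) + 1) *\<^sub>R centroid V = p + real CARD('d) *\<^sub>R centroid (V - {p})"
    using card_V card_facet[OF p] by (simp add: centroid_def add.commute)
  then have "real CARD('d) *\<^sub>R (centroid (V - {p}) - centroid V) = centroid V - p"
    by (simp add: algebra_simps)
  then have "(1 / real CARD('d)) *\<^sub>R (real CARD('d) *\<^sub>R (centroid (V - {p}) - centroid V)) = (1 / real CARD('d)) *\<^sub>R (centroid V - p)"
    by simp
  then show ?thesis by simp
qed

text \<open>Multiplication of the unit normal \<open>- G p / norm (G p)\<close> by the area of the facet removes the norm.\<close>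

lemma local_flux:
  fixes Y :: "real^'d^'l"
  assumes p: "p \<in> V"
  shows "measure (side_measure (F p)) (F p) *\<^sub>R ((Y + ((1 / real CARD('d)) *\<^sub>R e) \<otimes>\<^sub>t (centroid (V - {p}) - centroid V)) *v outer_normal T (F p))
    = measure lebesgue T *\<^sub>R ((1 / (real CARD('d) + 1)) *\<^sub>R e - real CARD('d) *\<^sub>R (Y *v G p))"
proof -
  have "(centroid (V - {p}) - centroid V) \<bullet> G p = - (1 / (real CARD('d) + 1))"
    using bary_diff[of V p "centroid (V - {p})" "centroid V"] p
    by (simp add: bary_facet_centroid bary_centroid inner_commute)
  then have mG: "(Y + ((1 / real CARD('d)) *\<^sub>R e) \<otimes>\<^sub>t (centroid (V - {p}) - centroid V)) *v G p
    = Y *v G p - (1 / (real CARD('d) * (real CARD('d) + 1))) *\<^sub>R e"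
    by (simp add: matrix_vector_mult_add_rdistrib tensor_mult_vec)
  have "norm (G p) > 0" using bary_grad_nonzero[OF p] by simp
  then have c: "real CARD('d) * measure lebesgue T * norm (G p) * - (1 / norm (G p)) = - (real CARD('d) * measure lebesgue T)"
    by simp
  have r: "(1 / (real CARD('d) + 1)) *\<^sub>R e = real CARD('d) *\<^sub>R ((1 / (real CARD('d) * (real CARD('d) + 1))) *\<^sub>R e)"
    by simp
  show ?thesis
    unfolding outer_normal_facet[OF p] measure_side[OF p] matrix_vector_mult_scaleR mG scaleR_scaleR c
    unfolding r by (simp only: scaleR_diff_right scaleR_scaleR minus_mult_left scaleR_minus_left mult.commute[of "measure lebesgue T"]) simp
qed

text \<open>The rows of \<open>Y\<close> are expanded by \<open>bary_grad_expansion\<close>.\<close>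

lemma matrix_inner_expansion:
  fixes W Y :: "real^'d^'l"
  shows "(\<Sum>p\<in>V. (W *v p) \<bullet> (Y *v G p)) = W \<bullet> Y"
proof -
  have "(\<Sum>p\<in>V. (W *v p) \<bullet> (Y *v G p)) = (\<Sum>p\<in>V. \<Sum>i\<in>UNIV. (W $ i \<bullet> p) * (Y $ i \<bullet> G p))"
    by (simp add: inner_vec_def matrix_vector_mul_component)
  also have "\<dots> = (\<Sum>i\<in>UNIV. \<Sum>p\<in>V. (W $ i \<bullet> p) * (Y $ i \<bullet> G p))" by (rule sum.swap)
  also have "\<dots> = (\<Sum>i\<in>UNIV. W $ i \<bullet> (\<Sum>p\<in>V. (G p \<bullet> Y $ i) *\<^sub>R p))"
    by (simp add: inner_sum_right inner_commute mult.commute)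
  also have "\<dots> = W \<bullet> Y" by (simp add: bary_grad_expansion inner_vec_def[of W Y])
  finally show ?thesis .
qed

text \<open>The Gauss theorem for \<open>v \<bullet> y\<close>, where \<open>v\<close> is affine with centroid value \<open>c\<close> and gradient
  \<open>W\<close>, and \<open>y\<close> is a Raviart-Thomas field with centroid value \<open>Y\<close> and divergence \<open>e\<close>.  Then \<open>m p\<close> is the
  mean of \<open>v\<close> over the facet \<open>F p\<close> and \<open>f p\<close> the flux of \<open>y\<close> through it.  Both are explicit in terms of
  \<open>p\<close> and \<open>G p\<close>, and the sums over the vertices are known: the gradients add up to zero and the
  vertices to \<open>d + 1\<close> times the centroid.\<close>

lemma local_integration_by_parts:
  fixes W Y :: "real^'d^'l" and c e :: "real^'l"
  defines "m \<equiv> \<lambda>p. c + W *v (centroid (V - {p}) - centroid V)"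
    and "f \<equiv> \<lambda>p. measure (side_measure (F p)) (F p) *\<^sub>R ((Y + ((1 / real CARD('d)) *\<^sub>R e) \<otimes>\<^sub>t (centroid (V - {p}) - centroid V)) *v outer_normal T (F p))"
  shows "(\<Sum>p\<in>V. m p \<bullet> f p) = measure lebesgue T * (W \<bullet> Y + c \<bullet> e)"
proof -
  let ?d = "real CARD('d)" and ?t = "measure lebesgue T" and ?b = "centroid V"
  have sumG: "(\<Sum>p\<in>V. Y *v G p) = 0"
  proof -
    have "(\<Sum>p\<in>V. G p) = 0" using bary_grad_expansion(1)
      by (metis inner_eq_zero_iff inner_sum_left)
    then show ?thesis using linear_sum[OF matrix_vector_mul_linear[of Y], of G V] by simp
  qed
  have sumV: "(\<Sum>p\<in>V. p) = (?d + 1) *\<^sub>R ?b" using card_V by (simp add: centroid_def add.commute)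
  have f: "f p = ?t *\<^sub>R ((1 / (?d + 1)) *\<^sub>R e - ?d *\<^sub>R (Y *v G p))" if "p \<in> V" for p
    unfolding f_def by (rule local_flux[OF that])
  have m: "m p = c + (1 / ?d) *\<^sub>R (W *v ?b - W *v p)" if "p \<in> V" for p
    unfolding m_def facet_centroid_shift[OF that] by (simp add: matrix_vector_mult_scaleR matrix_vector_mult_diff_distrib)
  have sumf: "(\<Sum>p\<in>V. f p) = ?t *\<^sub>R e"
  proof -
    have "(\<Sum>p\<in>V. f p) = (\<Sum>p\<in>V. ?t *\<^sub>R ((1 / (?d + 1)) *\<^sub>R e - ?d *\<^sub>R (Y *v G p)))"
      by (intro sum.cong refl f)
    also have "\<dots> = ?t *\<^sub>R ((\<Sum>p\<in>V. (1 / (?d + 1)) *\<^sub>R e) - ?d *\<^sub>R (\<Sum>p\<in>V. Y *v G p))"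
      by (simp only: scaleR_sum_right[symmetric] sum_subtractf)
    also have "\<dots> = ?t *\<^sub>R e" unfolding sumG by (simp del: sum_constant add: card_V sum_constant_scaleR add.commute)
    finally show ?thesis .
  qed
  have sumWf: "(\<Sum>p\<in>V. (W *v p) \<bullet> f p) = ?t * ((W *v ?b) \<bullet> e - ?d * (W \<bullet> Y))"
  proof -
    have "(\<Sum>p\<in>V. (W *v p) \<bullet> f p) = (\<Sum>p\<in>V. ?t * ((1 / (?d + 1)) * ((W *v p) \<bullet> e) - ?d * ((W *v p) \<bullet> (Y *v G p))))"
      by (intro sum.cong refl) (simp add: f inner_diff_right)
    also have "\<dots> = ?t * ((1 / (?d + 1)) * ((W *v (\<Sum>p\<in>V. p)) \<bullet> e) - ?d * (\<Sum>p\<in>V. (W *v p) \<bullet> (Y *v G p)))"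
      by (simp only: sum_distrib_left[symmetric] sum_subtractf linear_sum[OF matrix_vector_mul_linear] inner_sum_left)
    also have "\<dots> = ?t * ((W *v ?b) \<bullet> e - ?d * (W \<bullet> Y))"
      unfolding sumV matrix_inner_expansion by (simp add: matrix_vector_mult_scaleR)
    finally show ?thesis .
  qed
  have "(\<Sum>p\<in>V. m p \<bullet> f p) = (\<Sum>p\<in>V. (c + (1 / ?d) *\<^sub>R (W *v ?b)) \<bullet> f p - (1 / ?d) * ((W *v p) \<bullet> f p))"
    by (intro sum.cong refl) (simp add: m inner_add_left inner_diff_left scaleR_diff_right)
  also have "\<dots> = (c + (1 / ?d) *\<^sub>R (W *v ?b)) \<bullet> (\<Sum>p\<in>V. f p) - (1 / ?d) * (\<Sum>p\<in>V. (W *v p) \<bullet> f p)"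
    by (simp only: sum_subtractf inner_sum_right sum_distrib_left)
  also have "\<dots> = ?t * (W \<bullet> Y + c \<bullet> e)"
    unfolding sumf sumWf by (simp add: inner_add_left field_simps)
  finally show ?thesis .
qed

end

section \<open>Elements and sides of a triangulation\<close>

definition verts :: "'a::euclidean_space set \<Rightarrow> 'a set" where
  "verts S = {x. x extreme_point_of S}"

abbreviation bc :: "'a::euclidean_space set \<Rightarrow> 'a" where
  "bc S \<equiv> centroid (verts S)"

locale fe_mesh =
  fixes \<T> :: "(real^'d) set set" and \<Omega> :: "(real^'d) set"
  assumes lip: "bounded_lipschitz_domain \<Omega>" and conf: "conforming_triangulation \<T> \<Omega>"
begin

lemma finite_mesh: "finite \<T>"
  using conf unfolding conforming_triangulation_def triangulation_def by blast

lemma elem_simplex: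
  assumes "T \<in> \<T>"
  shows "full_simplex (verts T)" "convex hull (verts T) = T"
proof -
  obtain C where C: "\<not> affine_dependent C" "int (card C) = int CARD('d) + 1" "T = convex hull C"
    using conf assms unfolding conforming_triangulation_def simplex_def by auto
  have "verts T = C" unfolding verts_def C(3) using extreme_point_of_convex_hull_affine_independent[OF C(1)] by blast
  then show "full_simplex (verts T)" "convex hull (verts T) = T" using C by (auto simp: full_simplex_def)
qed

lemma facetE:
  assumes T: "T \<in> \<T>" and S: "S facet_of T"
  obtains p where "p \<in> verts T" "S = convex hull (verts T - {p})" "verts S = verts T - {p}"
proof -
  interpret full_simplex "verts T" using elem_simplex[OF T] by blast
  obtain p where p: "p \<in> verts T" "S = convex hull (verts T - {p})" using S facet_of_iff elem_simplex(2)[OF T] by auto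
  have "verts S = verts T - {p}"
    unfolding p(2) verts_def[of "convex hull (verts T - {p})"]
    using extreme_point_of_convex_hull_affine_independent[OF affine_independent_Diff[OF indep, of "{p}"]] by blast
  then show thesis using that p by blast
qed

lemma elem_simps:
  assumes T: "T \<in> \<T>"
  shows "compact T" "closed T" "convex T" "bc T \<in> interior T" "interior T \<noteq> {}" "aff_dim T = int CARD('d)"
    "0 < measure lebesgue T"
proof -
  interpret full_simplex "verts T" using elem_simplex[OF T] by blast
  have e: "convex hull (verts T) = T" by (rule elem_simplex(2)[OF T])
  show c: "compact T" "0 < measure lebesgue T" "bc T \<in> interior T" using compact_T measure_T_pos centroid_interior e by simp_all
  show "closed T" using c compact_imp_closed by blast
  show "convex T" using e by (metis convex_convex_hull)
  show i: "interior T \<noteq> {}" using c by blast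
  show "aff_dim T = int CARD('d)" using i by (simp add: aff_dim_nonempty_interior)
qed

text \<open>A Lipschitz domain lies on one side of its boundary: below the graph that describes the boundary
  near \<open>p\<close> there are points arbitrarily close to \<open>p\<close> that are not in the closure.\<close>

lemma interior_closure_domain: "interior (closure \<Omega>) \<subseteq> \<Omega>"
proof
  fix p assume p: "p \<in> interior (closure \<Omega>)"
  show "p \<in> \<Omega>"
  proof (rule ccontr)
    assume n: "p \<notin> \<Omega>"
    have "open \<Omega>" using lip unfolding bounded_lipschitz_domain_def by blast
    then have "p \<in> frontier \<Omega>" using n p interior_subset[of "closure \<Omega>"] by (auto simp: frontier_def interior_open)
    then obtain r e L \<gamma> where r: "r > 0" and e: "norm e = 1" and L: "L-lipschitz_on {y. y \<bullet> e = 0} \<gamma>"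
      and eq: "\<Omega> \<inter> ball p r = {x \<in> ball p r. \<gamma> (x - (x \<bullet> e) *\<^sub>R e) < x \<bullet> e}"
      using lip unfolding bounded_lipschitz_domain_def by blast
    have ee: "e \<bullet> e = 1" using e by (simp add: norm_eq_1)
    have eqI: "x \<in> \<Omega> \<longleftrightarrow> \<gamma> (x - (x \<bullet> e) *\<^sub>R e) < x \<bullet> e" if "x \<in> ball p r" for x using eq that by blast
    have "\<not> \<gamma> (p - (p \<bullet> e) *\<^sub>R e) < p \<bullet> e" using n r eqI[of p] by simp
    then have ge: "p \<bullet> e \<le> \<gamma> (p - (p \<bullet> e) *\<^sub>R e)" by simp
    obtain \<delta> where d: "\<delta> > 0" "ball p \<delta> \<subseteq> closure \<Omega>" using p unfolding mem_interior by blast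
    define \<epsilon> where "\<epsilon> = min \<delta> r / 2"
    have eps: "\<epsilon> > 0" "\<epsilon> < \<delta>" "\<epsilon> < r" using d(1) r by (auto simp: \<epsilon>_def)
    define y where "y = p - \<epsilon> *\<^sub>R e"
    have dy: "dist p y = \<epsilon>" using e eps by (simp add: y_def dist_norm)
    have ye: "y \<bullet> e = p \<bullet> e - \<epsilon>" using ee by (simp add: y_def inner_diff_left)
    have yp: "y - (y \<bullet> e) *\<^sub>R e = p - (p \<bullet> e) *\<^sub>R e" unfolding ye by (simp add: y_def scaleR_diff_left)
    have cont: "continuous_on UNIV (\<lambda>x. \<gamma> (x - (x \<bullet> e) *\<^sub>R e))"
      by (rule continuous_on_compose2[OF lipschitz_on_continuous_on[OF L]])
         (auto intro!: continuous_intros simp: inner_diff_left ee)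
    define A where "A = {x. x \<bullet> e < \<gamma> (x - (x \<bullet> e) *\<^sub>R e)} \<inter> ball p r"
    have "open A" unfolding A_def using cont by (intro open_Int open_Collect_less continuous_intros) auto
    moreover have "A \<inter> \<Omega> = {}" using eqI unfolding A_def by (auto dest: less_asym)
    ultimately have "A \<inter> closure \<Omega> = {}" using open_Int_closure_eq_empty by blast
    moreover have "y \<in> A" using ge eps yp ye dy by (simp add: A_def)
    moreover have "y \<in> closure \<Omega>" using d(2) dy eps by auto
    ultimately show False by blast
  qed
qed

lemma open_domain: "open \<Omega>" using lip unfolding bounded_lipschitz_domain_def by blast

lemma union_mesh: "\<Union>\<T> = closure \<Omega>" using conf unfolding conforming_triangulation_def by blast

lemma elem_interior_subset: "T \<in> \<T> \<Longrightarrow> interior T \<subseteq> \<Omega>"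
  using interior_mono[of T "closure \<Omega>"] union_mesh interior_closure_domain by blast

lemma face_Int: "T \<in> \<T> \<Longrightarrow> T' \<in> \<T> \<Longrightarrow> (T \<inter> T') face_of T"
  using conf unfolding conforming_triangulation_def triangulation_def by blast

text \<open>The intersection of two elements is a face of both, and a proper face does not meet the interior.\<close>

lemma elem_unique:
  assumes T: "T \<in> \<T>" "T' \<in> \<T>" and x: "x \<in> interior T" "x \<in> T'"
  shows "T = T'"
proof -
  have "x \<in> T" using x(1) interior_subset by blast
  then have "T \<inter> T' = T" using face_of_disjoint_interior[OF face_Int[OF T]] x by blast
  then have sub: "T \<subseteq> T'" and f: "T face_of T'" using face_Int[OF T(2,1)] by (auto simp: Int_commute)
  have "x \<in> interior T'" using interior_mono[OF sub] x by blast
  then show ?thesis using face_of_disjoint_interior[OF f] \<open>x \<in> T\<close> by blast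
qed

text \<open>The barycentric coordinates of \<open>p\<close> in \<open>T\<close> and of \<open>p'\<close> in \<open>T'\<close> vanish on the common facet, so
  they are proportional.  The sign of the factor tells on which side of the facet \<open>p'\<close> lies; on the
  side of \<open>p\<close>, the segment from the centroid of the facet to \<open>p'\<close> starts inside both elements.\<close>

lemma facet_pair:
  assumes T: "T \<in> \<T>" "T' \<in> \<T>" and p: "p \<in> verts T" "p' \<in> verts T'" and eq: "verts T - {p} = verts T' - {p'}"
  shows "bary (verts T) p x = bary (verts T) p p' * bary (verts T') p' x"
    and "bary (verts T) p p' \<noteq> 0"
    and "0 < bary (verts T) p p' \<Longrightarrow> T = T'"
proof -
  interpret A: full_simplex "verts T" using elem_simplex[OF T(1)] by blast
  interpret B: full_simplex "verts T'" using elem_simplex[OF T(2)] by blast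
  have 1: "A.lam p x = A.lam p p' * B.lam p' x" for x
  proof -
    have lin: "linear (\<lambda>x. bary_grad (verts T) p \<bullet> x)" by (rule linearI) (simp_all add: inner_add_right)
    have "A.lam p x = (\<Sum>q\<in>verts T'. B.lam q x *\<^sub>R A.lam p q)"
      by (rule B.affine_bary_expansion[OF lin, of _ "1 - bary_grad (verts T) p \<bullet> p"]) (simp add: bary_def inner_diff_right)
    also have "\<dots> = B.lam p' x * A.lam p p' + (\<Sum>q\<in>verts T' - {p'}. B.lam q x * A.lam p q)"
      using B.finite_V p(2) by (simp add: sum.remove)
    also have "(\<Sum>q\<in>verts T' - {p'}. B.lam q x * A.lam p q) = 0"
      unfolding eq[symmetric] using p by (intro sum.neutral) (auto simp: A.bary_vertex)
    finally show ?thesis by (simp add: mult.commute)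
  qed
  show "A.lam p x = A.lam p p' * B.lam p' x" by (rule 1)
  show "A.lam p p' \<noteq> 0" using 1[of p] A.bary_vertex[OF p(1) p(1)] by auto
  assume pos: "0 < A.lam p p'"
  define b where "b = centroid (verts T - {p})"
  have "\<forall>\<^sub>F \<epsilon> in at_right 0. \<forall>q\<in>verts T. 0 < A.lam q (b + \<epsilon> *\<^sub>R (p' - b))"
  proof (rule eventually_ball_finite[OF A.finite_V], intro ballI)
    fix q assume q: "q \<in> verts T"
    show "\<forall>\<^sub>F \<epsilon> in at_right 0. 0 < A.lam q (b + \<epsilon> *\<^sub>R (p' - b))"
    proof (cases "q = p")
      case True
      have e: "A.lam q (b + \<epsilon> *\<^sub>R (p' - b)) = \<epsilon> * A.lam p p'" for \<epsilon>
        unfolding bary_affine bary_diff[symmetric] using True q by (simp add: b_def A.bary_facet_centroid p)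
      show ?thesis unfolding e by (rule eventually_mono[OF eventually_at_right_less]) (use pos in simp)
    next
      case False
      have "((\<lambda>\<epsilon>. A.lam q b + \<epsilon> * (bary_grad (verts T) q \<bullet> (p' - b))) \<longlongrightarrow> A.lam q b + 0 * (bary_grad (verts T) q \<bullet> (p' - b))) (at_right 0)"
        by (intro tendsto_intros)
      moreover have "0 < A.lam q b + 0 * (bary_grad (verts T) q \<bullet> (p' - b))"
        using False q p by (simp add: b_def A.bary_facet_centroid)
      ultimately show ?thesis unfolding bary_affine by (rule order_tendstoD(1))
    qed
  qed
  moreover have "\<forall>\<^sub>F \<epsilon> in at_right (0::real). \<epsilon> \<in> {0<..<1}" by (rule eventually_at_right_real) simp
  ultimately have "\<forall>\<^sub>F \<epsilon> in at_right 0. (\<forall>q\<in>verts T. 0 < A.lam q (b + \<epsilon> *\<^sub>R (p' - b))) \<and> \<epsilon> \<in> {0<..<1}"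
    by (rule eventually_conj)
  then obtain \<epsilon> where ep: "\<forall>q\<in>verts T. 0 < A.lam q (b + \<epsilon> *\<^sub>R (p' - b))" "0 < \<epsilon>" "\<epsilon> < 1"
    using eventually_happens[of _ "at_right (0::real)"] trivial_limit_at_right_real by fastforce
  have "b + \<epsilon> *\<^sub>R (p' - b) \<in> interior T" using A.in_interior_iff ep(1) elem_simplex(2)[OF T(1)] by simp
  moreover have "b + \<epsilon> *\<^sub>R (p' - b) \<in> T'"
  proof -
    have bT: "b \<in> T'" unfolding b_def eq using B.facet_centroid_mem[OF p(2)] B.facet_subset[of p'] elem_simplex(2)[OF T(2)] by auto
    have pT: "p' \<in> T'" using hull_inc[OF p(2), of convex] elem_simplex(2)[OF T(2)] by simp
    have "(1 - \<epsilon>) *\<^sub>R b + \<epsilon> *\<^sub>R p' \<in> T'" using elem_simps(3)[OF T(2)] bT pT ep by (simp add: convex_def)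
    then show ?thesis by (simp add: algebra_simps)
  qed
  ultimately show "T = T'" by (rule elem_unique[OF T])
qed

definition elems :: "(real^'d) set \<Rightarrow> (real^'d) set set" where
  "elems S = {T \<in> \<T>. S facet_of T}"

text \<open>Two elements at a common side lie on opposite sides of it and together cover a neighbourhood of
  each point in the relative interior of the side.\<close>

lemma facet_of_two_interior:
  assumes T: "T \<in> \<T>" "T' \<in> \<T>" "T \<noteq> T'" and S: "S facet_of T" "S facet_of T'"
  shows "rel_interior S \<subseteq> \<Omega>"
proof
  fix x assume x: "x \<in> rel_interior S"
  obtain p where p: "p \<in> verts T" "S = convex hull (verts T - {p})" "verts S = verts T - {p}" using facetE[OF T(1) S(1)] .
  obtain p' where p': "p' \<in> verts T'" "S = convex hull (verts T' - {p'})" "verts S = verts T' - {p'}" using facetE[OF T(2) S(2)] .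
  interpret A: full_simplex "verts T" using elem_simplex[OF T(1)] by blast
  interpret B: full_simplex "verts T'" using elem_simplex[OF T(2)] by blast
  have eq: "verts T - {p} = verts T' - {p'}" using p p' by simp
  note P = facet_pair[OF T(1,2) p(1) p'(1) eq]
  have neg: "A.lam p p' < 0" using P(2,3) T(3) by (meson linorder_neqE_linordered_idom)
  define U where "U = {y. \<forall>q\<in>verts T - {p}. 0 < A.lam q y} \<inter> {y. \<forall>q\<in>verts T' - {p'}. 0 < B.lam q y}"
  have "open U" unfolding U_def Collect_ball_eq using A.finite_V B.finite_V
    by (intro open_Int open_INT ballI open_Collect_less continuous_intros) auto
  moreover have "x \<in> U" unfolding U_def using A.rel_interior_facet(2)[OF p(1)] B.rel_interior_facet(2)[OF p'(1)] x p(2) p'(2) by auto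
  moreover have "U \<subseteq> closure \<Omega>"
  proof
    fix y assume y: "y \<in> U"
    have "y \<in> T \<or> y \<in> T'"
    proof (cases "0 \<le> A.lam p y")
      case True
      then have "0 \<le> A.lam q y" if "q \<in> verts T" for q
        using y that unfolding U_def by (cases "q = p") (auto intro: less_imp_le)
      then show ?thesis using A.in_simplex_iff elem_simplex(2)[OF T(1)] by simp
    next
      case False
      then have "0 \<le> B.lam p' y" using P(1)[of y] neg by (smt (verit) mult_nonpos_nonpos)
      then have "0 \<le> B.lam q y" if "q \<in> verts T'" for q
        using y that unfolding U_def by (cases "q = p'") (auto intro: less_imp_le)
      then show ?thesis using B.in_simplex_iff elem_simplex(2)[OF T(2)] by simp
    qed
    then show "y \<in> closure \<Omega>" using union_mesh T by blast
  qed
  ultimately have "x \<in> interior (closure \<Omega>)" by (rule interiorI)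
  then show "x \<in> \<Omega>" using interior_closure_domain by blast
qed

text \<open>If \<open>x\<close> were in the domain, the elements would also cover points near \<open>x\<close> beyond the side, so \<open>x\<close>
  would lie in a second element \<open>T'\<close>.  The face \<open>T \<inter> T'\<close> contains a relatively interior point of
  \<open>S\<close>, hence all of \<open>S\<close>, and for dimension reasons it is \<open>S\<close>.\<close>

lemma facet_of_one_frontier:
  assumes T: "T \<in> \<T>" and S: "S facet_of T" and one: "\<And>T'. T' \<in> \<T> \<Longrightarrow> S facet_of T' \<Longrightarrow> T' = T"
  shows "rel_interior S \<subseteq> frontier \<Omega>"
proof
  fix x assume x: "x \<in> rel_interior S"
  obtain p where p: "p \<in> verts T" "S = convex hull (verts T - {p})" using facetE[OF T S] by metis
  interpret A: full_simplex "verts T" using elem_simplex[OF T] by blast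
  have xS: "x \<in> S" using x rel_interior_subset by blast
  have fST: "S face_of T" using S by (simp add: facet_of_def)
  have xT: "x \<in> T" using xS fST face_of_imp_subset by blast
  have "x \<notin> \<Omega>"
  proof
    assume xO: "x \<in> \<Omega>"
    define K where "K = \<Union>(\<T> - {T})"
    have "closed K" unfolding K_def using finite_mesh elem_simps(2) by (intro closed_Union) auto
    have "x \<in> K"
    proof (rule ccontr)
      assume "x \<notin> K"
      then have "open (\<Omega> - K)" "x \<in> \<Omega> - K" using open_domain \<open>closed K\<close> xO by auto
      then obtain e where e: "e > 0" "ball x e \<subseteq> \<Omega> - K" by (meson open_contains_ball)
      let ?G = "bary_grad (verts T) p"
      have G0: "norm ?G > 0" using A.bary_grad_nonzero[OF p(1)] by simp
      \<comment> \<open>a step across the side that stays in the ball\<close>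
      define t where "t = e / (2 * norm ?G)"
      have t: "t > 0" "t * norm ?G < e" using e G0 by (auto simp: t_def)
      have "x + (- t) *\<^sub>R ?G \<in> ball x e" using t by (simp add: dist_norm)
      then have "x + (- t) *\<^sub>R ?G \<in> T" using e(2) closure_subset[of \<Omega>] union_mesh unfolding K_def by blast
      then have "0 \<le> A.lam p (x + (- t) *\<^sub>R ?G)" using A.in_simplex_iff p(1) elem_simplex(2)[OF T] by simp
      moreover have "A.lam p x = 0" using xS p A.in_facet_iff[OF p(1)] by simp
      moreover have "?G \<bullet> ?G > 0" using G0 by simp
      ultimately show False using t(1) unfolding bary_affine by (simp add: mult_le_0_iff zero_le_mult_iff)
    qed
    then obtain T' where T': "T' \<in> \<T>" "T' \<noteq> T" "x \<in> T'" unfolding K_def by blast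
    have f: "(T \<inter> T') face_of T" by (rule face_Int[OF T T'(1)])
    have sub: "S \<subseteq> T \<inter> T'"
      using subset_of_face_of[OF f, of S] face_of_imp_subset[OF fST] x xT T' by blast
    have ne: "T \<inter> T' \<noteq> T"
    proof
      assume "T \<inter> T' = T"
      then have "bc T \<in> T'" using elem_simps(4)[OF T] interior_subset by blast
      then show False using elem_unique[OF T T'(1) elem_simps(4)[OF T]] T'(2) by blast
    qed
    have d1: "aff_dim (T \<inter> T') < aff_dim T" by (rule face_of_aff_dim_lt[OF elem_simps(3)[OF T] f ne])
    have d2: "aff_dim S = aff_dim T - 1" "S \<noteq> {}" using S by (auto simp: facet_of_def)
    have fS: "S face_of (T \<inter> T')" using fST sub by (rule face_of_subset) auto
    have "S = T \<inter> T'"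
    proof (rule ccontr)
      assume "S \<noteq> T \<inter> T'"
      then have "aff_dim S < aff_dim (T \<inter> T')"
        using face_of_aff_dim_lt[OF _ fS] elem_simps(3)[OF T] elem_simps(3)[OF T'(1)] convex_Int by blast
      then show False using d1 d2 by simp
    qed
    then have "S face_of T'" using face_Int[OF T'(1) T] by (simp add: Int_commute)
    then have "S facet_of T'" using d2 elem_simps(6)[OF T] elem_simps(6)[OF T'(1)] by (simp add: facet_of_def)
    then show False using one T' by blast
  qed
  moreover have "x \<in> closure \<Omega>" using xT T union_mesh by blast
  ultimately show "x \<in> frontier \<Omega>" using open_domain by (simp add: frontier_def interior_open)
qed

lemma side_rel_interior_nonempty: "S \<in> sides \<T> \<Longrightarrow> rel_interior S \<noteq> {}"
proof -
  assume "S \<in> sides \<T>"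
  then obtain T where T: "T \<in> \<T>" "S facet_of T" unfolding sides_def by blast
  then have "convex S" "S \<noteq> {}" using facetE[OF T] facet_of_def by (metis convex_convex_hull, blast)
  then show ?thesis using rel_interior_eq_empty by blast
qed

text \<open>Two of three elements at a side would lie on the same side of it.\<close>

lemma at_most_two:
  assumes T: "T \<in> elems S" "T' \<in> elems S" "T'' \<in> elems S" "T \<noteq> T'" "T \<noteq> T''"
  shows "T' = T''"
proof -
  have m: "T \<in> \<T>" "T' \<in> \<T>" "T'' \<in> \<T>" and f: "S facet_of T" "S facet_of T'" "S facet_of T''"
    using T by (auto simp: elems_def)
  obtain p where p: "p \<in> verts T" "verts S = verts T - {p}" using facetE[OF m(1) f(1)] by metis
  obtain p' where p': "p' \<in> verts T'" "verts S = verts T' - {p'}" using facetE[OF m(2) f(2)] by metis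
  obtain p'' where p'': "p'' \<in> verts T''" "verts S = verts T'' - {p''}" using facetE[OF m(3) f(3)] by metis
  have eq: "verts T - {p} = verts T' - {p'}" "verts T - {p} = verts T'' - {p''}" "verts T' - {p'} = verts T'' - {p''}"
    using p p' p'' by simp_all
  note P = facet_pair[OF m(1,2) p(1) p'(1) eq(1)]
  note Q = facet_pair[OF m(1,3) p(1) p''(1) eq(2)]
  have "bary (verts T) p p' < 0" "bary (verts T) p p'' < 0"
    using P(2,3) Q(2,3) T(4,5) by (meson linorder_neqE_linordered_idom)+
  then have "0 < bary (verts T') p' p''" using P(1)[of p''] by (metis mult_less_cancel_left_neg mult_zero_right)
  then show ?thesis by (rule facet_pair(3)[OF m(2,3) p'(1) p''(1) eq(3)])
qed

lemma elems_cases: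
  assumes "S \<in> sides \<T>"
  obtains (interior) T T' where "S \<in> sides_in \<T> \<Omega>" "S \<notin> sides_in \<T> (frontier \<Omega>)" "T \<noteq> T'" "elems S = {T, T'}"
  | (boundary) "S \<in> sides_in \<T> (frontier \<Omega>)" "S \<notin> sides_in \<T> \<Omega>" "elems S = {boundary_elem \<T> S}"
proof -
  obtain T where T: "T \<in> \<T>" "S facet_of T" using assms unfolding sides_def by blast
  have ne: "rel_interior S \<noteq> {}" by (rule side_rel_interior_nonempty[OF assms])
  have disj: "\<Omega> \<inter> frontier \<Omega> = {}" using open_domain by (auto simp: frontier_def interior_open)
  show thesis
  proof (cases "\<exists>T'\<in>\<T>. T' \<noteq> T \<and> S facet_of T'")
    case True
    then obtain T' where T': "T' \<in> \<T>" "T' \<noteq> T" "S facet_of T'" by blast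
    have "rel_interior S \<subseteq> \<Omega>" using facet_of_two_interior[OF T(1) T'(1)] T T' by blast
    moreover have "elems S = {T, T'}"
    proof -
      have m: "T \<in> elems S" "T' \<in> elems S" using T T' by (simp_all add: elems_def)
      have "T'' = T \<or> T'' = T'" if "T'' \<in> elems S" for T''
        using at_most_two[OF m(1,2) that] T'(2) by blast
      then show ?thesis using m by blast
    qed
    moreover have "S \<in> sides_in \<T> \<Omega>" "S \<notin> sides_in \<T> (frontier \<Omega>)"
      using calculation(1) assms ne disj unfolding sides_in_def by blast+
    ultimately show thesis using interior[of T T'] T'(2) by simp
  next
    case False
    then have one: "\<And>T'. T' \<in> \<T> \<Longrightarrow> S facet_of T' \<Longrightarrow> T' = T" by blast
    have "rel_interior S \<subseteq> frontier \<Omega>" by (rule facet_of_one_frontier[OF T one])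
    moreover have "boundary_elem \<T> S = T" unfolding boundary_elem_def
      by (rule the_equality) (use T in blast, elim conjE, erule one)
    moreover have "elems S = {T}"
    proof (intro equalityI subsetI)
      fix T' assume "T' \<in> elems S"
      then show "T' \<in> {T}" using one[of T'] by (simp add: elems_def)
    qed (use T in \<open>simp add: elems_def\<close>)
    moreover have "S \<in> sides_in \<T> (frontier \<Omega>)" "S \<notin> sides_in \<T> \<Omega>"
      using calculation(1) assms ne disj unfolding sides_in_def by blast+
    ultimately show thesis using boundary by simp
  qed
qed

lemma finite_facets: "T \<in> \<T> \<Longrightarrow> finite {S. S facet_of T}"
proof -
  assume T: "T \<in> \<T>"
  interpret full_simplex "verts T" using elem_simplex[OF T] by blast
  have "{S. S facet_of T} = F ` verts T" using facet_of_iff elem_simplex(2)[OF T] by auto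
  then show ?thesis using finite_V by simp
qed

lemma finite_sides: "finite (sides \<T>)"
proof -
  have "sides \<T> = (\<Union>T\<in>\<T>. {S. S facet_of T})" unfolding sides_def by blast
  then show ?thesis using finite_mesh finite_facets by simp
qed

lemma sum_elements_sides:
  fixes h :: "(real^'d) set \<Rightarrow> (real^'d) set \<Rightarrow> real"
  shows "(\<Sum>T\<in>\<T>. \<Sum>S | S facet_of T. h T S) = (\<Sum>S\<in>sides \<T>. \<Sum>T\<in>elems S. h T S)"
proof -
  have "(\<Sum>T\<in>\<T>. \<Sum>S | S facet_of T. h T S) = (\<Sum>T\<in>\<T>. \<Sum>S | S \<in> sides \<T> \<and> S facet_of T. h T S)"
    by (intro sum.cong refl) (auto simp: sides_def)
  also have "\<dots> = (\<Sum>S\<in>sides \<T>. \<Sum>T | T \<in> \<T> \<and> S facet_of T. h T S)"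
    by (rule sum.swap_restrict[OF finite_mesh finite_sides])
  finally show ?thesis by (simp add: elems_def)
qed

text \<open>Glues functions on the elements; outside of the open elements the piece is unspecified.\<close>

definition piecewise :: "((real^'d) set \<Rightarrow> real^'d \<Rightarrow> 'b) \<Rightarrow> real^'d \<Rightarrow> 'b" where
  "piecewise f x = f (THE T. T \<in> \<T> \<and> x \<in> interior T) x"

lemma the_elem:
  assumes "T \<in> \<T>" "x \<in> interior T" shows "(THE T. T \<in> \<T> \<and> x \<in> interior T) = T"
proof (rule the_equality)
  show "T \<in> \<T> \<and> x \<in> interior T" using assms by blast
  fix T' assume "T' \<in> \<T> \<and> x \<in> interior T'"
  then show "T' = T" using elem_unique[OF assms(1), of T'] assms(2) interior_subset by blast
qed

lemma piecewise_eq: "T \<in> \<T> \<Longrightarrow> x \<in> interior T \<Longrightarrow> piecewise f x = f T x"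
  unfolding piecewise_def by (simp add: the_elem)

end

section \<open>Crouzeix-Raviart and Raviart-Thomas functions\<close>

definition elem_affine :: "(real^'d) set \<Rightarrow> (real^'d \<Rightarrow> real^'l) \<Rightarrow> bool" where
  "elem_affine T v \<longleftrightarrow> (\<exists>c W. \<forall>x\<in>interior T. v x = c + W *v x)"

definition elem_rt :: "(real^'d) set \<Rightarrow> (real^'d \<Rightarrow> real^'d^'l) \<Rightarrow> bool" where
  "elem_rt T y \<longleftrightarrow> (\<exists>a c. \<forall>x\<in>interior T. y x = a + c \<otimes>\<^sub>t x)"

text \<open>The value at the centroid of \<open>S\<close> of the affine function that agrees with \<open>v\<close> on \<open>T\<close>.\<close>

definition facet_val :: "(real^'d \<Rightarrow> real^'l) \<Rightarrow> (real^'d) set \<Rightarrow> (real^'d) set \<Rightarrow> real^'l" where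
  "facet_val v T S = v (bc T) + grad_h v (bc T) *v (bc S - bc T)"

text \<open>The flux through \<open>S\<close> out of \<open>T\<close> of the Raviart-Thomas field that agrees with \<open>y\<close> on \<open>T\<close>, whose
  slope is the divergence divided by the dimension.\<close>

definition facet_flux :: "(real^'d \<Rightarrow> real^'d^'l) \<Rightarrow> (real^'d) set \<Rightarrow> (real^'d) set \<Rightarrow> real^'l" where
  "facet_flux y T S = measure (side_measure S) S *\<^sub>R
     ((y (bc T) + ((1 / real CARD('d)) *\<^sub>R div_h y (bc T)) \<otimes>\<^sub>t (bc S - bc T)) *v outer_normal T S)"

lemma isCont_affine: "linear L \<Longrightarrow> isCont (\<lambda>x::'a::euclidean_space. (c::'b::euclidean_space) + L x) x"
  by (intro continuous_intros linear_continuous_at) (simp add: linear_conv_bounded_linear)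

context fe_mesh
begin

abbreviation across_interior_sides :: "((real^'d) set \<Rightarrow> (real^'d) set \<Rightarrow> (real^'d) set \<Rightarrow> bool) \<Rightarrow> bool" where
  "across_interior_sides P \<equiv>
     \<forall>S\<in>sides_in \<T> \<Omega>. \<forall>T\<in>\<T>. \<forall>T'\<in>\<T>. T \<noteq> T' \<and> S facet_of T \<and> S facet_of T' \<longrightarrow> P S T T'"

lemma side_mean_affine_mesh:
  fixes f :: "real^'d \<Rightarrow> 'b::euclidean_space"
  assumes T: "T \<in> \<T>" "S facet_of T" and L: "linear L" "\<And>x. x \<in> S \<Longrightarrow> f x = c + L x"
  shows "side_mean S f = c + L (bc S)"
proof -
  obtain p where p: "p \<in> verts T" "S = convex hull (verts T - {p})" "verts S = verts T - {p}" using facetE[OF T] .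
  interpret full_simplex "verts T" using elem_simplex[OF T(1)] by blast
  show ?thesis unfolding p(3) unfolding p(2) by (rule side_mean_affine[OF p(1) L(1)]) (use L(2) p(2) in blast)
qed

lemma side_integral_const_mesh:
  fixes f :: "real^'d \<Rightarrow> 'b::{banach, second_countable_topology}"
  assumes T: "T \<in> \<T>" "S facet_of T" and f: "\<And>x. x \<in> rel_interior S \<Longrightarrow> f x = a"
  shows "(\<integral>x. indicator S x *\<^sub>R f x \<partial>side_measure S) = measure (side_measure S) S *\<^sub>R a"
proof -
  obtain p where p: "p \<in> verts T" "S = convex hull (verts T - {p})" using facetE[OF T] by metis
  interpret full_simplex "verts T" using elem_simplex[OF T(1)] by blast
  show ?thesis unfolding p(2) by (rule side_integral_const[OF p(1)]) (use f p(2) in blast)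
qed

lemma side_pos: "T \<in> \<T> \<Longrightarrow> S facet_of T \<Longrightarrow> 0 < measure (side_measure S) S"
proof -
  assume T: "T \<in> \<T>" "S facet_of T"
  obtain p where p: "p \<in> verts T" "S = convex hull (verts T - {p})" using facetE[OF T] by metis
  interpret full_simplex "verts T" using elem_simplex[OF T(1)] by blast
  show ?thesis unfolding p(2) by (rule measure_side_pos[OF p(1)])
qed

lemma facet_subset_elem: "S facet_of T \<Longrightarrow> S \<subseteq> T"
  using facet_of_imp_face_of face_of_imp_subset by blast

lemma Pi_h_affine:
  fixes v :: "real^'d \<Rightarrow> 'b::euclidean_space"
  assumes T: "T \<in> \<T>" "x \<in> interior T" and L: "linear L" "\<And>z. z \<in> interior T \<Longrightarrow> v z = c + L z"
  shows "Pi_h \<T> v x = v (bc T)"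
proof -
  interpret full_simplex "verts T" using elem_simplex[OF T(1)] by blast
  have "(1 / measure lebesgue T) *\<^sub>R integral\<^sup>L (lebesgue_on T) v = c + L (bc T)"
    using mean_value_affine[of L v c] L elem_simplex(2)[OF T(1)] by simp
  then show ?thesis unfolding Pi_h_def the_elem[OF T] Let_def using L(2)[OF elem_simps(4)[OF T(1)]] by simp
qed

lemma elem_trace_affine:
  fixes v :: "real^'d \<Rightarrow> 'b::euclidean_space"
  assumes T: "T \<in> \<T>" "x \<in> T" and L: "linear L" "\<And>z. z \<in> interior T \<Longrightarrow> v z = c + L z"
  shows "elem_trace T v x = c + L x"
  by (rule elem_trace_eq[where f = "\<lambda>x. c + L x", OF elem_simps(3,2,5)[OF T(1)] T(2) L(2) isCont_affine[OF L(1)]])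

lemma elem_affine_facts:
  assumes T: "T \<in> \<T>" and v: "elem_affine T v"
  shows "x \<in> interior T \<Longrightarrow> v x = v (bc T) + grad_h v (bc T) *v (x - bc T)"
    and "x \<in> T \<Longrightarrow> elem_trace T v x = v (bc T) + grad_h v (bc T) *v (x - bc T)"
    and "x \<in> interior T \<Longrightarrow> grad_h v x = grad_h v (bc T)"
    and "x \<in> interior T \<Longrightarrow> Pi_h \<T> v x = v (bc T)"
    and "S facet_of T \<Longrightarrow> side_mean S (elem_trace T v) = facet_val v T S"
proof -
  obtain c W where v: "\<And>x. x \<in> interior T \<Longrightarrow> v x = c + W *v x" using v unfolding elem_affine_def by blast
  note b = elem_simps(4)[OF T]
  have g: "grad_h v x = W" if "x \<in> interior T" for x using grad_h_affine[OF that v] by blast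
  have vb: "c + W *v x = v (bc T) + grad_h v (bc T) *v (x - bc T)" for x
    unfolding g[OF b] v[OF b] by (simp add: matrix_vector_mult_diff_distrib)
  show "x \<in> interior T \<Longrightarrow> v x = v (bc T) + grad_h v (bc T) *v (x - bc T)" using v vb by simp
  show tr: "x \<in> T \<Longrightarrow> elem_trace T v x = v (bc T) + grad_h v (bc T) *v (x - bc T)" for x
    using elem_trace_affine[OF T _ matrix_vector_mul_linear v] vb by simp
  show "x \<in> interior T \<Longrightarrow> grad_h v x = grad_h v (bc T)" using g b by simp
  show "x \<in> interior T \<Longrightarrow> Pi_h \<T> v x = v (bc T)" using Pi_h_affine[OF T _ matrix_vector_mul_linear v] by blast
  show "S facet_of T \<Longrightarrow> side_mean S (elem_trace T v) = facet_val v T S"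
    unfolding facet_val_def vb[symmetric]
  proof (rule side_mean_affine_mesh[OF T _ matrix_vector_mul_linear])
    fix x assume "S facet_of T" "x \<in> S"
    then have "x \<in> T" using facet_subset_elem by blast
    then show "elem_trace T v x = c + W *v x" using tr vb by simp
  qed
qed

lemma elem_rt_facts:
  fixes y :: "real^'d \<Rightarrow> real^'d^'l"
  assumes T: "T \<in> \<T>" and y: "elem_rt T y"
  shows "x \<in> interior T \<Longrightarrow> y x = y (bc T) + ((1 / real CARD('d)) *\<^sub>R div_h y (bc T)) \<otimes>\<^sub>t (x - bc T)"
    and "x \<in> T \<Longrightarrow> elem_trace T y x = y (bc T) + ((1 / real CARD('d)) *\<^sub>R div_h y (bc T)) \<otimes>\<^sub>t (x - bc T)"
    and "x \<in> interior T \<Longrightarrow> div_h y x = div_h y (bc T)"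
    and "x \<in> interior T \<Longrightarrow> Pi_h \<T> y x = y (bc T)"
    and "S facet_of T \<Longrightarrow> x \<in> S \<Longrightarrow> measure (side_measure S) S *\<^sub>R (elem_trace T y x *v outer_normal T S) = facet_flux y T S"
proof -
  obtain a c where y: "\<And>x. x \<in> interior T \<Longrightarrow> y x = a + c \<otimes>\<^sub>t x" using y unfolding elem_rt_def by blast
  note b = elem_simps(4)[OF T]
  have d: "div_h y x = real CARD('d) *\<^sub>R c" if "x \<in> interior T" for x using div_h_affine[OF that y] by blast
  have yb: "a + c \<otimes>\<^sub>t x = y (bc T) + ((1 / real CARD('d)) *\<^sub>R div_h y (bc T)) \<otimes>\<^sub>t (x - bc T)" for x
    unfolding d[OF b] y[OF b] by (simp add: tensor_simps)
  show "x \<in> interior T \<Longrightarrow> y x = y (bc T) + ((1 / real CARD('d)) *\<^sub>R div_h y (bc T)) \<otimes>\<^sub>t (x - bc T)" using y yb by simp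
  show tr: "x \<in> T \<Longrightarrow> elem_trace T y x = y (bc T) + ((1 / real CARD('d)) *\<^sub>R div_h y (bc T)) \<otimes>\<^sub>t (x - bc T)" for x
    using elem_trace_affine[OF T _ linear_tensor y] yb by simp
  show "x \<in> interior T \<Longrightarrow> div_h y x = div_h y (bc T)" using d b by simp
  show "x \<in> interior T \<Longrightarrow> Pi_h \<T> y x = y (bc T)" using Pi_h_affine[OF T _ linear_tensor y] by blast
  assume S: "S facet_of T" and x: "x \<in> S"
  obtain p where p: "p \<in> verts T" "S = convex hull (verts T - {p})" "verts S = verts T - {p}" using facetE[OF T S] .
  interpret full_simplex "verts T" using elem_simplex[OF T] by blast
  have n: "outer_normal T S = - (1 / norm (G p)) *\<^sub>R G p"
    using outer_normal_facet[OF p(1)] elem_simplex(2)[OF T] p(2) by simp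
  have "G p \<bullet> (x - bc S) = 0"
    using grad_facet[OF p(1)] x facet_centroid_mem[OF p(1)] unfolding p(3) unfolding p(2) by blast
  then have "(x - bc T) \<bullet> G p = (bc S - bc T) \<bullet> G p" by (simp add: inner_diff_left inner_diff_right inner_commute)
  then show "measure (side_measure S) S *\<^sub>R (elem_trace T y x *v outer_normal T S) = facet_flux y T S"
    unfolding facet_flux_def tr[OF subsetD[OF facet_subset_elem[OF S] x]] n matrix_vector_mult_scaleR
    by (simp add: matrix_vector_mult_add_rdistrib tensor_mult_vec)
qed

text \<open>The side mean of an affine function is its value at the centroid of the side, so the condition
  on the jumps is an equation between two vectors for each interior side.\<close>

lemma U_cr_iff:
  fixes v :: "real^'d \<Rightarrow> real^'l"
  shows "v \<in> U_cr \<T> \<Omega> \<longleftrightarrow> (\<forall>T\<in>\<T>. elem_affine T v) \<and>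
    across_interior_sides (\<lambda>S T T'. facet_val v T S = facet_val v T' S)"
proof -
  have aff: "(\<forall>i. (\<lambda>x. v x $ i) \<in> broken_poly 1 \<T>) \<longleftrightarrow> (\<forall>T\<in>\<T>. elem_affine T v)"
  proof (intro iffI ballI allI)
    fix T assume H: "\<forall>i. (\<lambda>x. v x $ i) \<in> broken_poly 1 \<T>" and T: "T \<in> \<T>"
    have "\<forall>i. \<exists>b a. \<forall>x\<in>interior T. v x $ i = b + a \<bullet> x"
    proof
      fix i
      obtain p where p: "polynomial_deg 1 p" "\<forall>x\<in>interior T. v x $ i = p x"
        using H T unfolding broken_poly_def by blast
      show "\<exists>b a. \<forall>x\<in>interior T. v x $ i = b + a \<bullet> x" using p unfolding polynomial_deg_1_iff by metis
    qed
    then obtain b a where "\<And>i x. x \<in> interior T \<Longrightarrow> v x $ i = b i + a i \<bullet> x" by metis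
    then show "elem_affine T v" unfolding elem_affine_def
      by (intro exI[of _ "\<chi> i. b i"] exI[of _ "\<chi> i. a i"]) (simp add: vec_eq_iff matrix_vector_mul_component)
  next
    fix i assume H: "\<forall>T\<in>\<T>. elem_affine T v"
    show "(\<lambda>x. v x $ i) \<in> broken_poly 1 \<T>"
      unfolding broken_poly_def
    proof (intro CollectI ballI)
      fix T assume "T \<in> \<T>"
      then obtain c W where cW: "\<forall>x\<in>interior T. v x = c + W *v x" using H unfolding elem_affine_def by blast
      have "polynomial_deg 1 (\<lambda>x. c $ i + W $ i \<bullet> x)" unfolding polynomial_deg_1_iff by blast
      moreover have "\<forall>x\<in>interior T. v x $ i = c $ i + W $ i \<bullet> x" using cW by (simp add: matrix_vector_mul_component)
      ultimately show "\<exists>p. polynomial_deg 1 p \<and> (\<forall>x\<in>interior T. v x $ i = p x)" by blast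
    qed
  qed
  have jump: "side_mean S (\<lambda>x. elem_trace T (\<lambda>x. v x $ i) x - elem_trace T' (\<lambda>x. v x $ i) x) = facet_val v T S $ i - facet_val v T' S $ i"
    if E: "\<forall>T\<in>\<T>. elem_affine T v" and T: "T \<in> \<T>" "T' \<in> \<T>" "S facet_of T" "S facet_of T'" for S T T' i
  proof -
    have tr: "elem_trace T (\<lambda>x. v x $ i) x = (v (bc T) - grad_h v (bc T) *v bc T) $ i + grad_h v (bc T) $ i \<bullet> x"
      if "T \<in> \<T>" "x \<in> T" for T x
    proof (rule elem_trace_affine[OF that])
      show "linear (\<lambda>x. grad_h v (bc T) $ i \<bullet> x)" by (rule linearI) (simp_all add: inner_add_right)
      fix z assume "z \<in> interior T"
      then show "v z $ i = (v (bc T) - grad_h v (bc T) *v bc T) $ i + grad_h v (bc T) $ i \<bullet> z"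
        using elem_affine_facts(1)[of T v z] E that by (simp add: matrix_vector_mult_diff_distrib matrix_vector_mul_component)
    qed
    have "side_mean S (\<lambda>x. elem_trace T (\<lambda>x. v x $ i) x - elem_trace T' (\<lambda>x. v x $ i) x)
      = ((v (bc T) - grad_h v (bc T) *v bc T) $ i - (v (bc T') - grad_h v (bc T') *v bc T') $ i) + (grad_h v (bc T) $ i - grad_h v (bc T') $ i) \<bullet> bc S"
    proof (rule side_mean_affine_mesh[OF T(1,3)])
      show "linear (\<lambda>x. (grad_h v (bc T) $ i - grad_h v (bc T') $ i) \<bullet> x)" by (rule linearI) (simp_all add: inner_add_right)
      fix x assume "x \<in> S"
      then show "elem_trace T (\<lambda>x. v x $ i) x - elem_trace T' (\<lambda>x. v x $ i) x =
        ((v (bc T) - grad_h v (bc T) *v bc T) $ i - (v (bc T') - grad_h v (bc T') *v bc T') $ i) + (grad_h v (bc T) $ i - grad_h v (bc T') $ i) \<bullet> x"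
        using tr[of T x] tr[of T' x] T subsetD[OF facet_subset_elem[OF T(3)]] subsetD[OF facet_subset_elem[OF T(4)]]
        by (simp add: inner_diff_left)
    qed
    then show ?thesis unfolding facet_val_def
      by (simp add: matrix_vector_mult_diff_distrib matrix_vector_mul_component inner_diff_left)
  qed
  show ?thesis
  proof
    assume v: "v \<in> U_cr \<T> \<Omega>"
    then have E: "\<forall>T\<in>\<T>. elem_affine T v" unfolding aff[symmetric] U_cr_def crouzeix_raviart_def by blast
    moreover have "facet_val v T S = facet_val v T' S"
      if "S \<in> sides_in \<T> \<Omega>" "T \<in> \<T>" "T' \<in> \<T>" "T \<noteq> T'" "S facet_of T" "S facet_of T'" for S T T'
      unfolding vec_eq_iff
    proof
      fix i
      have "(\<lambda>x. v x $ i) \<in> crouzeix_raviart \<T> \<Omega>" using v unfolding U_cr_def by blast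
      then have "side_mean S (\<lambda>x. elem_trace T (\<lambda>x. v x $ i) x - elem_trace T' (\<lambda>x. v x $ i) x) = 0"
        using that unfolding crouzeix_raviart_def by blast
      then show "facet_val v T S $ i = facet_val v T' S $ i" using jump[OF E that(2,3,5,6)] by simp
    qed
    ultimately show "(\<forall>T\<in>\<T>. elem_affine T v) \<and>
    across_interior_sides (\<lambda>S T T'. facet_val v T S = facet_val v T' S)" by blast
  next
    assume H: "(\<forall>T\<in>\<T>. elem_affine T v) \<and>
    across_interior_sides (\<lambda>S T T'. facet_val v T S = facet_val v T' S)"
    show "v \<in> U_cr \<T> \<Omega>" unfolding U_cr_def crouzeix_raviart_def
    proof (intro CollectI allI conjI ballI impI)
      fix i show "(\<lambda>x. v x $ i) \<in> broken_poly 1 \<T>" using H aff by blast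
      fix S T T' assume A: "S \<in> sides_in \<T> \<Omega>" "T \<in> \<T>" "T' \<in> \<T>" "T \<noteq> T' \<and> S facet_of T \<and> S facet_of T'"
      then have "facet_val v T S = facet_val v T' S" using H by blast
      then show "side_mean S (\<lambda>x. elem_trace T (\<lambda>x. v x $ i) x - elem_trace T' (\<lambda>x. v x $ i) x) = 0"
        using jump[of T T' S i] H A by simp
    qed
  qed
qed

lemma elem_rtI:
  fixes y :: "real^'d \<Rightarrow> real^'d^'l"
  assumes T: "T \<in> \<T>" and poly: "\<And>i j. (\<lambda>x. y x $ i $ j) \<in> broken_poly 1 \<T>"
    and const: "\<And>i S. S facet_of T \<Longrightarrow> (\<lambda>x. elem_trace T (\<lambda>x. y x $ i) x \<bullet> outer_normal T S) constant_on S"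
  shows "elem_rt T y"
proof -
  interpret full_simplex "verts T" using elem_simplex[OF T] by blast
  have e: "convex hull (verts T) = T" by (rule elem_simplex(2)[OF T])
  have "\<forall>i. \<exists>a c. \<forall>x\<in>interior T. y x $ i = a + c *\<^sub>R x"
  proof
    fix i
    have "\<forall>j. \<exists>b a. \<forall>x\<in>interior T. y x $ i $ j = b + a \<bullet> x"
    proof
      fix j
      obtain p where p: "polynomial_deg 1 p" "\<forall>x\<in>interior T. y x $ i $ j = p x"
        using poly[of i j] T unfolding broken_poly_def by blast
      show "\<exists>b a. \<forall>x\<in>interior T. y x $ i $ j = b + a \<bullet> x" using p unfolding polynomial_deg_1_iff by metis
    qed
    then obtain b A where bA: "\<And>j x. x \<in> interior T \<Longrightarrow> y x $ i $ j = b j + A j \<bullet> x" by metis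
    define a where "a = (\<chi> j. b j)"
    define L where "L = (\<lambda>x. (\<chi> j. A j \<bullet> x) :: real^'d)"
    have L: "linear L" unfolding L_def by (rule linearI) (simp_all add: vec_eq_iff inner_add_right)
    have y: "y x $ i = a + L x" if "x \<in> interior T" for x using bA[OF that] by (simp add: a_def L_def vec_eq_iff)
    have "\<exists>c. \<forall>x. L x = c *\<^sub>R x"
    proof (rule constant_normal_components[OF L])
      fix p assume p: "p \<in> verts T"
      have S: "F p facet_of T" using facet_of_iff p e by auto
      have G0: "norm (G p) > 0" using bary_grad_nonzero[OF p] by simp
      obtain k where k: "\<And>x. x \<in> F p \<Longrightarrow> elem_trace T (\<lambda>x. y x $ i) x \<bullet> outer_normal T (F p) = k"
        using const[OF S, of i] unfolding constant_on_def by blast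
      have "(a + L x) \<bullet> G p = - norm (G p) * k" if x: "x \<in> F p" for x
      proof -
        have "x \<in> T" using facet_subset_elem[OF S] x by blast
        then have "elem_trace T (\<lambda>x. y x $ i) x = a + L x" using elem_trace_affine[OF T _ L y] by blast
        then have "(a + L x) \<bullet> (- (1 / norm (G p)) *\<^sub>R G p) = k" using k[OF x] outer_normal_facet[OF p] e by simp
        then show ?thesis using G0 by (simp add: field_simps)
      qed
      then show "\<exists>k. \<forall>x\<in>F p. (a + L x) \<bullet> G p = k" by blast
    qed
    then show "\<exists>a c. \<forall>x\<in>interior T. y x $ i = a + c *\<^sub>R x" using y by metis
  qed
  then obtain a c where "\<And>i x. x \<in> interior T \<Longrightarrow> y x $ i = a i + c i *\<^sub>R x" by metis
  then show ?thesis unfolding elem_rt_def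
    by (intro exI[of _ "\<chi> i. a i"] exI[of _ "\<chi> i. c i"]) (simp add: vec_eq_iff tensor_def)
qed

text \<open>By \<open>constant_normal_components\<close> the condition on the normal components fixes the form of the field on each
  element; its normal components are then constants, and their sum vanishes together with the sum of
  the fluxes because both elements see the same area.\<close>

lemma Z_rt_iff:
  fixes y :: "real^'d \<Rightarrow> real^'d^'l"
  shows "y \<in> Z_rt \<T> \<Omega> \<longleftrightarrow> (\<forall>T\<in>\<T>. elem_rt T y) \<and>
    across_interior_sides (\<lambda>S T T'. facet_flux y T S + facet_flux y T' S = 0)"
proof -
  have tr: "elem_trace T (\<lambda>x. y x $ i) x = elem_trace T y x $ i"
    if E: "elem_rt T y" and T: "T \<in> \<T>" "x \<in> T" for T x i
  proof -
    obtain a c where y: "\<And>x. x \<in> interior T \<Longrightarrow> y x = a + c \<otimes>\<^sub>t x" using E unfolding elem_rt_def by blast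
    have "elem_trace T (\<lambda>x. y x $ i) x = a $ i + c $ i *\<^sub>R x"
      by (rule elem_trace_affine[OF T]) (auto simp: y tensor_nth linear_scale_self)
    moreover have "elem_trace T y x = a + c \<otimes>\<^sub>t x" by (rule elem_trace_affine[OF T linear_tensor y])
    ultimately show ?thesis by (simp add: tensor_nth)
  qed
  have nt: "measure (side_measure S) S * (elem_trace T (\<lambda>x. y x $ i) x \<bullet> outer_normal T S) = facet_flux y T S $ i"
    if E: "elem_rt T y" and T: "T \<in> \<T>" "S facet_of T" "x \<in> S" for T S x i
  proof -
    have "x \<in> T" using facet_subset_elem T by blast
    then show ?thesis
      using arg_cong[OF elem_rt_facts(5)[OF T(1) E T(2,3)], of "\<lambda>z. z $ i"] tr[OF E T(1)]
      by (simp add: matrix_vector_mul_component)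
  qed
  have jump: "(\<forall>x\<in>S. elem_trace T (\<lambda>x. y x $ i) x \<bullet> outer_normal T S + elem_trace T' (\<lambda>x. y x $ i) x \<bullet> outer_normal T' S = 0)
      \<longleftrightarrow> (facet_flux y T S + facet_flux y T' S) $ i = 0"
    if E: "elem_rt T y" "elem_rt T' y" and T: "T \<in> \<T>" "T' \<in> \<T>" "S facet_of T" "S facet_of T'" for S T T' i
  proof -
    have pos: "0 < measure (side_measure S) S" by (rule side_pos[OF T(1,3)])
    have eq: "measure (side_measure S) S * (elem_trace T (\<lambda>x. y x $ i) x \<bullet> outer_normal T S + elem_trace T' (\<lambda>x. y x $ i) x \<bullet> outer_normal T' S)
       = (facet_flux y T S + facet_flux y T' S) $ i" if "x \<in> S" for x
      using nt[OF E(1) T(1,3) that] nt[OF E(2) T(2,4) that] by (simp add: distrib_left)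
    obtain x where "x \<in> S" using T(3) by (auto simp: facet_of_def)
    then show ?thesis using eq pos by (metis mult_eq_0_iff less_irrefl)
  qed
  show ?thesis
  proof
    assume y: "y \<in> Z_rt \<T> \<Omega>"
    then have row: "(\<lambda>x. y x $ i) \<in> raviart_thomas \<T> \<Omega>" for i unfolding Z_rt_def by blast
    have E: "elem_rt T y" if "T \<in> \<T>" for T
      using row that unfolding raviart_thomas_def by (intro elem_rtI) auto
    have "facet_flux y T S + facet_flux y T' S = 0"
      if "S \<in> sides_in \<T> \<Omega>" "T \<in> \<T>" "T' \<in> \<T>" "T \<noteq> T'" "S facet_of T" "S facet_of T'" for S T T'
    proof -
      have "(facet_flux y T S + facet_flux y T' S) $ i = 0" for i
        using row[of i] that unfolding raviart_thomas_def jump[OF E[OF that(2)] E[OF that(3)] that(2,3,5,6), symmetric] by blast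
      then show ?thesis by (simp add: vec_eq_iff)
    qed
    then show "(\<forall>T\<in>\<T>. elem_rt T y) \<and>
    across_interior_sides (\<lambda>S T T'. facet_flux y T S + facet_flux y T' S = 0)"
      using E by blast
  next
    assume H: "(\<forall>T\<in>\<T>. elem_rt T y) \<and>
    across_interior_sides (\<lambda>S T T'. facet_flux y T S + facet_flux y T' S = 0)"
    then have E: "elem_rt T y" if "T \<in> \<T>" for T using that by blast
    show "y \<in> Z_rt \<T> \<Omega>" unfolding Z_rt_def raviart_thomas_def
    proof (intro CollectI allI conjI ballI impI)
      fix i j show "(\<lambda>x. y x $ i $ j) \<in> broken_poly 1 \<T>"
        unfolding broken_poly_def
      proof (intro CollectI ballI)
        fix T assume "T \<in> \<T>"
        then obtain a c where ac: "\<forall>x\<in>interior T. y x = a + c \<otimes>\<^sub>t x" using E unfolding elem_rt_def by blast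
        have "polynomial_deg 1 (\<lambda>x. a $ i $ j + (c $ i *\<^sub>R axis j 1) \<bullet> x)" unfolding polynomial_deg_1_iff by blast
        moreover have "\<forall>x\<in>interior T. y x $ i $ j = a $ i $ j + (c $ i *\<^sub>R axis j 1) \<bullet> x"
          using ac by (simp add: tensor_nth inner_axis')
        ultimately show "\<exists>p. polynomial_deg 1 p \<and> (\<forall>x\<in>interior T. y x $ i $ j = p x)" by blast
      qed
    next
      fix i T S assume T: "T \<in> \<T>" "S facet_of T"
      show "(\<lambda>x. elem_trace T (\<lambda>x. y x $ i) x \<bullet> outer_normal T S) constant_on S"
        unfolding constant_on_def
      proof (intro exI ballI)
        fix x assume "x \<in> S"
        then show "elem_trace T (\<lambda>x. y x $ i) x \<bullet> outer_normal T S = facet_flux y T S $ i / measure (side_measure S) S"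
          using nt[OF E[OF T(1)] T, of x i] side_pos[OF T] by (simp add: field_simps)
      qed
    next
      fix i S T T' x assume A: "S \<in> sides_in \<T> \<Omega>" "T \<in> \<T>" "T' \<in> \<T>" "T \<noteq> T' \<and> S facet_of T \<and> S facet_of T'" "x \<in> S"
      then have "facet_flux y T S + facet_flux y T' S = 0" using H by blast
      then show "elem_trace T (\<lambda>x. y x $ i) x \<bullet> outer_normal T S + elem_trace T' (\<lambda>x. y x $ i) x \<bullet> outer_normal T' S = 0"
        using jump[OF E[OF A(2)] E[OF A(3)], of S i] A by simp
    qed
  qed
qed

lemma U_cr_elem: "v \<in> U_cr \<T> \<Omega> \<Longrightarrow> T \<in> \<T> \<Longrightarrow> elem_affine T v"
  using U_cr_iff by blast

lemma U_cr_jump: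
  "v \<in> U_cr \<T> \<Omega> \<Longrightarrow> S \<in> sides_in \<T> \<Omega> \<Longrightarrow> T \<in> \<T> \<Longrightarrow> T' \<in> \<T> \<Longrightarrow> T \<noteq> T' \<Longrightarrow>
    S facet_of T \<Longrightarrow> S facet_of T' \<Longrightarrow> facet_val v T S = facet_val v T' S"
  using U_cr_iff by blast

lemma Z_rt_elem: "y \<in> Z_rt \<T> \<Omega> \<Longrightarrow> T \<in> \<T> \<Longrightarrow> elem_rt T y"
  using Z_rt_iff by blast

lemma Z_rt_jump:
  "y \<in> Z_rt \<T> \<Omega> \<Longrightarrow> S \<in> sides_in \<T> \<Omega> \<Longrightarrow> T \<in> \<T> \<Longrightarrow> T' \<in> \<T> \<Longrightarrow> T \<noteq> T' \<Longrightarrow>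
    S facet_of T \<Longrightarrow> S facet_of T' \<Longrightarrow> facet_flux y T S + facet_flux y T' S = 0"
  using Z_rt_iff by blast

lemma integration_by_parts_elem:
  fixes v :: "real^'d \<Rightarrow> real^'l"
  assumes T: "T \<in> \<T>"
  shows "(\<Sum>S | S facet_of T. facet_val v T S \<bullet> facet_flux y T S)
    = measure lebesgue T * (grad_h v (bc T) \<bullet> y (bc T) + v (bc T) \<bullet> div_h y (bc T))"
proof -
  interpret full_simplex "verts T" using elem_simplex[OF T] by blast
  have e: "convex hull (verts T) = T" by (rule elem_simplex(2)[OF T])
  have fs: "{S. S facet_of T} = F ` verts T" using facet_of_iff e by auto
  have vF: "verts (F p) = verts T - {p}" if "p \<in> verts T" for p
    unfolding verts_def[of "F p"]
    using extreme_point_of_convex_hull_affine_independent[OF affine_independent_Diff[OF indep, of "{p}"]] by blast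
  have "(\<Sum>S | S facet_of T. facet_val v T S \<bullet> facet_flux y T S) = (\<Sum>p\<in>verts T. facet_val v T (F p) \<bullet> facet_flux y T (F p))"
    unfolding fs by (simp add: sum.reindex[OF inj_on_F])
  also have "\<dots> = measure lebesgue T * (grad_h v (bc T) \<bullet> y (bc T) + v (bc T) \<bullet> div_h y (bc T))"
    using local_integration_by_parts[of "v (bc T)" "grad_h v (bc T)" "y (bc T)" "div_h y (bc T)"]
    unfolding e by (simp add: facet_val_def facet_flux_def vF cong: sum.cong)
  finally show ?thesis .
qed

text \<open>The contributions of interior sides cancel.\<close>

lemma integration_by_parts:
  fixes v :: "real^'d \<Rightarrow> real^'l"
  assumes v: "v \<in> U_cr \<T> \<Omega>" and y: "y \<in> Z_rt \<T> \<Omega>"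
  shows "(\<Sum>T\<in>\<T>. measure lebesgue T * (grad_h v (bc T) \<bullet> y (bc T) + v (bc T) \<bullet> div_h y (bc T)))
    = (\<Sum>S\<in>sides_in \<T> (frontier \<Omega>). facet_val v (boundary_elem \<T> S) S \<bullet> facet_flux y (boundary_elem \<T> S) S)"
proof -
  let ?h = "\<lambda>T S. facet_val v T S \<bullet> facet_flux y T S"
  have "(\<Sum>T\<in>\<T>. measure lebesgue T * (grad_h v (bc T) \<bullet> y (bc T) + v (bc T) \<bullet> div_h y (bc T)))
    = (\<Sum>T\<in>\<T>. \<Sum>S | S facet_of T. ?h T S)"
    by (intro sum.cong refl integration_by_parts_elem[symmetric])
  also have "\<dots> = (\<Sum>S\<in>sides \<T>. \<Sum>T\<in>elems S. ?h T S)" by (rule sum_elements_sides)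
  also have "\<dots> = (\<Sum>S\<in>sides \<T>. if S \<in> sides_in \<T> (frontier \<Omega>) then ?h (boundary_elem \<T> S) S else 0)"
  proof (intro sum.cong refl)
    fix S assume "S \<in> sides \<T>"
    then show "(\<Sum>T\<in>elems S. ?h T S) = (if S \<in> sides_in \<T> (frontier \<Omega>) then ?h (boundary_elem \<T> S) S else 0)"
    proof (cases rule: elems_cases)
      case (interior T T')
      then have T: "T \<in> \<T>" "T' \<in> \<T>" "S facet_of T" "S facet_of T'" by (auto simp: elems_def)
      have "facet_val v T S = facet_val v T' S" "facet_flux y T S + facet_flux y T' S = 0"
        by (rule U_cr_jump[OF v interior(1) T(1,2) interior(3) T(3,4)],
            rule Z_rt_jump[OF y interior(1) T(1,2) interior(3) T(3,4)])
      then have "?h T S + ?h T' S = 0" by (metis inner_add_right inner_zero_right)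
      then show ?thesis using interior(2,3,4) by simp
    qed simp
  qed
  also have "\<dots> = (\<Sum>S\<in>sides_in \<T> (frontier \<Omega>). ?h (boundary_elem \<T> S) S)"
  proof -
    have "sides \<T> \<inter> sides_in \<T> (frontier \<Omega>) = sides_in \<T> (frontier \<Omega>)" by (auto simp: sides_in_def)
    then show ?thesis by (simp only: sum.inter_restrict[OF finite_sides, symmetric])
  qed
  finally show ?thesis .
qed

text \<open>The Crouzeix-Raviart function with side means \<open>a\<close>: the function \<open>1 - d \<lambda>\<close>, with the
  barycentric coordinate \<open>\<lambda>\<close> of a vertex, has mean one over the opposite side and mean zero over the
  other sides.\<close>

definition cr_fun :: "((real^'d) set \<Rightarrow> real^'l) \<Rightarrow> real^'d \<Rightarrow> real^'l" where
  "cr_fun a = piecewise (\<lambda>T x. \<Sum>p\<in>verts T. (1 - real CARD('d) * bary (verts T) p x) *\<^sub>R a (convex hull (verts T - {p})))"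

text \<open>The Raviart-Thomas field with fluxes \<open>f T S\<close> out of \<open>T\<close>: the field \<open>(x - p) / (d \<bar>T\<bar>)\<close> is
  tangential to the sides that contain the vertex \<open>p\<close>, and has flux one through the opposite side.\<close>

definition rt_fun :: "((real^'d) set \<Rightarrow> (real^'d) set \<Rightarrow> real^'l) \<Rightarrow> real^'d \<Rightarrow> real^'d^'l" where
  "rt_fun f = piecewise (\<lambda>T x. \<Sum>p\<in>verts T. f T (convex hull (verts T - {p})) \<otimes>\<^sub>t ((1 / (real CARD('d) * measure lebesgue T)) *\<^sub>R (x - p)))"

lemma cr_fun_elem:
  assumes T: "T \<in> \<T>"
  shows "elem_affine T (cr_fun a)" and "S facet_of T \<Longrightarrow> facet_val (cr_fun a) T S = a S"
proof -
  interpret full_simplex "verts T" using elem_simplex[OF T] by blast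
  have e: "convex hull (verts T) = T" by (rule elem_simplex(2)[OF T])
  define f where "f = (\<lambda>x. \<Sum>p\<in>verts T. (1 - real CARD('d) * lam p x) *\<^sub>R a (F p))"
  define L where "L = (\<lambda>x. \<Sum>p\<in>verts T. (- real CARD('d) * (G p \<bullet> x)) *\<^sub>R a (F p))"
  define c where "c = (\<Sum>p\<in>verts T. (1 - real CARD('d) + real CARD('d) * (G p \<bullet> p)) *\<^sub>R a (F p))"
  have L: "linear L" unfolding L_def by (intro linear_compose_sum ballI linearI) (simp_all add: inner_add_right algebra_simps)
  have f: "f x = c + matrix L *v x" for x
  proof -
    have "f x = c + L x" unfolding f_def c_def L_def by (simp add: bary_def algebra_simps flip: sum.distrib)
    then show ?thesis using L by (simp add: matrix_works linear_matrix_vector_mul_eq)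
  qed
  have v: "cr_fun a x = f x" if "x \<in> interior T" for x unfolding cr_fun_def f_def by (rule piecewise_eq[OF T that])
  show A: "elem_affine T (cr_fun a)" unfolding elem_affine_def using v f by metis
  note b = elem_simps(4)[OF T]
  have g: "grad_h (cr_fun a) (bc T) = matrix L" by (rule grad_h_affine[OF b, of _ c]) (simp add: v f)
  have fv: "facet_val (cr_fun a) T S = f (bc S)" for S
    unfolding facet_val_def g v[OF b] f by (simp add: matrix_vector_mult_diff_distrib)
  assume S: "S facet_of T"
  obtain q where q: "q \<in> verts T" "S = F q" "verts S = verts T - {q}" using facetE[OF T S] .
  have "f (bc S) = (\<Sum>p\<in>verts T. if p = q then a (F p) else 0)"
    unfolding f_def q(3) using q(1) by (intro sum.cong) (auto simp: bary_facet_centroid)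
  also have "\<dots> = a S" using q finite_V by simp
  finally show "facet_val (cr_fun a) T S = a S" using fv by simp
qed

lemma rt_fun_elem:
  assumes T: "T \<in> \<T>"
  shows "elem_rt T (rt_fun f)" and "S facet_of T \<Longrightarrow> facet_flux (rt_fun f) T S = f T S"
proof -
  interpret full_simplex "verts T" using elem_simplex[OF T] by blast
  have e: "convex hull (verts T) = T" by (rule elem_simplex(2)[OF T])
  define k where "k = 1 / (real CARD('d) * measure lebesgue T)"
  have kpos: "k > 0" using elem_simps(7)[OF T] by (simp add: k_def)
  define c where "c = (\<Sum>p\<in>verts T. k *\<^sub>R f T (F p))"
  define a where "a = (\<Sum>p\<in>verts T. f T (F p) \<otimes>\<^sub>t (- k *\<^sub>R p))"
  have tsum: "c \<otimes>\<^sub>t x = (\<Sum>p\<in>verts T. f T (F p) \<otimes>\<^sub>t (k *\<^sub>R x))" for x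
    unfolding c_def by (simp add: tensor_def vec_eq_iff sum_distrib_right sum_distrib_left algebra_simps)
  have y: "rt_fun f x = a + c \<otimes>\<^sub>t x" if "x \<in> interior T" for x
    unfolding rt_fun_def piecewise_eq[OF T that] tsum a_def k_def[symmetric] sum.distrib[symmetric]
    by (intro sum.cong refl) (simp add: scaleR_diff_right flip: tensor_simps(1))
  show E: "elem_rt T (rt_fun f)" unfolding elem_rt_def using y by metis
  assume S: "S facet_of T"
  obtain q where q: "q \<in> verts T" "S = F q" "verts S = verts T - {q}" using facetE[OF T S] .
  have bS: "bc S \<in> S" using facet_centroid_mem[OF q(1)] q by simp
  have "facet_flux (rt_fun f) T S = measure (side_measure S) S *\<^sub>R (elem_trace T (rt_fun f) (bc S) *v outer_normal T S)"
    by (rule elem_rt_facts(5)[OF T E S bS, symmetric])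
  also have "elem_trace T (rt_fun f) (bc S) = a + c \<otimes>\<^sub>t bc S"
    by (rule elem_trace_affine[OF T _ linear_tensor y]) (use bS facet_subset_elem[OF S] in auto)
  also have "\<dots> = (\<Sum>p\<in>verts T. f T (F p) \<otimes>\<^sub>t (k *\<^sub>R (bc S - p)))"
    unfolding tsum a_def sum.distrib[symmetric]
    by (intro sum.cong refl) (simp add: scaleR_diff_right flip: tensor_simps(1))
  also have "outer_normal T S = - (1 / norm (G q)) *\<^sub>R G q" using outer_normal_facet[OF q(1)] e q(2) by simp
  also have "measure (side_measure S) S = norm (G q) / k" using measure_side[OF q(1)] e q(2) by (simp add: k_def)
  also have "(\<Sum>p\<in>verts T. f T (F p) \<otimes>\<^sub>t (k *\<^sub>R (bc S - p))) *v (- (1 / norm (G q)) *\<^sub>R G q)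
     = (\<Sum>p\<in>verts T. (if p = q then (k / norm (G q)) *\<^sub>R f T (F p) else 0))"
  proof -
    have ms: "sum M (verts T) *v x = (\<Sum>p\<in>verts T. M p *v x)" for M :: "real^'d \<Rightarrow> real^'d^'l" and x
      using linear_sum[of "\<lambda>A::real^'d^'l. A *v x" M "verts T"]
      by (simp add: linear_iff matrix_vector_mult_add_rdistrib scaleR_matrix_vector_assoc)
    have gq: "(bc S - p) \<bullet> G q = (if p = q then -1 else 0)" if "p \<in> verts T" for p
      using bary_diff[of "verts T" q "bc S" p] that q(1) unfolding q(3)
      by (auto simp: bary_facet_centroid bary_vertex inner_commute)
    show ?thesis unfolding ms
      by (intro sum.cong refl) (auto simp: tensor_mult_vec gq)
  qed
  also have "\<dots> = (k / norm (G q)) *\<^sub>R f T S" using q finite_V by simp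
  also have "(norm (G q) / k) *\<^sub>R \<dots> = f T S" using kpos bary_grad_nonzero[OF q(1)] by simp
  finally show "facet_flux (rt_fun f) T S = f T S" .
qed

lemma cr_fun_U: "cr_fun a \<in> U_cr \<T> \<Omega>"
  unfolding U_cr_iff using cr_fun_elem by metis

lemma rt_fun_Z:
  assumes "\<And>S T T'. S \<in> sides_in \<T> \<Omega> \<Longrightarrow> T \<in> \<T> \<Longrightarrow> T' \<in> \<T> \<Longrightarrow> T \<noteq> T' \<Longrightarrow> S facet_of T \<Longrightarrow> S facet_of T' \<Longrightarrow> f T S + f T' S = 0"
  shows "rt_fun f \<in> Z_rt \<T> \<Omega>"
  unfolding Z_rt_iff
proof (intro conjI ballI impI)
  fix S T T' assume A: "S \<in> sides_in \<T> \<Omega>" "T \<in> \<T>" "T' \<in> \<T>" "T \<noteq> T' \<and> S facet_of T \<and> S facet_of T'"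
  then show "facet_flux (rt_fun f) T S + facet_flux (rt_fun f) T' S = 0"
    using assms[of S T T'] rt_fun_elem(2)[of T S f] rt_fun_elem(2)[of T' S f] by simp
qed (rule rt_fun_elem(1))

lemma elem_affine_combination:
  assumes T: "T \<in> \<T>" and u: "elem_affine T u" and v: "elem_affine T v"
  shows "elem_affine T (\<lambda>x. u x + t *\<^sub>R v x)"
    and "grad_h (\<lambda>x. u x + t *\<^sub>R v x) (bc T) = grad_h u (bc T) + t *\<^sub>R grad_h v (bc T)"
    and "facet_val (\<lambda>x. u x + t *\<^sub>R v x) T S = facet_val u T S + t *\<^sub>R facet_val v T S"
proof -
  obtain c W where u: "\<And>x. x \<in> interior T \<Longrightarrow> u x = c + W *v x" using u unfolding elem_affine_def by blast
  obtain c' W' where v: "\<And>x. x \<in> interior T \<Longrightarrow> v x = c' + W' *v x" using v unfolding elem_affine_def by blast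
  note b = elem_simps(4)[OF T]
  have uv: "u x + t *\<^sub>R v x = (c + t *\<^sub>R c') + (W + t *\<^sub>R W') *v x" if "x \<in> interior T" for x
    using u[OF that] v[OF that] by (simp add: matrix_vector_mult_add_rdistrib scaleR_matrix_vector_assoc[symmetric] algebra_simps)
  show "elem_affine T (\<lambda>x. u x + t *\<^sub>R v x)" unfolding elem_affine_def using uv by blast
  have g: "grad_h (\<lambda>x. u x + t *\<^sub>R v x) (bc T) = W + t *\<^sub>R W'" "grad_h u (bc T) = W" "grad_h v (bc T) = W'"
    using grad_h_affine[OF b uv] grad_h_affine[OF b u] grad_h_affine[OF b v] by simp_all
  then show "grad_h (\<lambda>x. u x + t *\<^sub>R v x) (bc T) = grad_h u (bc T) + t *\<^sub>R grad_h v (bc T)" by simp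
  show "facet_val (\<lambda>x. u x + t *\<^sub>R v x) T S = facet_val u T S + t *\<^sub>R facet_val v T S"
    unfolding facet_val_def g by (simp add: matrix_vector_mult_add_rdistrib scaleR_matrix_vector_assoc[symmetric] algebra_simps)
qed

lemma elem_rt_combination:
  assumes T: "T \<in> \<T>" and y: "elem_rt T y" and z: "elem_rt T z"
  shows "elem_rt T (\<lambda>x. y x + t *\<^sub>R z x)"
    and "div_h (\<lambda>x. y x + t *\<^sub>R z x) (bc T) = div_h y (bc T) + t *\<^sub>R div_h z (bc T)"
    and "facet_flux (\<lambda>x. y x + t *\<^sub>R z x) T S = facet_flux y T S + t *\<^sub>R facet_flux z T S"
proof -
  obtain a c where y: "\<And>x. x \<in> interior T \<Longrightarrow> y x = a + c \<otimes>\<^sub>t x" using y unfolding elem_rt_def by blast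
  obtain a' c' where z: "\<And>x. x \<in> interior T \<Longrightarrow> z x = a' + c' \<otimes>\<^sub>t x" using z unfolding elem_rt_def by blast
  note b = elem_simps(4)[OF T]
  have yz: "y x + t *\<^sub>R z x = (a + t *\<^sub>R a') + (c + t *\<^sub>R c') \<otimes>\<^sub>t x" if "x \<in> interior T" for x
    using y[OF that] z[OF that] by (simp add: tensor_simps algebra_simps)
  show "elem_rt T (\<lambda>x. y x + t *\<^sub>R z x)" unfolding elem_rt_def using yz by blast
  have d: "div_h (\<lambda>x. y x + t *\<^sub>R z x) (bc T) = real CARD('d) *\<^sub>R (c + t *\<^sub>R c')"
    "div_h y (bc T) = real CARD('d) *\<^sub>R c" "div_h z (bc T) = real CARD('d) *\<^sub>R c'"
    using div_h_affine[OF b yz] div_h_affine[OF b y] div_h_affine[OF b z] by simp_all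
  then show "div_h (\<lambda>x. y x + t *\<^sub>R z x) (bc T) = div_h y (bc T) + t *\<^sub>R div_h z (bc T)" by (simp add: algebra_simps)
  show "facet_flux (\<lambda>x. y x + t *\<^sub>R z x) T S = facet_flux y T S + t *\<^sub>R facet_flux z T S"
    unfolding facet_flux_def d
    by (simp add: matrix_vector_mult_add_rdistrib tensor_simps scaleR_matrix_vector_assoc[symmetric] scaleR_add_right tensor_mult_vec algebra_simps)
qed

end

section \<open>The functionals in finitely many unknowns, and duality\<close>

text \<open>At a minimum along the line with directions \<open>P'\<close> and \<open>Q'\<close> the derivative vanishes.  It is used
  for the primal functional and for the negative of the dual one.\<close>

lemma derivative_zero_at_minimum:
  fixes p :: "'t \<Rightarrow> 'a::euclidean_space \<Rightarrow> ereal" and q :: "'t \<Rightarrow> 'b::euclidean_space \<Rightarrow> ereal"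
  assumes C: "\<And>T. T \<in> A \<Longrightarrow> C1 (p T)" "\<And>T. T \<in> A \<Longrightarrow> C1 (q T)"
    and min: "\<And>t. (\<Sum>T\<in>A. m T * (real_of_ereal (p T (P T)) + real_of_ereal (q T (Q T)))) - K
       \<le> (\<Sum>T\<in>A. m T * (real_of_ereal (p T (P T + t *\<^sub>R P' T)) + real_of_ereal (q T (Q T + t *\<^sub>R Q' T)))) - (K + t * K')"
  shows "(\<Sum>T\<in>A. m T * (P' T \<bullet> gradient (p T) (P T) + Q' T \<bullet> gradient (q T) (Q T))) = K'"
proof -
  define h where "h = (\<lambda>t. (\<Sum>T\<in>A. m T * (real_of_ereal (p T (P T + t *\<^sub>R P' T)) + real_of_ereal (q T (Q T + t *\<^sub>R Q' T)))) - (K + t * K'))"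
  have "(h has_real_derivative (\<Sum>T\<in>A. m T * (P' T \<bullet> gradient (p T) (P T) + Q' T \<bullet> gradient (q T) (Q T))) - (0 + 1 * K')) (at 0)"
    unfolding h_def
    by (intro DERIV_diff DERIV_sum DERIV_cmult DERIV_add DERIV_const DERIV_cmult_right DERIV_ident
        GDERIV_along_line C1_gradient C)
  moreover have "h 0 \<le> h t" for t using min[of t] by (simp add: h_def)
  ultimately show ?thesis using DERIV_local_min[of h _ 0 1] by force
qed

text \<open>The constant value of data that are constant on the relative interior of \<open>S\<close>.\<close>

definition side_value :: "('a::euclidean_space \<Rightarrow> 'b) \<Rightarrow> 'a set \<Rightarrow> 'b" where
  "side_value f S = f (SOME x. x \<in> rel_interior S)"

context fe_mesh
begin

text \<open>The interior of an element is open and not empty, hence not a null set, so an almost everywhere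
  property holds at some point of it, and with it at the centroid.\<close>

lemma AE_elem:
  assumes T: "T \<in> \<T>" and ae: "AE x in lebesgue_on \<Omega>. P (F x)" and const: "\<And>x. x \<in> interior T \<Longrightarrow> F x = F (bc T)"
  shows "P (F (bc T))"
proof (rule ccontr)
  assume n: "\<not> P (F (bc T))"
  have "\<Omega> \<in> sets lebesgue" using open_domain by simp
  then have "AE x in lebesgue. x \<in> \<Omega> \<longrightarrow> P (F x)" using ae by (simp add: AE_restrict_space_iff)
  then have "AE x in lebesgue. x \<notin> interior T"
    by eventually_elim (use n const elem_interior_subset[OF T] in force)
  then have "interior T \<in> null_sets lebesgue"
    by (subst (asm) AE_iff_null_sets[symmetric]) auto
  then have "negligible (interior T)" by (simp add: negligible_iff_null_sets)
  then show False using open_not_negligible[of "interior T"] elem_simps(5)[OF T] by simp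
qed

text \<open>The boundaries of the elements form a null set, outside of which each point of the domain lies in the
  interior of exactly one element.\<close>

lemma nn_integral_elementwise:
  fixes h :: "real^'d \<Rightarrow> ennreal"
  assumes h: "\<And>T x. T \<in> \<T> \<Longrightarrow> x \<in> interior T \<Longrightarrow> h x = k T"
  shows "(\<integral>\<^sup>+x. h x \<partial>lebesgue_on \<Omega>) = (\<Sum>T\<in>\<T>. k T * ennreal (measure lebesgue T))"
proof -
  have Om: "\<Omega> \<in> sets lebesgue" using open_domain by simp
  have neg: "negligible (\<Union>T\<in>\<T>. frontier T)"
    using finite_mesh elem_simps(3) by (intro negligible_Union) (auto intro: negligible_convex_frontier)
  have "(\<integral>\<^sup>+x. h x \<partial>lebesgue_on \<Omega>) = (\<integral>\<^sup>+x. h x * indicator \<Omega> x \<partial>lebesgue)"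
    using Om by (intro nn_integral_restrict_space) auto
  also have "\<dots> = (\<integral>\<^sup>+x. (\<Sum>T\<in>\<T>. k T * indicator (interior T) x) \<partial>lebesgue)"
  proof (rule nn_integral_cong_AE)
    have "AE x in lebesgue. x \<notin> (\<Union>T\<in>\<T>. frontier T)"
      using neg by (intro AE_not_in) (simp add: negligible_iff_null_sets)
    then show "AE x in lebesgue. h x * indicator \<Omega> x = (\<Sum>T\<in>\<T>. k T * indicator (interior T) x)"
    proof eventually_elim
      case (elim x)
      show ?case
      proof (cases "x \<in> \<Omega>")
        case True
        then obtain T where T: "T \<in> \<T>" "x \<in> T" using union_mesh closure_subset[of \<Omega>] by blast
        then have x: "x \<in> interior T" using elim elem_simps(2)[OF T(1)] by (auto simp: frontier_def)
        have "(\<Sum>T'\<in>\<T>. k T' * indicator (interior T') x) = (\<Sum>T'\<in>\<T>. if T' = T then k T' else 0)"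
        proof (intro sum.cong refl)
          fix T' assume T': "T' \<in> \<T>"
          show "k T' * indicator (interior T') x = (if T' = T then k T' else 0)"
            using elem_unique[OF T(1) T' x] interior_subset[of T'] x by (auto simp: indicator_def)
        qed
        then show ?thesis using True T(1) finite_mesh h[OF T(1) x] by simp
      next
        case False
        then have "x \<notin> interior T" if "T \<in> \<T>" for T using elem_interior_subset[OF that] by blast
        then show ?thesis using False by simp
      qed
    qed
  qed
  also have "\<dots> = (\<Sum>T\<in>\<T>. k T * emeasure lebesgue (interior T))"
    by (subst nn_integral_sum) (auto simp: nn_integral_cmult_indicator intro!: borel_measurable_times_ennreal borel_measurable_indicator)
  also have "\<dots> = (\<Sum>T\<in>\<T>. k T * ennreal (measure lebesgue T))"
  proof (intro sum.cong refl)
    fix T assume T: "T \<in> \<T>"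
    have b: "bounded T" using elem_simps(1)[OF T] compact_imp_bounded by blast
    have "interior T \<in> lmeasurable" using b by (intro lmeasurable_interior)
    then have "emeasure lebesgue (interior T) = ennreal (measure lebesgue (interior T))" by (rule emeasure_eq_measure2)
    moreover have "measure lebesgue (interior T) = measure lebesgue T"
      using b negligible_convex_frontier[OF elem_simps(3)[OF T]] by (rule measure_interior)
    ultimately show "k T * emeasure lebesgue (interior T) = k T * ennreal (measure lebesgue T)" by simp
  qed
  finally show ?thesis .
qed

lemma eintegral_elementwise:
  assumes f: "\<And>T x. T \<in> \<T> \<Longrightarrow> x \<in> interior T \<Longrightarrow> f x = ereal (r T)"
  shows "eintegral (lebesgue_on \<Omega>) f = ereal (\<Sum>T\<in>\<T>. measure lebesgue T * r T)"
proof -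
  have E: "(\<Sum>T\<in>\<T>. ennreal (s T) * ennreal (measure lebesgue T)) = ennreal (\<Sum>T\<in>\<T>. max 0 (s T) * measure lebesgue T)" for s
  proof -
    have "ennreal (s T) * ennreal (measure lebesgue T) = ennreal (max 0 (s T) * measure lebesgue T)" for T
      by (cases "0 \<le> s T") (auto simp: ennreal_mult'' ennreal_neg max_def)
    then show ?thesis by (simp add: sum_ennreal)
  qed
  have 1: "(\<integral>\<^sup>+x. e2ennreal (f x) \<partial>lebesgue_on \<Omega>) = ennreal (\<Sum>T\<in>\<T>. max 0 (r T) * measure lebesgue T)"
    unfolding E[symmetric] by (rule nn_integral_elementwise) (simp add: f e2ennreal_ereal)
  have 2: "(\<integral>\<^sup>+x. e2ennreal (- f x) \<partial>lebesgue_on \<Omega>) = ennreal (\<Sum>T\<in>\<T>. max 0 (- r T) * measure lebesgue T)"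
    unfolding E[symmetric] by (rule nn_integral_elementwise) (simp add: f e2ennreal_ereal)
  have "eintegral (lebesgue_on \<Omega>) f = ereal ((\<Sum>T\<in>\<T>. max 0 (r T) * measure lebesgue T) - (\<Sum>T\<in>\<T>. max 0 (- r T) * measure lebesgue T))"
    unfolding eintegral_def 1 2 by (simp add: sum_nonneg enn2ereal_ennreal)
  also have "(\<Sum>T\<in>\<T>. max 0 (r T) * measure lebesgue T) - (\<Sum>T\<in>\<T>. max 0 (- r T) * measure lebesgue T) = (\<Sum>T\<in>\<T>. measure lebesgue T * r T)"
    unfolding sum_subtractf[symmetric] by (intro sum.cong refl) (auto simp: max_def algebra_simps)
  finally show ?thesis .
qed

lemma eintegral_elementwise_PInf:
  assumes f: "\<And>T x. T \<in> \<T> \<Longrightarrow> x \<in> interior T \<Longrightarrow> f x = c T" and c: "\<And>T. T \<in> \<T> \<Longrightarrow> c T \<noteq> -\<infinity>"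
    and T: "T \<in> \<T>" "c T = \<infinity>"
  shows "eintegral (lebesgue_on \<Omega>) f = \<infinity>"
proof -
  have 1: "(\<integral>\<^sup>+x. e2ennreal (f x) \<partial>lebesgue_on \<Omega>) = \<infinity>"
  proof -
    have "e2ennreal (c T) * ennreal (measure lebesgue T) = \<infinity>"
      using T(2) elem_simps(7)[OF T(1)] by (simp add: ennreal_top_mult)
    moreover have "e2ennreal (c T) * ennreal (measure lebesgue T) \<le> (\<Sum>T\<in>\<T>. e2ennreal (c T) * ennreal (measure lebesgue T))"
      by (rule member_le_sum[OF T(1)]) (use finite_mesh in auto)
    ultimately show ?thesis
      using nn_integral_elementwise[of "\<lambda>x. e2ennreal (f x)" "\<lambda>T. e2ennreal (c T)"] f
      by (simp add: top_unique)
  qed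
  have "(\<integral>\<^sup>+x. e2ennreal (- f x) \<partial>lebesgue_on \<Omega>) = (\<Sum>T\<in>\<T>. e2ennreal (- c T) * ennreal (measure lebesgue T))"
    by (rule nn_integral_elementwise) (simp add: f)
  also have "\<dots> < \<infinity>"
  proof -
    have "e2ennreal (- c T) < \<infinity>" if "T \<in> \<T>" for T
      using c[OF that] by (cases "c T") (auto simp: e2ennreal_ereal e2ennreal_neg)
    then have "\<forall>T\<in>\<T>. e2ennreal (- c T) * ennreal (measure lebesgue T) < top"
      by (auto simp: ennreal_mult_less_top)
    then show ?thesis using finite_mesh by simp
  qed
  finally show ?thesis unfolding eintegral_def 1 by (cases "\<integral>\<^sup>+x. e2ennreal (- f x) \<partial>lebesgue_on \<Omega>") (auto simp: enn2ereal_ennreal)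
qed

end

text \<open>The discrete problem.  Side means and fluxes on boundary sides refer to the adjacent element
  \<open>bel S\<close>, and the boundary data on a side are written as the vectors \<open>gS S\<close> and \<open>uS S\<close>.\<close>

locale fe_problem = fe_mesh \<T> \<Omega> for \<T> :: "(real^'d) set set" and \<Omega> +
  fixes \<Gamma>\<^sub>D \<Gamma>\<^sub>N :: "(real^'d) set"
    and \<phi> :: "real^'d \<Rightarrow> real^'d^'l \<Rightarrow> ereal" and \<psi> :: "real^'d \<Rightarrow> real^'l \<Rightarrow> ereal"
    and g u\<^sub>D :: "real^'d \<Rightarrow> real^'l"
  assumes boundary: "\<Gamma>\<^sub>D \<union> \<Gamma>\<^sub>N = frontier \<Omega>" "\<Gamma>\<^sub>D \<inter> \<Gamma>\<^sub>N = {}"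
    and boundary_sides: "sides_in \<T> (frontier \<Omega>) \<subseteq> sides_in \<T> \<Gamma>\<^sub>D \<union> sides_in \<T> \<Gamma>\<^sub>N"
    and phi_convex: "AE x in lebesgue_on \<Omega>. proper_convex_lsc (\<phi> x)"
    and psi_convex: "AE x in lebesgue_on \<Omega>. proper_convex_lsc (\<psi> x)"
    and phi_const: "\<And>r. elementwise_constant \<T> (\<lambda>x. \<phi> x r)"
    and psi_const: "\<And>s. elementwise_constant \<T> (\<lambda>x. \<psi> x s)"
    and g_const: "sidewise_constant (sides_in \<T> \<Gamma>\<^sub>N) g"
    and uD_const: "sidewise_constant (sides_in \<T> \<Gamma>\<^sub>D) u\<^sub>D"
begin

abbreviation "SD \<equiv> sides_in \<T> \<Gamma>\<^sub>D"
abbreviation "SN \<equiv> sides_in \<T> \<Gamma>\<^sub>N"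
abbreviation "bel \<equiv> boundary_elem \<T>"
abbreviation "primal \<equiv> I_cr \<Omega> \<Gamma>\<^sub>D \<Gamma>\<^sub>N \<T> \<phi> \<psi> g u\<^sub>D"
abbreviation "dual \<equiv> D_rt \<Omega> \<Gamma>\<^sub>D \<Gamma>\<^sub>N \<T> \<phi> \<psi> g u\<^sub>D"
abbreviation "gS \<equiv> side_value g"
abbreviation "uS \<equiv> side_value u\<^sub>D"
abbreviation "vol T \<equiv> measure lebesgue T"
abbreviation "area S \<equiv> measure (side_measure S) S"

lemma phi_elem: "T \<in> \<T> \<Longrightarrow> x \<in> interior T \<Longrightarrow> \<phi> x = \<phi> (bc T)"
proof
  fix r assume T: "T \<in> \<T>" "x \<in> interior T"
  have "(\<lambda>x. \<phi> x r) constant_on interior T" using phi_const T unfolding elementwise_constant_def by blast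
  then show "\<phi> x r = \<phi> (bc T) r" using T(2) elem_simps(4)[OF T(1)] unfolding constant_on_def by metis
qed

lemma psi_elem: "T \<in> \<T> \<Longrightarrow> x \<in> interior T \<Longrightarrow> \<psi> x = \<psi> (bc T)"
proof
  fix r assume T: "T \<in> \<T>" "x \<in> interior T"
  have "(\<lambda>x. \<psi> x r) constant_on interior T" using psi_const T unfolding elementwise_constant_def by blast
  then show "\<psi> x r = \<psi> (bc T) r" using T(2) elem_simps(4)[OF T(1)] unfolding constant_on_def by metis
qed

lemma phi_proper: "T \<in> \<T> \<Longrightarrow> proper_convex_lsc (\<phi> (bc T))"
  using AE_elem[where P = proper_convex_lsc and F = \<phi>, OF _ phi_convex] phi_elem by blast

lemma psi_proper: "T \<in> \<T> \<Longrightarrow> proper_convex_lsc (\<psi> (bc T))"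
  using AE_elem[where P = proper_convex_lsc and F = \<psi>, OF _ psi_convex] psi_elem by blast

lemma not_MInf:
  assumes "T \<in> \<T>"
  shows "\<phi> (bc T) r \<noteq> -\<infinity>" "\<psi> (bc T) s \<noteq> -\<infinity>" "fenchel (\<phi> (bc T)) r \<noteq> -\<infinity>" "fenchel (\<psi> (bc T)) s \<noteq> -\<infinity>"
  using phi_proper[OF assms] psi_proper[OF assms] fenchel_not_MInf unfolding proper_convex_lsc_def by blast+

lemma finite_SD: "finite SD" and finite_SN: "finite SN"
  using finite_sides by (auto simp: sides_in_def intro: finite_subset)

lemma boundary_union: "sides_in \<T> (frontier \<Omega>) = SD \<union> SN"
  using boundary_sides boundary(1) unfolding sides_in_def by blast

lemma boundary_disjoint: "SD \<inter> SN = {}"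
  using side_rel_interior_nonempty boundary(2) unfolding sides_in_def by blast

lemma boundary_side:
  assumes "S \<in> SD \<union> SN"
  shows "bel S \<in> \<T>" "S facet_of bel S" "elems S = {bel S}" "S \<in> sides \<T>" "S \<notin> sides_in \<T> \<Omega>"
proof -
  have S: "S \<in> sides_in \<T> (frontier \<Omega>)" using assms boundary_union by blast
  then show s: "S \<in> sides \<T>" by (simp add: sides_in_def)
  from s have "elems S = {bel S} \<and> S \<notin> sides_in \<T> \<Omega>" using S by (cases rule: elems_cases) auto
  then show "bel S \<in> \<T>" "S facet_of bel S" "elems S = {bel S}" "S \<notin> sides_in \<T> \<Omega>"
    by (auto simp: elems_def)
qed

lemma gS: "S \<in> SN \<Longrightarrow> x \<in> rel_interior S \<Longrightarrow> g x = gS S"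
  using g_const unfolding sidewise_constant_def constant_on_def side_value_def by (metis someI)

lemma uS: "S \<in> SD \<Longrightarrow> x \<in> rel_interior S \<Longrightarrow> u\<^sub>D x = uS S"
  using uD_const unfolding sidewise_constant_def constant_on_def side_value_def by (metis someI)

definition feasible_primal :: "(real^'d \<Rightarrow> real^'l) \<Rightarrow> bool" where
  "feasible_primal v \<longleftrightarrow> (\<forall>S\<in>SD. facet_val v (bel S) S = uS S)"

definition feasible_dual :: "(real^'d \<Rightarrow> real^'d^'l) \<Rightarrow> bool" where
  "feasible_dual y \<longleftrightarrow> (\<forall>S\<in>SN. facet_flux y (bel S) S = area S *\<^sub>R gS S)"

definition load :: "(real^'d \<Rightarrow> real^'l) \<Rightarrow> real" where
  "load v = (\<Sum>S\<in>SN. area S * (gS S \<bullet> facet_val v (bel S) S))"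

definition lift :: "(real^'d \<Rightarrow> real^'d^'l) \<Rightarrow> real" where
  "lift y = (\<Sum>S\<in>SD. facet_flux y (bel S) S \<bullet> uS S)"

lemma pi_h_side:
  assumes v: "v \<in> U_cr \<T> \<Omega>" and S: "S \<in> SD \<union> SN"
  shows "pi_h \<T> v S = facet_val v (bel S) S"
  unfolding pi_h_def using boundary_side[OF S] elem_affine_facts(5)[OF _ U_cr_elem[OF v]] by blast

lemma primal_eq:
  assumes v: "v \<in> U_cr \<T> \<Omega>"
  shows "primal v = eintegral (lebesgue_on \<Omega>) (\<lambda>x. \<phi> x (grad_h v x)) + eintegral (lebesgue_on \<Omega>) (\<lambda>x. \<psi> x (Pi_h \<T> v x))
    - ereal (load v) + (if feasible_primal v then 0 else \<infinity>)"
proof -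
  have "L2_sides SN (\<lambda>S. g) (\<lambda>S x. pi_h \<T> v S) = load v"
    unfolding L2_sides_def load_def
  proof (intro sum.cong refl)
    fix S assume S: "S \<in> SN"
    note b = boundary_side[OF UnI2[OF S]]
    have "(\<integral>x. indicator S x *\<^sub>R (g x \<bullet> pi_h \<T> v S) \<partial>side_measure S) = area S *\<^sub>R (gS S \<bullet> facet_val v (bel S) S)"
      by (rule side_integral_const_mesh[OF b(1,2)]) (simp add: gS[OF S] pi_h_side[OF v UnI2[OF S]])
    then show "(\<integral>x. indicator S x *\<^sub>R (g x \<bullet> pi_h \<T> v S) \<partial>side_measure S) = area S * (gS S \<bullet> facet_val v (bel S) S)" by simp
  qed
  moreover have "(\<forall>S\<in>SD. \<forall>x\<in>rel_interior S. pi_h \<T> v S = u\<^sub>D x) \<longleftrightarrow> feasible_primal v"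
    unfolding feasible_primal_def
  proof (intro ball_cong refl)
    fix S assume S: "S \<in> SD"
    have "rel_interior S \<noteq> {}" using side_rel_interior_nonempty S by (simp add: sides_in_def)
    then show "(\<forall>x\<in>rel_interior S. pi_h \<T> v S = u\<^sub>D x) \<longleftrightarrow> facet_val v (bel S) S = uS S"
      using uS[OF S] pi_h_side[OF v UnI1[OF S]] by auto
  qed
  ultimately show ?thesis unfolding I_cr_def I_sides_def by simp
qed

lemma dual_eq:
  assumes y: "y \<in> Z_rt \<T> \<Omega>"
  shows "dual y = - eintegral (lebesgue_on \<Omega>) (\<lambda>x. fenchel (\<phi> x) (Pi_h \<T> y x)) - eintegral (lebesgue_on \<Omega>) (\<lambda>x. fenchel (\<psi> x) (div_h y x))
    + ereal (lift y) - (if feasible_dual y then 0 else \<infinity>)"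
proof -
  have nt: "area S *\<^sub>R normal_trace \<T> y S x = facet_flux y (bel S) S" if S: "S \<in> SD \<union> SN" and x: "x \<in> S" for S x
    unfolding normal_trace_def Let_def
    using boundary_side[OF S] elem_rt_facts(5)[OF _ Z_rt_elem[OF y]] x by blast
  have pos: "0 < area S" if "S \<in> SD \<union> SN" for S using side_pos boundary_side[OF that] by blast
  have "L2_sides SD (normal_trace \<T> y) (\<lambda>S. u\<^sub>D) = lift y"
    unfolding L2_sides_def lift_def
  proof (intro sum.cong refl)
    fix S assume S: "S \<in> SD"
    note b = boundary_side[OF UnI1[OF S]]
    have "(\<integral>x. indicator S x *\<^sub>R (normal_trace \<T> y S x \<bullet> u\<^sub>D x) \<partial>side_measure S) = area S *\<^sub>R (((1 / area S) *\<^sub>R facet_flux y (bel S) S) \<bullet> uS S)"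
    proof (rule side_integral_const_mesh[OF b(1,2)])
      fix x assume x: "x \<in> rel_interior S"
      then have "x \<in> S" using rel_interior_subset by blast
      then have "normal_trace \<T> y S x = (1 / area S) *\<^sub>R facet_flux y (bel S) S"
        using nt[OF UnI1[OF S], of x] pos[OF UnI1[OF S]] by (metis divideR_right less_irrefl inverse_eq_divide)
      then show "normal_trace \<T> y S x \<bullet> u\<^sub>D x = ((1 / area S) *\<^sub>R facet_flux y (bel S) S) \<bullet> uS S" using uS[OF S x] by simp
    qed
    then show "(\<integral>x. indicator S x *\<^sub>R (normal_trace \<T> y S x \<bullet> u\<^sub>D x) \<partial>side_measure S) = facet_flux y (bel S) S \<bullet> uS S"
      using pos[OF UnI1[OF S]] by simp
  qed
  moreover have "(\<forall>S\<in>SN. \<forall>x\<in>rel_interior S. normal_trace \<T> y S x = g x) \<longleftrightarrow> feasible_dual y"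
    unfolding feasible_dual_def
  proof (intro ball_cong refl)
    fix S assume S: "S \<in> SN"
    have ne: "rel_interior S \<noteq> {}" using side_rel_interior_nonempty S by (simp add: sides_in_def)
    have "normal_trace \<T> y S x = g x \<longleftrightarrow> facet_flux y (bel S) S = area S *\<^sub>R gS S" if x: "x \<in> rel_interior S" for x
    proof -
      have "x \<in> S" using x rel_interior_subset by blast
      then have "facet_flux y (bel S) S = area S *\<^sub>R normal_trace \<T> y S x" using nt[OF UnI2[OF S]] by simp
      then show ?thesis using pos[OF UnI2[OF S]] gS[OF S x] by simp
    qed
    then show "(\<forall>x\<in>rel_interior S. normal_trace \<T> y S x = g x) \<longleftrightarrow> facet_flux y (bel S) S = area S *\<^sub>R gS S" using ne by blast
  qed
  ultimately show ?thesis unfolding D_rt_def I_sides_def by simp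
qed

lemma primal_integrands:
  assumes v: "v \<in> U_cr \<T> \<Omega>" and T: "T \<in> \<T>" "x \<in> interior T"
  shows "\<phi> x (grad_h v x) = \<phi> (bc T) (grad_h v (bc T))" "\<psi> x (Pi_h \<T> v x) = \<psi> (bc T) (v (bc T))"
  using elem_affine_facts(3,4)[OF T(1) U_cr_elem[OF v T(1)] T(2)] phi_elem[OF T] psi_elem[OF T] by simp_all

lemma dual_integrands:
  assumes y: "y \<in> Z_rt \<T> \<Omega>" and T: "T \<in> \<T>" "x \<in> interior T"
  shows "fenchel (\<phi> x) (Pi_h \<T> y x) = fenchel (\<phi> (bc T)) (y (bc T))" "fenchel (\<psi> x) (div_h y x) = fenchel (\<psi> (bc T)) (div_h y (bc T))"
  using elem_rt_facts(3,4)[OF T(1) Z_rt_elem[OF y T(1)] T(2)] phi_elem[OF T] psi_elem[OF T] by simp_all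

lemma primal_finite:
  assumes v: "v \<in> U_cr \<T> \<Omega>" "feasible_primal v"
    and pq: "\<And>T. T \<in> \<T> \<Longrightarrow> \<phi> (bc T) (grad_h v (bc T)) = ereal (p T)" "\<And>T. T \<in> \<T> \<Longrightarrow> \<psi> (bc T) (v (bc T)) = ereal (q T)"
  shows "primal v = ereal ((\<Sum>T\<in>\<T>. vol T * (p T + q T)) - load v)"
proof -
  have "eintegral (lebesgue_on \<Omega>) (\<lambda>x. \<phi> x (grad_h v x)) = ereal (\<Sum>T\<in>\<T>. vol T * p T)"
    "eintegral (lebesgue_on \<Omega>) (\<lambda>x. \<psi> x (Pi_h \<T> v x)) = ereal (\<Sum>T\<in>\<T>. vol T * q T)"
    using primal_integrands[OF v(1)] pq by (auto intro!: eintegral_elementwise)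
  then show ?thesis unfolding primal_eq[OF v(1)] using v(2) by (simp add: sum.distrib distrib_left)
qed

lemma dual_finite:
  assumes y: "y \<in> Z_rt \<T> \<Omega>" "feasible_dual y"
    and pq: "\<And>T. T \<in> \<T> \<Longrightarrow> fenchel (\<phi> (bc T)) (y (bc T)) = ereal (p T)" "\<And>T. T \<in> \<T> \<Longrightarrow> fenchel (\<psi> (bc T)) (div_h y (bc T)) = ereal (q T)"
  shows "dual y = ereal (lift y - (\<Sum>T\<in>\<T>. vol T * (p T + q T)))"
proof -
  have "eintegral (lebesgue_on \<Omega>) (\<lambda>x. fenchel (\<phi> x) (Pi_h \<T> y x)) = ereal (\<Sum>T\<in>\<T>. vol T * p T)"
    "eintegral (lebesgue_on \<Omega>) (\<lambda>x. fenchel (\<psi> x) (div_h y x)) = ereal (\<Sum>T\<in>\<T>. vol T * q T)"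
    using dual_integrands[OF y(1)] pq by (auto intro!: eintegral_elementwise)
  then show ?thesis unfolding dual_eq[OF y(1)] using y(2) by (simp add: sum.distrib distrib_left)
qed

lemma eintegral_not_MInf:
  assumes f: "\<And>T x. T \<in> \<T> \<Longrightarrow> x \<in> interior T \<Longrightarrow> f x = c T" and c: "\<And>T. T \<in> \<T> \<Longrightarrow> c T \<noteq> -\<infinity>"
  shows "eintegral (lebesgue_on \<Omega>) f \<noteq> -\<infinity>"
proof (cases "\<exists>T\<in>\<T>. c T = \<infinity>")
  case True
  then obtain T where "T \<in> \<T>" "c T = \<infinity>" by blast
  then show ?thesis using eintegral_elementwise_PInf[of f c T] f c by simp
next
  case False
  then have "c T = ereal (real_of_ereal (c T))" if "T \<in> \<T>" for T using c[OF that] that by (cases "c T") auto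
  then have "f x = ereal (real_of_ereal (c T))" if "T \<in> \<T>" "x \<in> interior T" for T x using f that by metis
  from eintegral_elementwise[of f "\<lambda>T. real_of_ereal (c T)", OF this] show ?thesis by simp
qed

lemma primal_PInf:
  assumes v: "v \<in> U_cr \<T> \<Omega>"
    and inf: "\<not> feasible_primal v \<or> (\<exists>T\<in>\<T>. \<phi> (bc T) (grad_h v (bc T)) = \<infinity> \<or> \<psi> (bc T) (v (bc T)) = \<infinity>)"
  shows "primal v = \<infinity>"
proof -
  let ?a = "eintegral (lebesgue_on \<Omega>) (\<lambda>x. \<phi> x (grad_h v x))" and ?b = "eintegral (lebesgue_on \<Omega>) (\<lambda>x. \<psi> x (Pi_h \<T> v x))"
  have a: "?a \<noteq> -\<infinity>"
    by (rule eintegral_not_MInf[where c = "\<lambda>T. \<phi> (bc T) (grad_h v (bc T))"]) (use primal_integrands[OF v] not_MInf in auto)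
  have b: "?b \<noteq> -\<infinity>"
    by (rule eintegral_not_MInf[where c = "\<lambda>T. \<psi> (bc T) (v (bc T))"]) (use primal_integrands[OF v] not_MInf in auto)
  have "\<not> feasible_primal v \<or> ?a = \<infinity> \<or> ?b = \<infinity>"
    using inf eintegral_elementwise_PInf[where f = "\<lambda>x. \<phi> x (grad_h v x)" and c = "\<lambda>T. \<phi> (bc T) (grad_h v (bc T))"]
      eintegral_elementwise_PInf[where f = "\<lambda>x. \<psi> x (Pi_h \<T> v x)" and c = "\<lambda>T. \<psi> (bc T) (v (bc T))"]
      primal_integrands[OF v] not_MInf by blast
  then show ?thesis unfolding primal_eq[OF v] using a b by (cases ?a; cases ?b) auto
qed

lemma dual_MInf:
  assumes y: "y \<in> Z_rt \<T> \<Omega>"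
    and inf: "\<not> feasible_dual y \<or> (\<exists>T\<in>\<T>. fenchel (\<phi> (bc T)) (y (bc T)) = \<infinity> \<or> fenchel (\<psi> (bc T)) (div_h y (bc T)) = \<infinity>)"
  shows "dual y = -\<infinity>"
proof -
  let ?a = "eintegral (lebesgue_on \<Omega>) (\<lambda>x. fenchel (\<phi> x) (Pi_h \<T> y x))" and ?b = "eintegral (lebesgue_on \<Omega>) (\<lambda>x. fenchel (\<psi> x) (div_h y x))"
  have a: "?a \<noteq> -\<infinity>"
    by (rule eintegral_not_MInf[where c = "\<lambda>T. fenchel (\<phi> (bc T)) (y (bc T))"]) (use dual_integrands[OF y] not_MInf in auto)
  have b: "?b \<noteq> -\<infinity>"
    by (rule eintegral_not_MInf[where c = "\<lambda>T. fenchel (\<psi> (bc T)) (div_h y (bc T))"]) (use dual_integrands[OF y] not_MInf in auto)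
  have "\<not> feasible_dual y \<or> ?a = \<infinity> \<or> ?b = \<infinity>"
    using inf eintegral_elementwise_PInf[where f = "\<lambda>x. fenchel (\<phi> x) (Pi_h \<T> y x)" and c = "\<lambda>T. fenchel (\<phi> (bc T)) (y (bc T))"]
      eintegral_elementwise_PInf[where f = "\<lambda>x. fenchel (\<psi> x) (div_h y x)" and c = "\<lambda>T. fenchel (\<psi> (bc T)) (div_h y (bc T))"]
      dual_integrands[OF y] not_MInf by blast
  then show ?thesis unfolding dual_eq[OF y] using a b by (cases ?a; cases ?b) auto
qed

text \<open>The side means on the Dirichlet part and the fluxes on the Neumann part are the prescribed data,
  so the boundary terms become the linear terms of the two functionals.\<close>

lemma integration_by_parts_feasible:
  assumes v: "v \<in> U_cr \<T> \<Omega>" "feasible_primal v" and y: "y \<in> Z_rt \<T> \<Omega>" "feasible_dual y"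
  shows "(\<Sum>T\<in>\<T>. vol T * (grad_h v (bc T) \<bullet> y (bc T) + v (bc T) \<bullet> div_h y (bc T))) = lift y + load v"
proof -
  have "(\<Sum>T\<in>\<T>. vol T * (grad_h v (bc T) \<bullet> y (bc T) + v (bc T) \<bullet> div_h y (bc T)))
    = (\<Sum>S\<in>SD. facet_val v (bel S) S \<bullet> facet_flux y (bel S) S) + (\<Sum>S\<in>SN. facet_val v (bel S) S \<bullet> facet_flux y (bel S) S)"
    unfolding integration_by_parts[OF v(1) y(1)] boundary_union
    by (rule sum.union_disjoint[OF finite_SD finite_SN boundary_disjoint])
  also have "(\<Sum>S\<in>SD. facet_val v (bel S) S \<bullet> facet_flux y (bel S) S) = lift y"
    unfolding lift_def using v(2) by (intro sum.cong) (auto simp: feasible_primal_def inner_commute)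
  also have "(\<Sum>S\<in>SN. facet_val v (bel S) S \<bullet> facet_flux y (bel S) S) = load v"
    unfolding load_def using y(2) by (intro sum.cong) (auto simp: feasible_dual_def inner_commute)
  finally show ?thesis .
qed

text \<open>Young's inequality on each element, summed up by means of the discrete integration by parts.  If one
  of the functionals is infinite, the claim is immediate.\<close>

lemma weak_duality:
  assumes v: "v \<in> U_cr \<T> \<Omega>" and y: "y \<in> Z_rt \<T> \<Omega>"
  shows "dual y \<le> primal v"
proof (cases "primal v = \<infinity> \<or> dual y = -\<infinity>")
  case False
  then have fv: "feasible_primal v" and fy: "feasible_dual y" using primal_PInf[OF v] dual_MInf[OF y] by blast+
  define p where "p = (\<lambda>T. real_of_ereal (\<phi> (bc T) (grad_h v (bc T))))"
  define q where "q = (\<lambda>T. real_of_ereal (\<psi> (bc T) (v (bc T))))"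
  define p' where "p' = (\<lambda>T. real_of_ereal (fenchel (\<phi> (bc T)) (y (bc T))))"
  define q' where "q' = (\<lambda>T. real_of_ereal (fenchel (\<psi> (bc T)) (div_h y (bc T))))"
  have real: "x \<noteq> \<infinity> \<Longrightarrow> x \<noteq> -\<infinity> \<Longrightarrow> x = ereal (real_of_ereal x)" for x :: ereal by (cases x) auto
  have fin: "\<phi> (bc T) (grad_h v (bc T)) = ereal (p T)" "\<psi> (bc T) (v (bc T)) = ereal (q T)"
    "fenchel (\<phi> (bc T)) (y (bc T)) = ereal (p' T)" "fenchel (\<psi> (bc T)) (div_h y (bc T)) = ereal (q' T)"
    if T: "T \<in> \<T>" for T
  proof -
    have n: "\<phi> (bc T) (grad_h v (bc T)) \<noteq> \<infinity>" "\<psi> (bc T) (v (bc T)) \<noteq> \<infinity>"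
      "fenchel (\<phi> (bc T)) (y (bc T)) \<noteq> \<infinity>" "fenchel (\<psi> (bc T)) (div_h y (bc T)) \<noteq> \<infinity>"
      using False primal_PInf[OF v] dual_MInf[OF y] T by blast+
    show "\<phi> (bc T) (grad_h v (bc T)) = ereal (p T)" "\<psi> (bc T) (v (bc T)) = ereal (q T)"
      "fenchel (\<phi> (bc T)) (y (bc T)) = ereal (p' T)" "fenchel (\<psi> (bc T)) (div_h y (bc T)) = ereal (q' T)"
      unfolding p_def q_def p'_def q'_def by (rule real n not_MInf[OF T])+
  qed
  have "lift y + load v \<le> (\<Sum>T\<in>\<T>. vol T * ((p T + p' T) + (q T + q' T)))"
    unfolding integration_by_parts_feasible[OF v fv y fy, symmetric]
  proof (intro sum_mono mult_left_mono add_mono)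
    fix T assume T: "T \<in> \<T>"
    show "grad_h v (bc T) \<bullet> y (bc T) \<le> p T + p' T"
      using fenchel_young[OF phi_proper[OF T], of "y (bc T)" "grad_h v (bc T)"] by (simp add: fin T inner_commute)
    show "v (bc T) \<bullet> div_h y (bc T) \<le> q T + q' T"
      using fenchel_young[OF psi_proper[OF T], of "div_h y (bc T)" "v (bc T)"] by (simp add: fin T inner_commute)
  qed simp
  also have "\<dots> = (\<Sum>T\<in>\<T>. vol T * (p T + q T)) + (\<Sum>T\<in>\<T>. vol T * (p' T + q' T))"
    unfolding sum.distrib[symmetric] by (intro sum.cong refl) (simp add: algebra_simps)
  finally have le: "lift y + load v \<le> (\<Sum>T\<in>\<T>. vol T * (p T + q T)) + (\<Sum>T\<in>\<T>. vol T * (p' T + q' T))" .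
  have "primal v = ereal ((\<Sum>T\<in>\<T>. vol T * (p T + q T)) - load v)"
    by (rule primal_finite[OF v fv]) (simp_all add: fin)
  moreover have "dual y = ereal (lift y - (\<Sum>T\<in>\<T>. vol T * (p' T + q' T)))"
    by (rule dual_finite[OF y fy]) (simp_all add: fin)
  ultimately show ?thesis using le by simp
qed auto

text \<open>With equality in Young's inequality on each element, the proof of weak duality gives an equality;
  weak duality then turns it into optimality of both functions.\<close>

lemma strong_duality:
  assumes u: "u \<in> U_cr \<T> \<Omega>" "feasible_primal u" and z: "z \<in> Z_rt \<T> \<Omega>" "feasible_dual z"
    and phi: "\<And>T. T \<in> \<T> \<Longrightarrow> \<phi> (bc T) (grad_h u (bc T)) + fenchel (\<phi> (bc T)) (z (bc T)) = ereal (grad_h u (bc T) \<bullet> z (bc T))"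
    and psi: "\<And>T. T \<in> \<T> \<Longrightarrow> \<psi> (bc T) (u (bc T)) + fenchel (\<psi> (bc T)) (div_h z (bc T)) = ereal (u (bc T) \<bullet> div_h z (bc T))"
  shows "primal u = dual z" "is_arg_min primal (\<lambda>v. v \<in> U_cr \<T> \<Omega>) u" "is_arg_max dual (\<lambda>y. y \<in> Z_rt \<T> \<Omega>) z"
proof -
  define p where "p = (\<lambda>T. real_of_ereal (\<phi> (bc T) (grad_h u (bc T))))"
  define q where "q = (\<lambda>T. real_of_ereal (\<psi> (bc T) (u (bc T))))"
  have fin: "\<phi> (bc T) (grad_h u (bc T)) = ereal (p T)" "\<psi> (bc T) (u (bc T)) = ereal (q T)"
    "fenchel (\<phi> (bc T)) (z (bc T)) = ereal (grad_h u (bc T) \<bullet> z (bc T) - p T)"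
    "fenchel (\<psi> (bc T)) (div_h z (bc T)) = ereal (u (bc T) \<bullet> div_h z (bc T) - q T)"
    if T: "T \<in> \<T>" for T
  proof -
    show "\<phi> (bc T) (grad_h u (bc T)) = ereal (p T)" "fenchel (\<phi> (bc T)) (z (bc T)) = ereal (grad_h u (bc T) \<bullet> z (bc T) - p T)"
      using phi[OF T] not_MInf[OF T] unfolding p_def
      by (cases "\<phi> (bc T) (grad_h u (bc T))"; cases "fenchel (\<phi> (bc T)) (z (bc T))"; auto)+
    show "\<psi> (bc T) (u (bc T)) = ereal (q T)" "fenchel (\<psi> (bc T)) (div_h z (bc T)) = ereal (u (bc T) \<bullet> div_h z (bc T) - q T)"
      using psi[OF T] not_MInf[OF T] unfolding q_def
      by (cases "\<psi> (bc T) (u (bc T))"; cases "fenchel (\<psi> (bc T)) (div_h z (bc T))"; auto)+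
  qed
  have "(\<Sum>T\<in>\<T>. vol T * (p T + q T)) + (\<Sum>T\<in>\<T>. vol T * ((grad_h u (bc T) \<bullet> z (bc T) - p T) + (u (bc T) \<bullet> div_h z (bc T) - q T)))
    = (\<Sum>T\<in>\<T>. vol T * (grad_h u (bc T) \<bullet> z (bc T) + u (bc T) \<bullet> div_h z (bc T)))"
    unfolding sum.distrib[symmetric] by (intro sum.cong refl) (simp add: algebra_simps)
  moreover have "primal u = ereal ((\<Sum>T\<in>\<T>. vol T * (p T + q T)) - load u)"
    by (rule primal_finite[OF u]) (simp_all add: fin)
  moreover have "dual z = ereal (lift z - (\<Sum>T\<in>\<T>. vol T * ((grad_h u (bc T) \<bullet> z (bc T) - p T) + (u (bc T) \<bullet> div_h z (bc T) - q T))))"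
    by (rule dual_finite[OF z]) (simp_all add: fin)
  ultimately show eq: "primal u = dual z"
    unfolding integration_by_parts_feasible[OF u z] by simp
  show "is_arg_min primal (\<lambda>v. v \<in> U_cr \<T> \<Omega>) u"
    unfolding is_arg_min_def using u(1) weak_duality[OF _ z(1)] eq by (auto simp: not_less)
  show "is_arg_max dual (\<lambda>y. y \<in> Z_rt \<T> \<Omega>) z"
    unfolding is_arg_max_def using z(1) weak_duality[OF u(1)] eq by (auto simp: not_less)
qed

end

section \<open>Optimality conditions and reconstruction\<close>

context fe_problem
begin

text \<open>The terms of a single side are selected by test functions that vanish on all other sides.\<close>

lemma sum_sides_test:
  fixes h :: "(real^'d) set \<Rightarrow> (real^'d) set \<Rightarrow> real"
  assumes S0: "S0 \<in> sides \<T>" and h: "\<And>S T. S \<noteq> S0 \<Longrightarrow> h T S = 0"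
  shows "(\<Sum>T\<in>\<T>. \<Sum>S | S facet_of T. h T S) = (\<Sum>T\<in>elems S0. h T S0)"
proof -
  have "(\<Sum>T\<in>\<T>. \<Sum>S | S facet_of T. h T S) = (\<Sum>S\<in>sides \<T>. \<Sum>T\<in>elems S. h T S)" by (rule sum_elements_sides)
  also have "\<dots> = (\<Sum>S\<in>sides \<T>. if S = S0 then \<Sum>T\<in>elems S0. h T S0 else 0)"
    by (intro sum.cong refl) (auto simp: h)
  finally show ?thesis using S0 finite_sides by simp
qed

text \<open>The densities are finite, so the function whose side means are the Dirichlet data has finite energy.\<close>

lemma minimizer_feasible:
  assumes C: "\<And>T. T \<in> \<T> \<Longrightarrow> C1 (\<phi> (bc T))" "\<And>T. T \<in> \<T> \<Longrightarrow> C1 (\<psi> (bc T))"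
    and u: "is_arg_min primal (\<lambda>v. v \<in> U_cr \<T> \<Omega>) u"
  shows "feasible_primal u"
proof (rule ccontr)
  assume n: "\<not> feasible_primal u"
  have uU: "u \<in> U_cr \<T> \<Omega>" using u by (simp add: is_arg_min_def)
  \<comment> \<open>On sides that are not Dirichlet sides the means of \<open>?v\<close> are arbitrary vectors.\<close>
  let ?v = "cr_fun uS"
  have v: "?v \<in> U_cr \<T> \<Omega>" by (rule cr_fun_U)
  have fv: "feasible_primal ?v" unfolding feasible_primal_def using cr_fun_elem(2) boundary_side by blast
  have "primal ?v < \<infinity>"
    using primal_finite[OF v fv C1_finite[OF C(1)] C1_finite[OF C(2)]] by simp
  moreover have "primal u = \<infinity>" using primal_PInf[OF uU] n by blast
  ultimately show False using u v by (auto simp: is_arg_min_def)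
qed

lemma maximizer_feasible:
  assumes C: "\<And>T. T \<in> \<T> \<Longrightarrow> C1 (fenchel (\<phi> (bc T)))" "\<And>T. T \<in> \<T> \<Longrightarrow> C1 (fenchel (\<psi> (bc T)))"
    and z: "is_arg_max dual (\<lambda>y. y \<in> Z_rt \<T> \<Omega>) z"
  shows "feasible_dual z"
proof (rule ccontr)
  assume n: "\<not> feasible_dual z"
  have zZ: "z \<in> Z_rt \<T> \<Omega>" using z by (simp add: is_arg_max_def)
  let ?f = "\<lambda>T S. if S \<in> SN then area S *\<^sub>R gS S else 0"
  let ?y = "rt_fun ?f"
  have y: "?y \<in> Z_rt \<T> \<Omega>" using boundary_side(5) by (intro rt_fun_Z) auto
  have fy: "feasible_dual ?y" unfolding feasible_dual_def using rt_fun_elem(2)[of _ _ ?f] boundary_side by simp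
  have "-\<infinity> < dual ?y"
    using dual_finite[OF y fy C1_finite[OF C(1)] C1_finite[OF C(2)]] by simp
  moreover have "dual z = -\<infinity>" using dual_MInf[OF zZ] n by blast
  ultimately show False using z y by (auto simp: is_arg_max_def)
qed

text \<open>The variations keep the Dirichlet data because \<open>a\<close> vanishes on Dirichlet sides.\<close>

lemma primal_optimality:
  assumes C: "\<And>T. T \<in> \<T> \<Longrightarrow> C1 (\<phi> (bc T))" "\<And>T. T \<in> \<T> \<Longrightarrow> C1 (\<psi> (bc T))"
    and u: "is_arg_min primal (\<lambda>v. v \<in> U_cr \<T> \<Omega>) u"
    and a: "\<And>S. S \<in> SD \<Longrightarrow> a S = 0"
  shows "(\<Sum>T\<in>\<T>. vol T * (grad_h (cr_fun a) (bc T) \<bullet> gradient (\<phi> (bc T)) (grad_h u (bc T))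
      + cr_fun a (bc T) \<bullet> gradient (\<psi> (bc T)) (u (bc T)))) = (\<Sum>S\<in>SN. area S * (gS S \<bullet> a S))"
proof (rule derivative_zero_at_minimum[where p = "\<lambda>T. \<phi> (bc T)" and q = "\<lambda>T. \<psi> (bc T)" and K = "load u", OF C])
  fix t
  let ?v = "cr_fun a"
  let ?w = "\<lambda>x. u x + t *\<^sub>R ?v x"
  let ?E = "(\<Sum>T\<in>\<T>. vol T * (real_of_ereal (\<phi> (bc T) (grad_h u (bc T))) + real_of_ereal (\<psi> (bc T) (u (bc T)))))"
  let ?E' = "(\<Sum>T\<in>\<T>. vol T * (real_of_ereal (\<phi> (bc T) (grad_h u (bc T) + t *\<^sub>R grad_h ?v (bc T))) + real_of_ereal (\<psi> (bc T) (u (bc T) + t *\<^sub>R ?v (bc T)))))"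
  have uU: "u \<in> U_cr \<T> \<Omega>" using u by (simp add: is_arg_min_def)
  have fu: "feasible_primal u" by (rule minimizer_feasible[OF C u])
  note vU = cr_fun_U[of a]
  note comb = elem_affine_combination[OF _ U_cr_elem[OF uU] U_cr_elem[OF vU], of _ t]
  have fva: "facet_val ?v (bel S) S = a S" if "S \<in> SD \<union> SN" for S
    using cr_fun_elem(2) boundary_side(1,2)[OF that] by blast
  have wU: "?w \<in> U_cr \<T> \<Omega>" unfolding U_cr_iff
  proof (intro conjI ballI impI)
    fix S T T' assume A: "S \<in> sides_in \<T> \<Omega>" "T \<in> \<T>" "T' \<in> \<T>" "T \<noteq> T' \<and> S facet_of T \<and> S facet_of T'"
    have "facet_val u T S = facet_val u T' S" "facet_val ?v T S = facet_val ?v T' S"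
      using U_cr_jump[OF uU A(1-3)] U_cr_jump[OF vU A(1-3)] A(4) by blast+
    then show "facet_val ?w T S = facet_val ?w T' S" by (simp only: comb(3)[OF A(2) A(2) A(2)] comb(3)[OF A(3) A(3) A(3)])
  qed (use comb(1) in blast)
  have fw: "feasible_primal ?w"
    unfolding feasible_primal_def
  proof
    fix S assume S: "S \<in> SD"
    note b = boundary_side(1)[OF UnI1[OF S]]
    show "facet_val ?w (bel S) S = uS S"
      unfolding comb(3)[OF b b b] using fu S fva[OF UnI1[OF S]] a[OF S] by (simp add: feasible_primal_def)
  qed
  have load: "load ?w = load u + t * (\<Sum>S\<in>SN. area S * (gS S \<bullet> a S))"
    unfolding load_def sum_distrib_left sum.distrib[symmetric]
  proof (intro sum.cong refl)
    fix S assume S: "S \<in> SN"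
    note b = boundary_side(1)[OF UnI2[OF S]]
    show "area S * (gS S \<bullet> facet_val ?w (bel S) S) = area S * (gS S \<bullet> facet_val u (bel S) S) + t * (area S * (gS S \<bullet> a S))"
      unfolding comb(3)[OF b b b] using fva[OF UnI2[OF S]] by (simp add: inner_add_right algebra_simps)
  qed
  have pu: "primal u = ereal (?E - load u)"
    by (rule primal_finite[OF uU fu]) (auto intro: C1_finite C)
  have pw: "primal ?w = ereal (?E' - load ?w)"
  proof (rule primal_finite[OF wU fw])
    fix T assume T: "T \<in> \<T>"
    show "\<phi> (bc T) (grad_h ?w (bc T)) = ereal (real_of_ereal (\<phi> (bc T) (grad_h u (bc T) + t *\<^sub>R grad_h ?v (bc T))))"
      unfolding comb(2)[OF T T T] by (rule C1_finite[OF C(1)[OF T]])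
  qed (rule C1_finite[OF C(2)])
  have "primal u \<le> primal ?w" using u wU by (auto simp: is_arg_min_def not_less)
  then show "?E - load u
    \<le> ?E'
      - (load u + t * (\<Sum>S\<in>SN. area S * (gS S \<bullet> a S)))"
    unfolding pu pw load by simp
qed

text \<open>The variations keep the Neumann data because \<open>f\<close> vanishes on Neumann sides.\<close>

lemma dual_optimality:
  assumes C: "\<And>T. T \<in> \<T> \<Longrightarrow> C1 (fenchel (\<phi> (bc T)))" "\<And>T. T \<in> \<T> \<Longrightarrow> C1 (fenchel (\<psi> (bc T)))"
    and z: "is_arg_max dual (\<lambda>y. y \<in> Z_rt \<T> \<Omega>) z"
    and f: "\<And>S T. S \<in> SN \<Longrightarrow> f T S = 0"
    and anti: "\<And>S T T'. S \<in> sides_in \<T> \<Omega> \<Longrightarrow> T \<in> \<T> \<Longrightarrow> T' \<in> \<T> \<Longrightarrow> T \<noteq> T' \<Longrightarrow> S facet_of T \<Longrightarrow> S facet_of T' \<Longrightarrow> f T S + f T' S = 0"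
  shows "(\<Sum>T\<in>\<T>. vol T * (rt_fun f (bc T) \<bullet> gradient (fenchel (\<phi> (bc T))) (z (bc T))
      + div_h (rt_fun f) (bc T) \<bullet> gradient (fenchel (\<psi> (bc T))) (div_h z (bc T)))) = (\<Sum>S\<in>SD. f (bel S) S \<bullet> uS S)"
proof (rule derivative_zero_at_minimum[where p = "\<lambda>T. fenchel (\<phi> (bc T))" and q = "\<lambda>T. fenchel (\<psi> (bc T))" and K = "lift z", OF C])
  fix t
  let ?y = "rt_fun f"
  let ?w = "\<lambda>x. z x + t *\<^sub>R ?y x"
  let ?E = "(\<Sum>T\<in>\<T>. vol T * (real_of_ereal (fenchel (\<phi> (bc T)) (z (bc T))) + real_of_ereal (fenchel (\<psi> (bc T)) (div_h z (bc T)))))"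
  let ?E' = "(\<Sum>T\<in>\<T>. vol T * (real_of_ereal (fenchel (\<phi> (bc T)) (z (bc T) + t *\<^sub>R ?y (bc T))) + real_of_ereal (fenchel (\<psi> (bc T)) (div_h z (bc T) + t *\<^sub>R div_h ?y (bc T)))))"
  have zZ: "z \<in> Z_rt \<T> \<Omega>" using z by (simp add: is_arg_max_def)
  have fz: "feasible_dual z" by (rule maximizer_feasible[OF C z])
  have yZ: "?y \<in> Z_rt \<T> \<Omega>" by (rule rt_fun_Z[OF anti])
  note comb = elem_rt_combination[OF _ Z_rt_elem[OF zZ] Z_rt_elem[OF yZ], of _ t]
  have ff: "facet_flux ?y (bel S) S = f (bel S) S" if "S \<in> SD \<union> SN" for S
    using rt_fun_elem(2) boundary_side(1,2)[OF that] by blast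
  have wZ: "?w \<in> Z_rt \<T> \<Omega>" unfolding Z_rt_iff
  proof (intro conjI ballI impI)
    fix S T T' assume A: "S \<in> sides_in \<T> \<Omega>" "T \<in> \<T>" "T' \<in> \<T>" "T \<noteq> T' \<and> S facet_of T \<and> S facet_of T'"
    have "facet_flux z T S + facet_flux z T' S = 0" "facet_flux ?y T S + facet_flux ?y T' S = 0"
      using Z_rt_jump[OF zZ A(1-3)] Z_rt_jump[OF yZ A(1-3)] A(4) by blast+
    moreover have "facet_flux ?w T S + facet_flux ?w T' S
        = (facet_flux z T S + facet_flux z T' S) + t *\<^sub>R (facet_flux ?y T S + facet_flux ?y T' S)"
      by (simp only: comb(3)[OF A(2) A(2) A(2)] comb(3)[OF A(3) A(3) A(3)] scaleR_add_right add.assoc add.left_commute)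
    ultimately show "facet_flux ?w T S + facet_flux ?w T' S = 0" by simp
  qed (use comb(1) in blast)
  have fw: "feasible_dual ?w"
    unfolding feasible_dual_def
  proof
    fix S assume S: "S \<in> SN"
    note b = boundary_side(1)[OF UnI2[OF S]]
    show "facet_flux ?w (bel S) S = area S *\<^sub>R gS S"
      unfolding comb(3)[OF b b b] using fz S ff[OF UnI2[OF S]] f[OF S] by (simp add: feasible_dual_def)
  qed
  have lift: "lift ?w = lift z + t * (\<Sum>S\<in>SD. f (bel S) S \<bullet> uS S)"
    unfolding lift_def sum_distrib_left sum.distrib[symmetric]
  proof (intro sum.cong refl)
    fix S assume S: "S \<in> SD"
    note b = boundary_side(1)[OF UnI1[OF S]]
    show "facet_flux ?w (bel S) S \<bullet> uS S = facet_flux z (bel S) S \<bullet> uS S + t * (f (bel S) S \<bullet> uS S)"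
      unfolding comb(3)[OF b b b] using ff[OF UnI1[OF S]] by (simp add: inner_add_left)
  qed
  have pz: "dual z = ereal (lift z - ?E)"
    by (rule dual_finite[OF zZ fz]) (auto intro: C1_finite C)
  have pw: "dual ?w = ereal (lift ?w - ?E')"
  proof (rule dual_finite[OF wZ fw])
    fix T assume T: "T \<in> \<T>"
    show "fenchel (\<psi> (bc T)) (div_h ?w (bc T)) = ereal (real_of_ereal (fenchel (\<psi> (bc T)) (div_h z (bc T) + t *\<^sub>R div_h ?y (bc T))))"
      unfolding comb(2)[OF T T T] by (rule C1_finite[OF C(2)[OF T]])
  qed (rule C1_finite[OF C(1)])
  have "dual ?w \<le> dual z" using z wZ by (auto simp: is_arg_max_def not_less)
  then show "?E - lift z
    \<le> ?E'
      - (lift z + t * (\<Sum>S\<in>SD. f (bel S) S \<bullet> uS S))"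
    unfolding pz pw lift by simp
qed

lemma Pi_h_id: "T \<in> \<T> \<Longrightarrow> x \<in> interior T \<Longrightarrow> Pi_h \<T> (\<lambda>x. x) x = bc T"
  using Pi_h_affine[of T x "\<lambda>x. x" "\<lambda>x. x" 0] by (simp add: linear_id[unfolded id_def])

text \<open>In \<open>test\<close> the optimality condition for the side mean basis function of one side \<open>S0\<close> is rewritten
  by the Gauss formula on each element: it says that the fluxes of \<open>z\<close> out of the elements at \<open>S0\<close> add
  up to the load on \<open>S0\<close>.  For an interior side this is the jump condition, for a Neumann side the
  boundary condition.\<close>

lemma dual_reconstruction:
  assumes C: "\<And>T. T \<in> \<T> \<Longrightarrow> C1 (\<phi> (bc T))" "\<And>T. T \<in> \<T> \<Longrightarrow> C1 (\<psi> (bc T))"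
    and u: "is_arg_min primal (\<lambda>v. v \<in> U_cr \<T> \<Omega>) u"
  defines "z \<equiv> \<lambda>x. gradient (\<phi> x) (grad_h u x) + ((1 / real CARD('d)) *\<^sub>R gradient (\<psi> x) (Pi_h \<T> u x)) \<otimes>\<^sub>t (x - Pi_h \<T> (\<lambda>x. x) x)"
  shows "is_arg_max dual (\<lambda>y. y \<in> Z_rt \<T> \<Omega>) z" "primal u = dual z"
proof -
  have uU: "u \<in> U_cr \<T> \<Omega>" using u by (simp add: is_arg_min_def)
  have fu: "feasible_primal u" by (rule minimizer_feasible[OF C u])
  define P where "P = (\<lambda>T. gradient (\<phi> (bc T)) (grad_h u (bc T)))"
  define Q where "Q = (\<lambda>T. gradient (\<psi> (bc T)) (u (bc T)))"
  have z: "z x = (P T - ((1 / real CARD('d)) *\<^sub>R Q T) \<otimes>\<^sub>t bc T) + ((1 / real CARD('d)) *\<^sub>R Q T) \<otimes>\<^sub>t x"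
    if T: "T \<in> \<T>" "x \<in> interior T" for T x
    unfolding z_def P_def Q_def using elem_affine_facts(3,4)[OF T(1) U_cr_elem[OF uU T(1)] T(2)] phi_elem[OF T] psi_elem[OF T] Pi_h_id[OF T]
    by (simp add: tensor_simps)
  have E: "elem_rt T z" if "T \<in> \<T>" for T unfolding elem_rt_def using z[OF that] by blast
  have zb: "z (bc T) = P T" if "T \<in> \<T>" for T using z[OF that elem_simps(4)[OF that]] by simp
  have zd: "div_h z (bc T) = Q T" if "T \<in> \<T>" for T using div_h_affine[OF elem_simps(4)[OF that] z[OF that]] by simp
  have test: "w \<bullet> (\<Sum>T\<in>elems S0. facet_flux z T S0) = (if S0 \<in> SN then area S0 * (gS S0 \<bullet> w) else 0)"
    if S0: "S0 \<in> sides \<T>" "S0 \<notin> SD" for S0 w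
  proof -
    define a where "a = (\<lambda>S. if S = S0 then w else 0)"
    have a: "a S = 0" if "S \<in> SD" for S using that S0(2) by (auto simp: a_def)
    have "(\<Sum>T\<in>\<T>. \<Sum>S | S facet_of T. a S \<bullet> facet_flux z T S) = (\<Sum>T\<in>elems S0. a S0 \<bullet> facet_flux z T S0)"
      by (rule sum_sides_test[OF S0(1)]) (simp add: a_def)
    also have "\<dots> = w \<bullet> (\<Sum>T\<in>elems S0. facet_flux z T S0)" by (simp add: a_def inner_sum_right)
    finally have "w \<bullet> (\<Sum>T\<in>elems S0. facet_flux z T S0) = (\<Sum>T\<in>\<T>. \<Sum>S | S facet_of T. a S \<bullet> facet_flux z T S)" ..
    also have "\<dots> = (\<Sum>T\<in>\<T>. \<Sum>S | S facet_of T. facet_val (cr_fun a) T S \<bullet> facet_flux z T S)"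
      by (intro sum.cong refl) (simp add: cr_fun_elem(2))
    also have "\<dots> = (\<Sum>T\<in>\<T>. vol T * (grad_h (cr_fun a) (bc T) \<bullet> P T + cr_fun a (bc T) \<bullet> Q T))"
      by (intro sum.cong refl) (simp add: integration_by_parts_elem zb zd)
    also have "\<dots> = (\<Sum>S\<in>SN. area S * (gS S \<bullet> a S))"
      unfolding P_def Q_def by (rule primal_optimality[OF C u a])
    also have "\<dots> = (\<Sum>S\<in>SN. if S = S0 then area S0 * (gS S0 \<bullet> w) else 0)"
      by (intro sum.cong refl) (simp add: a_def)
    also have "\<dots> = (if S0 \<in> SN then area S0 * (gS S0 \<bullet> w) else 0)" using finite_SN by simp
    finally show ?thesis .
  qed
  have "z \<in> Z_rt \<T> \<Omega>" unfolding Z_rt_iff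
  proof (intro conjI ballI impI)
    fix S T T' assume A: "S \<in> sides_in \<T> \<Omega>" "T \<in> \<T>" "T' \<in> \<T>" "T \<noteq> T' \<and> S facet_of T \<and> S facet_of T'"
    have S: "S \<in> sides \<T>" "S \<notin> SD" "S \<notin> SN" using A(1) boundary_side(5) by (auto simp: sides_in_def)
    have "elems S = {T, T'}"
    proof -
      have m: "T \<in> elems S" "T' \<in> elems S" using A by (auto simp: elems_def)
      have "T'' = T \<or> T'' = T'" if "T'' \<in> elems S" for T'' using at_most_two[OF m that] A(4) by blast
      then show ?thesis using m by blast
    qed
    then have "(\<Sum>T\<in>elems S. facet_flux z T S) = facet_flux z T S + facet_flux z T' S" using A(4) by simp
    then have "w \<bullet> (facet_flux z T S + facet_flux z T' S) = 0" for w using test[OF S(1,2), of w] S(3) by simp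
    then show "facet_flux z T S + facet_flux z T' S = 0" by (metis inner_eq_zero_iff)
  qed (rule E)
  moreover have "feasible_dual z" unfolding feasible_dual_def
  proof
    fix S assume S: "S \<in> SN"
    note b = boundary_side[OF UnI2[OF S]]
    have "S \<notin> SD" using boundary_disjoint S by blast
    then have "w \<bullet> (facet_flux z (bel S) S - area S *\<^sub>R gS S) = 0" for w
      using test[OF b(4), of w] S b(3) by (simp add: inner_diff_right inner_commute)
    then show "facet_flux z (bel S) S = area S *\<^sub>R gS S" by (metis inner_eq_zero_iff right_minus_eq)
  qed
  moreover have "\<phi> (bc T) (grad_h u (bc T)) + fenchel (\<phi> (bc T)) (z (bc T)) = ereal (grad_h u (bc T) \<bullet> z (bc T))" if T: "T \<in> \<T>" for T
    unfolding zb[OF T] P_def using fenchel_at_gradient[OF phi_proper[OF T] C(1)[OF T]] by (simp add: inner_commute)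
  moreover have "\<psi> (bc T) (u (bc T)) + fenchel (\<psi> (bc T)) (div_h z (bc T)) = ereal (u (bc T) \<bullet> div_h z (bc T))" if T: "T \<in> \<T>" for T
    unfolding zd[OF T] Q_def using fenchel_at_gradient[OF psi_proper[OF T] C(2)[OF T]] by (simp add: inner_commute)
  ultimately show "is_arg_max dual (\<lambda>y. y \<in> Z_rt \<T> \<Omega>) z" "primal u = dual z"
    using strong_duality[OF uU fu] by blast+
qed

text \<open>In \<open>test\<close> the optimality condition for fluxes through one side \<open>S0\<close> is rewritten by the Gauss
  formula on each element.  Opposite fluxes out of the two elements at an interior side give equality
  of the two side means of \<open>u\<close>; a flux through a Dirichlet side gives the boundary condition.\<close>

lemma primal_reconstruction:
  assumes C: "\<And>T. T \<in> \<T> \<Longrightarrow> C1 (fenchel (\<phi> (bc T)))" "\<And>T. T \<in> \<T> \<Longrightarrow> C1 (fenchel (\<psi> (bc T)))"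
    and z: "is_arg_max dual (\<lambda>y. y \<in> Z_rt \<T> \<Omega>) z"
  defines "u \<equiv> \<lambda>x. gradient (fenchel (\<psi> x)) (div_h z x) + gradient (fenchel (\<phi> x)) (Pi_h \<T> z x) *v (x - Pi_h \<T> (\<lambda>x. x) x)"
  shows "is_arg_min primal (\<lambda>v. v \<in> U_cr \<T> \<Omega>) u" "primal u = dual z"
proof -
  have zZ: "z \<in> Z_rt \<T> \<Omega>" using z by (simp add: is_arg_max_def)
  have fz: "feasible_dual z" by (rule maximizer_feasible[OF C z])
  define P where "P = (\<lambda>T. gradient (fenchel (\<phi> (bc T))) (z (bc T)))"
  define Q where "Q = (\<lambda>T. gradient (fenchel (\<psi> (bc T))) (div_h z (bc T)))"
  have u: "u x = (Q T - P T *v bc T) + P T *v x" if T: "T \<in> \<T>" "x \<in> interior T" for T x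
    unfolding u_def P_def Q_def using elem_rt_facts(3,4)[OF T(1) Z_rt_elem[OF zZ T(1)] T(2)] phi_elem[OF T] psi_elem[OF T] Pi_h_id[OF T]
    by (simp add: matrix_vector_mult_diff_distrib)
  have E: "elem_affine T u" if "T \<in> \<T>" for T unfolding elem_affine_def using u[OF that] by blast
  have ub: "u (bc T) = Q T" if "T \<in> \<T>" for T using u[OF that elem_simps(4)[OF that]] by simp
  have ug: "grad_h u (bc T) = P T" if "T \<in> \<T>" for T using grad_h_affine[OF elem_simps(4)[OF that] u[OF that]] by simp
  have test: "(\<Sum>T\<in>elems S0. facet_val u T S0 \<bullet> f T) = (if S0 \<in> SD then f (bel S0) \<bullet> uS S0 else 0)"
    if S0: "S0 \<in> sides \<T>" "S0 \<notin> SN"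
      and anti: "\<And>T T'. S0 \<in> sides_in \<T> \<Omega> \<Longrightarrow> T \<in> elems S0 \<Longrightarrow> T' \<in> elems S0 \<Longrightarrow> T \<noteq> T' \<Longrightarrow> f T + f T' = 0" for S0 f
  proof -
    \<comment> \<open>the field that only flows through \<open>S0\<close>\<close>
    define F where "F = (\<lambda>T S. if S = S0 then f T else 0)"
    have F0: "F T S = 0" if "S \<in> SN" for T S using that S0(2) by (auto simp: F_def)
    have FA: "F T S + F T' S = 0" if "S \<in> sides_in \<T> \<Omega>" "T \<in> \<T>" "T' \<in> \<T>" "T \<noteq> T'" "S facet_of T" "S facet_of T'" for S T T'
      using anti[of T T'] that by (auto simp: F_def elems_def)
    have "(\<Sum>T\<in>\<T>. \<Sum>S | S facet_of T. facet_val u T S \<bullet> F T S) = (\<Sum>T\<in>elems S0. facet_val u T S0 \<bullet> F T S0)"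
      by (rule sum_sides_test[OF S0(1)]) (simp add: F_def)
    also have "\<dots> = (\<Sum>T\<in>elems S0. facet_val u T S0 \<bullet> f T)" by (simp add: F_def)
    finally have "(\<Sum>T\<in>elems S0. facet_val u T S0 \<bullet> f T) = (\<Sum>T\<in>\<T>. \<Sum>S | S facet_of T. facet_val u T S \<bullet> F T S)" ..
    also have "\<dots> = (\<Sum>T\<in>\<T>. \<Sum>S | S facet_of T. facet_val u T S \<bullet> facet_flux (rt_fun F) T S)"
      by (intro sum.cong refl) (simp add: rt_fun_elem(2))
    also have "\<dots> = (\<Sum>T\<in>\<T>. vol T * (rt_fun F (bc T) \<bullet> P T + div_h (rt_fun F) (bc T) \<bullet> Q T))"
      by (intro sum.cong refl) (simp add: integration_by_parts_elem ub ug inner_commute)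
    also have "\<dots> = (\<Sum>S\<in>SD. F (bel S) S \<bullet> uS S)"
      unfolding P_def Q_def by (rule dual_optimality[OF C z F0 FA])
    also have "\<dots> = (\<Sum>S\<in>SD. if S = S0 then f (bel S0) \<bullet> uS S0 else 0)"
      by (intro sum.cong refl) (simp add: F_def)
    also have "\<dots> = (if S0 \<in> SD then f (bel S0) \<bullet> uS S0 else 0)" using finite_SD by simp
    finally show ?thesis .
  qed
  have "u \<in> U_cr \<T> \<Omega>" unfolding U_cr_iff
  proof (intro conjI ballI impI)
    fix S T T' assume A: "S \<in> sides_in \<T> \<Omega>" "T \<in> \<T>" "T' \<in> \<T>" "T \<noteq> T' \<and> S facet_of T \<and> S facet_of T'"
    have S: "S \<in> sides \<T>" "S \<notin> SD" "S \<notin> SN" using A(1) boundary_side(5) by (auto simp: sides_in_def)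
    have el: "elems S = {T, T'}"
    proof -
      have m: "T \<in> elems S" "T' \<in> elems S" using A by (auto simp: elems_def)
      have "T'' = T \<or> T'' = T'" if "T'' \<in> elems S" for T'' using at_most_two[OF m that] A(4) by blast
      then show ?thesis using m by blast
    qed
    have "(facet_val u T S - facet_val u T' S) \<bullet> w = 0" for w
    proof -
      \<comment> \<open>Fluxes of a Raviart-Thomas field through an interior side must be opposite.\<close>
      let ?f = "\<lambda>T''. if T'' = T then w else - w"
      have "(\<Sum>T\<in>elems S. facet_val u T S \<bullet> ?f T) = (if S \<in> SD then ?f (bel S) \<bullet> uS S else 0)"
        by (rule test[OF S(1,3)]) (auto simp: el)
      moreover have "(\<Sum>T\<in>elems S. facet_val u T S \<bullet> ?f T) = (facet_val u T S - facet_val u T' S) \<bullet> w"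
        using A(4) by (auto simp: el inner_diff_left)
      ultimately show ?thesis using S(2) by simp
    qed
    then show "facet_val u T S = facet_val u T' S" by (metis inner_eq_zero_iff right_minus_eq)
  qed (rule E)
  moreover have "feasible_primal u" unfolding feasible_primal_def
  proof
    fix S assume S: "S \<in> SD"
    note b = boundary_side[OF UnI1[OF S]]
    have "S \<notin> SN" using boundary_disjoint S by blast
    then have "(facet_val u (bel S) S - uS S) \<bullet> w = 0" for w
      using test[OF b(4), of "\<lambda>_. w"] S b(3,5) by (simp add: inner_diff_right inner_commute)
    then show "facet_val u (bel S) S = uS S" by (metis inner_eq_zero_iff right_minus_eq)
  qed
  moreover have "\<phi> (bc T) (grad_h u (bc T)) + fenchel (\<phi> (bc T)) (z (bc T)) = ereal (grad_h u (bc T) \<bullet> z (bc T))" if T: "T \<in> \<T>" for T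
    unfolding ug[OF T] P_def using fenchel_at_conjugate_gradient[OF phi_proper[OF T] C(1)[OF T]] by (simp add: inner_commute)
  moreover have "\<psi> (bc T) (u (bc T)) + fenchel (\<psi> (bc T)) (div_h z (bc T)) = ereal (u (bc T) \<bullet> div_h z (bc T))" if T: "T \<in> \<T>" for T
    unfolding ub[OF T] Q_def using fenchel_at_conjugate_gradient[OF psi_proper[OF T] C(2)[OF T]] by (simp add: inner_commute)
  ultimately show "is_arg_min primal (\<lambda>v. v \<in> U_cr \<T> \<Omega>) u" "primal u = dual z"
    using strong_duality[OF _ _ zZ fz] by blast+
qed

end
theorem proposition3p7:
  fixes \<Omega> \<Gamma>\<^sub>D \<Gamma>\<^sub>N :: "(real^'d) set"
    and \<T> :: "(real^'d) set set"
    and \<phi> :: "real^'d \<Rightarrow> real^'d^'l \<Rightarrow> ereal"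
    and \<psi> :: "real^'d \<Rightarrow> real^'l \<Rightarrow> ereal"
    and g u\<^sub>D :: "real^'d \<Rightarrow> real^'l"
  defines "I \<equiv> I_cr \<Omega> \<Gamma>\<^sub>D \<Gamma>\<^sub>N \<T> \<phi> \<psi> g u\<^sub>D"
    and "D \<equiv> D_rt \<Omega> \<Gamma>\<^sub>D \<Gamma>\<^sub>N \<T> \<phi> \<psi> g u\<^sub>D"
  assumes domain: "bounded_lipschitz_domain \<Omega>"
    and triangulation: "conforming_triangulation \<T> \<Omega>"
    and boundary: "\<Gamma>\<^sub>D \<union> \<Gamma>\<^sub>N = frontier \<Omega>" "\<Gamma>\<^sub>D \<inter> \<Gamma>\<^sub>N = {}"
    and dirichlet: "\<Gamma>\<^sub>D = {} \<or> surface_measure \<T> \<Omega> \<Gamma>\<^sub>D > 0"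
    and neumann: "\<Gamma>\<^sub>N = {} \<or> surface_measure \<T> \<Omega> \<Gamma>\<^sub>N > 0"
    and boundary_sides: "sides_in \<T> (frontier \<Omega>) \<subseteq> sides_in \<T> \<Gamma>\<^sub>D \<union> sides_in \<T> \<Gamma>\<^sub>N"
    and phi_range: "\<And>x r. x \<in> \<Omega> \<Longrightarrow> \<phi> x r \<noteq> -\<infinity>"
    and psi_range: "\<And>x s. x \<in> \<Omega> \<Longrightarrow> \<psi> x s \<noteq> -\<infinity>"
    and phi_convex: "AE x in lebesgue_on \<Omega>. proper_convex_lsc (\<phi> x)"
    and psi_convex: "AE x in lebesgue_on \<Omega>. proper_convex_lsc (\<psi> x)"
    and phi_const: "\<And>r. elementwise_constant \<T> (\<lambda>x. \<phi> x r)"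
    and psi_const: "\<And>s. elementwise_constant \<T> (\<lambda>x. \<psi> x s)"
    and g_const: "sidewise_constant (sides_in \<T> \<Gamma>\<^sub>N) g"
    and uD_const: "sidewise_constant (sides_in \<T> \<Gamma>\<^sub>D) u\<^sub>D"
    and minimizer_exists: "\<exists>u. is_arg_min I (\<lambda>v. v \<in> U_cr \<T> \<Omega>) u"
    and maximizer_exists: "\<exists>z. is_arg_max D (\<lambda>y. y \<in> Z_rt \<T> \<Omega>) z"
  shows
   "((AE x in lebesgue_on \<Omega>. C1 (\<phi> x)) \<and> (AE x in lebesgue_on \<Omega>. C1 (\<psi> x)) \<longrightarrow>
      (\<forall>u. is_arg_min I (\<lambda>v. v \<in> U_cr \<T> \<Omega>) u \<longrightarrow>
        (\<exists>z. is_arg_max D (\<lambda>y. y \<in> Z_rt \<T> \<Omega>) z \<and>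
          (AE x in lebesgue_on \<Omega>.
             z x = gradient (\<phi> x) (grad_h u x)
                   + ((1 / real CARD('d)) *\<^sub>R gradient (\<psi> x) (Pi_h \<T> u x))
                     \<otimes>\<^sub>t (x - Pi_h \<T> (\<lambda>x. x) x)) \<and>
          I u = D z)))
    \<and>
    ((AE x in lebesgue_on \<Omega>. C1 (fenchel (\<phi> x))) \<and> (AE x in lebesgue_on \<Omega>. C1 (fenchel (\<psi> x))) \<longrightarrow>
      (\<forall>z. is_arg_max D (\<lambda>y. y \<in> Z_rt \<T> \<Omega>) z \<longrightarrow>
        (\<exists>u. is_arg_min I (\<lambda>v. v \<in> U_cr \<T> \<Omega>) u \<and>
          (AE x in lebesgue_on \<Omega>.
             u x = gradient (fenchel (\<psi> x)) (div_h z x)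
                   + gradient (fenchel (\<phi> x)) (Pi_h \<T> z x) *v (x - Pi_h \<T> (\<lambda>x. x) x)) \<and>
          I u = D z)))"
proof -
  interpret fe_problem \<T> \<Omega> \<Gamma>\<^sub>D \<Gamma>\<^sub>N \<phi> \<psi> g u\<^sub>D
    by unfold_locales fact+
  show ?thesis
  proof (intro conjI impI allI; (elim conjE)?)
    fix u assume C: "AE x in lebesgue_on \<Omega>. C1 (\<phi> x)" "AE x in lebesgue_on \<Omega>. C1 (\<psi> x)"
      and u: "is_arg_min I (\<lambda>v. v \<in> U_cr \<T> \<Omega>) u"
    have "C1 (\<phi> (bc T))" "C1 (\<psi> (bc T))" if "T \<in> \<T>" for T
      using AE_elem[where P = C1 and F = \<phi>, OF that C(1)] AE_elem[where P = C1 and F = \<psi>, OF that C(2)] phi_elem psi_elem that by blast+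
    from dual_reconstruction[OF this u[unfolded I_def]]
    show "\<exists>z. is_arg_max D (\<lambda>y. y \<in> Z_rt \<T> \<Omega>) z \<and>
          (AE x in lebesgue_on \<Omega>. z x = gradient (\<phi> x) (grad_h u x)
                   + ((1 / real CARD('d)) *\<^sub>R gradient (\<psi> x) (Pi_h \<T> u x)) \<otimes>\<^sub>t (x - Pi_h \<T> (\<lambda>x. x) x)) \<and>
          I u = D z"
      unfolding I_def D_def by (intro exI conjI) (assumption | simp)+
  next
    fix z assume C: "AE x in lebesgue_on \<Omega>. C1 (fenchel (\<phi> x))" "AE x in lebesgue_on \<Omega>. C1 (fenchel (\<psi> x))"
      and z: "is_arg_max D (\<lambda>y. y \<in> Z_rt \<T> \<Omega>) z"
    have "C1 (fenchel (\<phi> (bc T)))" "C1 (fenchel (\<psi> (bc T)))" if "T \<in> \<T>" for T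
      using AE_elem[where P = "\<lambda>f. C1 (fenchel f)" and F = \<phi>, OF that C(1)]
        AE_elem[where P = "\<lambda>f. C1 (fenchel f)" and F = \<psi>, OF that C(2)] phi_elem psi_elem that by blast+
    from primal_reconstruction[OF this z[unfolded D_def]]
    show "\<exists>u. is_arg_min I (\<lambda>v. v \<in> U_cr \<T> \<Omega>) u \<and>
          (AE x in lebesgue_on \<Omega>. u x = gradient (fenchel (\<psi> x)) (div_h z x)
                   + gradient (fenchel (\<phi> x)) (Pi_h \<T> z x) *v (x - Pi_h \<T> (\<lambda>x. x) x)) \<and>
          I u = D z"
      unfolding I_def D_def by (intro exI conjI) (assumption | simp)+
  qed
qed

end
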